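(* Let $X$ be an Asplund space, let $\Omega_0,\Omega_1,\dots,\Omega_n\subseteq X$ be nonempty closed sets, and let $v_1,\dots,v_n\in X$ be nonzero vectors. Consider the problem $$\text{minimize } S(x):=\sum_{i=1}^nT_{v_i}(x;\Omega_i)\quad\text{subject to }x\in\Omega_0.$$ Suppose that $\bar x\in\Omega_0$ is an optimal solution of the problem and that $T_{v_i}(\cdot;\Omega_i)$ is Lipschitz continuous around $\bar x$ for all $i=1,\dots,n$. Then there exist $x_1^*,\dots,x_n^*\in X^*$ with the following properties: (1) $x_i^*\in N(\tilde x_i;\Omega_i)$, where $\tilde x_i:=\bar x+T_{v_i}(\bar x;\Omega_i)v_i$, for $i=1,\dots,n$. (2) $\langle x_i^*,-v_i\rangle\le1$ for all $i\in I(\bar x)$ and $\langle x_j^*,v_j\rangle=-1$ for all $j\in J(\bar x)$. (3) $-\sum_{i=1}^nx_i^*\in N(\bar x;\Omega_0)$. Here $N$ denotes the limiting (Mordukhovich) normal cone.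
   Context: An Asplund space is a Banach space all of whose separable closed subspaces have separable dual; here it is real. For a nonempty closed set $\Omega\subseteq X$ and nonzero $v\in X$, $T_v(x;\Omega):=\inf\{t\ge0\mid x+tv\in\Omega\}\in[0,\infty]$, with $\inf\emptyset=\infty$; when this is finite, $x+T_v(x;\Omega)v\in\Omega$. $I(\bar x):=\{i\in\{1,\dots,n\}\mid\bar x\in\Omega_i\}$ and $J(\bar x):=\{i\in\{1,\dots,n\}\mid\bar x\notin\Omega_i\}$. An optimal solution is a point of $\Omega_0$ minimizing $S$ over $\Omega_0$ (with finite value). A function is Lipschitz continuous around $\bar x$ if it is finite and Lipschitz on some neighborhood of $\bar x$. The Fréchet normal cone $\widehat N(y;\Omega)$ at $y\in\Omega$ is the set of $x^*\in X^*$ such that for every $\varepsilon>0$ there is $\delta>0$ with $\langle x^*,x-y\rangle\le\varepsilon\|x-y\|$ for all $x\in\Omega$ with $\|x-y\|\le\delta$. The limiting normal cone $N(y;\Omega)$ is the set of $x^*\in X^*$ for which there are sequences $x_k\to y$ with $x_k\in\Omega$, and $x_k^*\in\widehat N(x_k;\Omega)$ with $x_k^*\to x^*$ weak$^*$. *)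

theory Defs
  imports "HOL-Analysis.Analysis"
begin

text \<open>The topological dual of a closed subspace \<open>Y\<close>. Since \<open>Y\<close> is a set and not a type, its
  elements are represented by functions that are \<open>undefined\<close> outside \<open>Y\<close>, so that two functionals
  are equal iff they agree on \<open>Y\<close>.\<close>

definition dual_on :: "'a::real_normed_vector set \<Rightarrow> ('a \<Rightarrow> real) set" where
  "dual_on Y = {f \<in> extensional Y.
     (\<forall>x\<in>Y. \<forall>y\<in>Y. f (x + y) = f x + f y) \<and>
     (\<forall>c. \<forall>x\<in>Y. f (c *\<^sub>R x) = c * f x) \<and>
     (\<exists>K. \<forall>x\<in>Y. \<bar>f x\<bar> \<le> K * norm x)}"

text \<open>Separability for the dual norm: the last inequality says that the norm of \<open>f - g\<close> in the dual
  of \<open>Y\<close> is at most \<open>e\<close>.\<close>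

definition separable_dual_on :: "'a::real_normed_vector set \<Rightarrow> bool" where
  "separable_dual_on Y \<longleftrightarrow>
     (\<exists>D. countable D \<and> D \<subseteq> dual_on Y \<and>
        (\<forall>f\<in>dual_on Y. \<forall>e>0. \<exists>g\<in>D. \<forall>y\<in>Y. \<bar>f y - g y\<bar> \<le> e * norm y))"

definition asplund :: "'a::banach itself \<Rightarrow> bool" where
  "asplund _ \<longleftrightarrow>
     (\<forall>Y :: 'a set. subspace Y \<and> closed Y \<and> separable_space (top_of_set Y) \<longrightarrow>
        separable_dual_on Y)"

text \<open>In \<open>ereal\<close> the infimum of the empty set is \<open>\<infinity>\<close>.\<close>

definition min_time :: "'a::real_vector \<Rightarrow> 'a set \<Rightarrow> 'a \<Rightarrow> ereal" where
  "min_time v \<Omega> x = Inf (ereal ` {t. 0 \<le> t \<and> x + t *\<^sub>R v \<in> \<Omega>})"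

definition total_time ::
    "nat \<Rightarrow> (nat \<Rightarrow> 'a::real_vector) \<Rightarrow> (nat \<Rightarrow> 'a set) \<Rightarrow> 'a \<Rightarrow> ereal" where
  "total_time n v \<Omega> x = (\<Sum>i=1..n. min_time (v i) (\<Omega> i) x)"

definition optimal_solution :: "('a \<Rightarrow> ereal) \<Rightarrow> 'a set \<Rightarrow> 'a \<Rightarrow> bool" where
  "optimal_solution S \<Omega>\<^sub>0 x \<longleftrightarrow> x \<in> \<Omega>\<^sub>0 \<and> \<bar>S x\<bar> \<noteq> \<infinity> \<and> (\<forall>y\<in>\<Omega>\<^sub>0. S x \<le> S y)"

definition lipschitz_around :: "('a::metric_space \<Rightarrow> ereal) \<Rightarrow> 'a \<Rightarrow> bool" where
  "lipschitz_around f x \<longleftrightarrow>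
     (\<exists>\<delta>>0. \<exists>L. (\<forall>y\<in>ball x \<delta>. \<bar>f y\<bar> \<noteq> \<infinity>) \<and>
        L-lipschitz_on (ball x \<delta>) (\<lambda>y. real_of_ereal (f y)))"

definition idx_in :: "nat \<Rightarrow> (nat \<Rightarrow> 'a set) \<Rightarrow> 'a \<Rightarrow> nat set" where
  "idx_in n \<Omega> x = {i \<in> {1..n}. x \<in> \<Omega> i}"

definition idx_out :: "nat \<Rightarrow> (nat \<Rightarrow> 'a set) \<Rightarrow> 'a \<Rightarrow> nat set" where
  "idx_out n \<Omega> x = {i \<in> {1..n}. x \<notin> \<Omega> i}"

text \<open>Both normal cones are only meant for \<open>y \<in> \<Omega>\<close>; the Frechet cone is set to be empty elsewhere.\<close>

definition frechet_normal_cone ::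
    "'a::real_normed_vector \<Rightarrow> 'a set \<Rightarrow> ('a \<Rightarrow>\<^sub>L real) set" where
  "frechet_normal_cone y \<Omega> = {\<xi>. y \<in> \<Omega> \<and>
     (\<forall>\<epsilon>>0. \<exists>\<delta>>0. \<forall>x\<in>\<Omega>. norm (x - y) \<le> \<delta> \<longrightarrow>
        blinfun_apply \<xi> (x - y) \<le> \<epsilon> * norm (x - y))}"

text \<open>Sequential convergence in the weak* topology is pointwise convergence.\<close>

definition weak_star_tendsto ::
    "(nat \<Rightarrow> 'a::real_normed_vector \<Rightarrow>\<^sub>L real) \<Rightarrow> ('a \<Rightarrow>\<^sub>L real) \<Rightarrow> bool" where
  "weak_star_tendsto \<xi>s \<xi> \<longleftrightarrow>
     (\<forall>h. (\<lambda>k. blinfun_apply (\<xi>s k) h) \<longlonglongrightarrow> blinfun_apply \<xi> h)"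

definition limiting_normal_cone ::
    "'a::real_normed_vector \<Rightarrow> 'a set \<Rightarrow> ('a \<Rightarrow>\<^sub>L real) set" where
  "limiting_normal_cone y \<Omega> = {\<xi>. y \<in> \<Omega> \<and>
     (\<exists>x \<xi>s. x \<longlonglongrightarrow> y \<and>
        (\<forall>k. x k \<in> \<Omega> \<and> \<xi>s k \<in> frechet_normal_cone (x k) \<Omega>) \<and>
        weak_star_tendsto \<xi>s \<xi>)}"

end

theory Submission
  imports Defs
begin

text \<open>The key is a fuzzy sum rule: near a minimizer over \<open>\<Omega> 0\<close> of a sum of Lipschitz functions
  \<open>f i\<close> there are points carrying a Frechet normal to \<open>\<Omega> 0\<close> and Frechet subgradients of the \<open>f i\<close> with
  small sum. By compactness, Frechet subgradients found on a suitable separable subspace extend to the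
  whole space, so the rule is only needed where the dual is separable. There the sum is decoupled by a
  penalty that is differentiable from above, and a Borwein--Preiss argument gives exact minimizers of
  the penalized problem. A Frechet subgradient \<open>\<xi>\<close> of the minimal time function at \<open>x\<close> is a Frechet
  normal to the target at the point hit from \<open>x\<close>, and moving \<open>x\<close> along \<open>- v\<close> or \<open>v\<close> gives the bounds on
  \<open>\<xi> v\<close>. Bounded sequences in the dual have weak* convergent subsequences, so one can pass to the limit.\<close>

section \<open>Compactness and the Hahn--Banach theorem\<close>

text \<open>Two obstacles shape the argument. Frechet subgradients of a sum do not split exactly, so
  variables have to be separated and errors allowed. The penalty that does this is built from a
  countable dense set of functionals, which the Asplund property supplies only on separable
  subspaces. A functional obtained there says nothing off the subspace, and an arbitrary norm
  preserving extension need not remain a subgradient; hence the way back keeps the points but looks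
  for new functionals, as solutions of an infinite system of inequalities. The Asplund property is
  used a second time, independently: limiting normals are defined by sequences, so balls of the dual
  of the whole space must be weak* sequentially compact. The constraint is one more summand, the
  zero function restricted to \<open>\<Omega> 0\<close>, whose Frechet subgradients are Frechet
  normals. No Lipschitz constant bounds its functional; the bound comes from the other functionals
  and the small total sum.\<close>

lemma compact_box:
  fixes b :: "'i \<Rightarrow> real"
  shows "compact {\<xi>. \<forall>i. \<bar>\<xi> i\<bar> \<le> b i}"
proof -
  have "compactin (product_topology (\<lambda>i. euclidean) UNIV) (PiE UNIV (\<lambda>i. {- b i..b i}))"
    by (subst compactin_PiE) auto
  moreover have "PiE UNIV (\<lambda>i. {- b i..b i}) = {\<xi>. \<forall>i. \<bar>\<xi> i\<bar> \<le> b i}"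
    by (auto simp: PiE_def Pi_def abs_le_iff minus_le_iff)
  ultimately show ?thesis
    by (simp add: euclidean_product_topology)
qed

text \<open>Tychonoff in the role of Banach-Alaoglu: functionals with a pointwise bound are points
  of a product of intervals, and linearity is a closed condition there, so it can be one of the sets
  in \<open>\<C>\<close>.\<close>

lemma box_fip:
  fixes b :: "'i \<Rightarrow> real"
  assumes cl: "\<And>C. C \<in> \<C> \<Longrightarrow> closed C"
    and fin: "\<And>\<B>. finite \<B> \<Longrightarrow> \<B> \<subseteq> \<C> \<Longrightarrow> \<exists>\<xi>\<in>\<Inter>\<B>. \<forall>i. \<bar>\<xi> i\<bar> \<le> b i"
  shows "\<exists>\<xi>\<in>\<Inter>\<C>. \<forall>i. \<bar>\<xi> i\<bar> \<le> b i"
proof -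
  have "{\<xi>. \<forall>i. \<bar>\<xi> i\<bar> \<le> b i} \<inter> \<Inter>\<C> \<noteq> {}"
  proof (rule compact_imp_fip[OF compact_box])
    show "closed C" if "C \<in> \<C>" for C
      using cl that .
    show "{\<xi>. \<forall>i. \<bar>\<xi> i\<bar> \<le> b i} \<inter> \<Inter>\<B> \<noteq> {}" if "finite \<B>" "\<B> \<subseteq> \<C>" for \<B>
      using fin[OF that] by blast
  qed
  then show ?thesis by blast
qed

lemma bounded_linear_functional:
  fixes \<xi> :: "'a::real_normed_vector \<Rightarrow> real"
  assumes "\<And>x y. \<xi> (x + y) = \<xi> x + \<xi> y" "\<And>c x. \<xi> (c *\<^sub>R x) = c * \<xi> x"
    and "\<And>x. \<bar>\<xi> x\<bar> \<le> K * norm x" "0 \<le> K"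
  obtains \<zeta> :: "'a \<Rightarrow>\<^sub>L real" where "blinfun_apply \<zeta> = \<xi>" "norm \<zeta> \<le> K"
proof -
  have bl: "bounded_linear \<xi>"
    by (rule bounded_linear_intro[of _ K]) (use assms in \<open>auto simp: mult.commute\<close>)
  show ?thesis
  proof
    show *: "blinfun_apply (Blinfun \<xi>) = \<xi>"
      using bl by (rule bounded_linear_Blinfun_apply)
    show "norm (Blinfun \<xi>) \<le> K"
      by (rule norm_blinfun_bound) (use assms * in auto)
  qed
qed

lemma blinfun_le:
  fixes \<xi> :: "'a::real_normed_vector \<Rightarrow>\<^sub>L real"
  assumes "norm \<xi> \<le> K"
  shows "\<bar>blinfun_apply \<xi> x\<bar> \<le> K * norm x"
  using norm_blinfun[of \<xi> x] mult_right_mono[OF assms, of "norm x"] by simp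

definition sublinear :: "('a::real_vector \<Rightarrow> real) \<Rightarrow> bool" where
  "sublinear p \<longleftrightarrow> (\<forall>x y. p (x + y) \<le> p x + p y) \<and> (\<forall>c\<ge>0. \<forall>x. p (c *\<^sub>R x) = c * p x)"

lemma sublinear_neg: "sublinear p \<Longrightarrow> - p (- x) \<le> p x"
proof -
  assume p: "sublinear p"
  then have "p (0 *\<^sub>R x) = 0 * p x"
    unfolding sublinear_def by blast
  moreover have "p (x + - x) \<le> p x + p (- x)"
    using p unfolding sublinear_def by blast
  ultimately show ?thesis by simp
qed

text \<open>\<open>q\<close> is the largest sublinear minorant of \<open>p\<close> that is at most
  \<open>- p y\<close> at \<open>- y\<close>; the bound \<open>- p (- x)\<close> keeps the infimum
  finite. A minimal \<open>p\<close> must coincide with it and is therefore odd.\<close>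

lemma sublinear_shift:
  fixes p :: "'a::real_vector \<Rightarrow> real" and y :: 'a
  assumes p: "sublinear p"
  defines "q \<equiv> \<lambda>x. INF t\<in>{0..}. p (x + t *\<^sub>R y) - t * p y"
  shows "sublinear q" "q x \<le> p x" "q (- y) \<le> - p y"
proof -
  have sub: "p (a + b) \<le> p a + p b" and hom: "0 \<le> c \<Longrightarrow> p (c *\<^sub>R a) = c * p a" for a b c
    using p by (auto simp: sublinear_def)
  have bd: "bdd_below ((\<lambda>t. p (x + t *\<^sub>R y) - t * p y) ` {0..})" for x
  proof (rule bdd_belowI2)
    fix t :: real assume "t \<in> {0..}"
    then have "t * p y = p (t *\<^sub>R y)" using hom by simp
    also have "\<dots> \<le> p (x + t *\<^sub>R y) + p (- x)"
      using sub[of "x + t *\<^sub>R y" "- x"] by simp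
    finally show "- p (- x) \<le> p (x + t *\<^sub>R y) - t * p y" by simp
  qed
  have low: "q x \<le> p (x + t *\<^sub>R y) - t * p y" if "0 \<le> t" for x t
    unfolding q_def using bd that by (intro cINF_lower) auto
  have q_ge: "m \<le> q x" if "\<And>t. 0 \<le> t \<Longrightarrow> m \<le> p (x + t *\<^sub>R y) - t * p y" for m x
    unfolding q_def using that by (intro cINF_greatest) auto
  have p0: "p 0 = 0" using hom[of 0 0] by simp
  show "q x \<le> p x" using low[of 0 x] by simp
  show "q (- y) \<le> - p y" using low[of 1 "- y"] p0 by simp
  have q_add: "q (a + b) \<le> q a + q b" for a b
  proof -
    have "q (a + b) - (p (b + s *\<^sub>R y) - s * p y) \<le> q a" if "0 \<le> s" for s
    proof (rule q_ge)
      fix t :: real assume "0 \<le> t"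
      have "q (a + b) \<le> p ((a + t *\<^sub>R y) + (b + s *\<^sub>R y)) - (t + s) * p y"
        using low[of "t + s" "a + b"] \<open>0 \<le> t\<close> that by (simp add: algebra_simps)
      also have "\<dots> \<le> p (a + t *\<^sub>R y) + p (b + s *\<^sub>R y) - (t + s) * p y"
        using sub by simp
      finally show "q (a + b) - (p (b + s *\<^sub>R y) - s * p y) \<le> p (a + t *\<^sub>R y) - t * p y"
        by (simp add: algebra_simps)
    qed
    then have "q (a + b) - q a \<le> q b"
      by (intro q_ge) (simp add: algebra_simps)
    then show ?thesis by simp
  qed
  have q_le_hom: "q (c *\<^sub>R x) \<le> c * q x" if "0 < c" for c x
  proof -
    have "q (c *\<^sub>R x) / c \<le> q x"
    proof (rule q_ge)
      fix t :: real assume "0 \<le> t"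
      have "q (c *\<^sub>R x) \<le> p (c *\<^sub>R (x + t *\<^sub>R y)) - c * t * p y"
        using low[of "c * t" "c *\<^sub>R x"] that \<open>0 \<le> t\<close> by (simp add: algebra_simps)
      also have "\<dots> = c * (p (x + t *\<^sub>R y) - t * p y)"
        using hom[of c "x + t *\<^sub>R y"] that by (simp add: right_diff_distrib)
      finally show "q (c *\<^sub>R x) / c \<le> p (x + t *\<^sub>R y) - t * p y"
        using that by (simp add: field_simps)
    qed
    then show ?thesis using that by (simp add: field_simps)
  qed
  have q0: "q 0 = 0"
  proof (rule antisym)
    show "q 0 \<le> 0" using low[of 0 0] p0 by simp
    show "0 \<le> q 0" by (rule q_ge) (simp add: hom)
  qed
  have "q (c *\<^sub>R x) = c * q x" if "0 \<le> c" for c x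
  proof (cases "c = 0")
    case True then show ?thesis using q0 by simp
  next
    case False
    with that have c: "0 < c" by simp
    have "q x \<le> inverse c * q (c *\<^sub>R x)"
      using q_le_hom[of "inverse c" "c *\<^sub>R x"] c by simp
    with c q_le_hom[OF c, of x] show ?thesis by (simp add: field_simps)
  qed
  with q_add show "sublinear q" by (simp add: sublinear_def)
qed

text \<open>The common bound \<open>- p (- x)\<close> keeps the infimum finite. For subadditivity
  two members of the chain are compared and the smaller one is used at both points.\<close>

lemma sublinear_chain_inf:
  fixes C :: "('a::real_vector \<Rightarrow> real) set"
  assumes C: "C \<noteq> {}" "\<And>q. q \<in> C \<Longrightarrow> sublinear q \<and> (\<forall>x. q x \<le> p x)"
    and chain: "\<And>q r. q \<in> C \<Longrightarrow> r \<in> C \<Longrightarrow> (\<forall>x. q x \<le> r x) \<or> (\<forall>x. r x \<le> q x)"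
  defines "u \<equiv> \<lambda>x. INF q\<in>C. q x"
  shows "sublinear u" "q \<in> C \<Longrightarrow> u x \<le> q x"
proof -
  have bd: "bdd_below ((\<lambda>q. q x) ` C)" for x
  proof (rule bdd_belowI2)
    fix q assume "q \<in> C"
    with C(2)[of q] sublinear_neg[of q x] show "- p (- x) \<le> q x"
      by (metis neg_le_iff_le order_trans)
  qed
  have low: "u x \<le> q x" if "q \<in> C" for q x
    unfolding u_def using bd that by (intro cINF_lower) auto
  have ge: "m \<le> u x" if "\<And>q. q \<in> C \<Longrightarrow> m \<le> q x" for m x
    unfolding u_def using that C(1) by (intro cINF_greatest) auto
  show "q \<in> C \<Longrightarrow> u x \<le> q x" by (rule low)
  have sub: "q (a + b) \<le> q a + q b" and hom: "0 \<le> c \<Longrightarrow> q (c *\<^sub>R a) = c * q a"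
    if "q \<in> C" for q a b c
    using C(2)[OF that] by (auto simp: sublinear_def)
  have u_add: "u (a + b) \<le> u a + u b" for a b
  proof -
    have "u (a + b) - r b \<le> u a" if r: "r \<in> C" for r
    proof (rule ge)
      fix q assume q: "q \<in> C"
      consider "\<forall>x. q x \<le> r x" | "\<forall>x. r x \<le> q x" using chain q r by blast
      then show "u (a + b) - r b \<le> q a"
      proof cases
        case 1
        then show ?thesis using low[OF q, of "a + b"] sub[OF q, of a b] by (smt (verit))
      next
        case 2
        then show ?thesis using low[OF r, of "a + b"] sub[OF r, of a b] by (smt (verit))
      qed
    qed
    then have "u (a + b) - u a \<le> u b"
      by (intro ge) (simp add: algebra_simps)
    then show ?thesis by simp
  qed
  have u_hom: "u (c *\<^sub>R x) \<le> c * u x" if "0 < c" for c x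
  proof -
    have "u (c *\<^sub>R x) / c \<le> u x"
      by (rule ge) (use low hom that in \<open>fastforce simp: field_simps\<close>)
    then show ?thesis using that by (simp add: field_simps)
  qed
  have u0: "u 0 = 0"
  proof (rule antisym)
    have q0: "q 0 = 0" if "q \<in> C" for q using hom[OF that, of 0 0] by simp
    from C(1) obtain q where "q \<in> C" by blast
    with low[of q 0] q0[of q] show "u 0 \<le> 0" by simp
    show "0 \<le> u 0" by (rule ge) (simp add: q0)
  qed
  have "u (c *\<^sub>R x) = c * u x" if "0 \<le> c" for c x
  proof (cases "c = 0")
    case True then show ?thesis using u0 by simp
  next
    case False
    with that have c: "0 < c" by simp
    have "u x \<le> inverse c * u (c *\<^sub>R x)"
      using u_hom[of "inverse c" "c *\<^sub>R x"] c by simp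
    with c u_hom[OF c, of x] show ?thesis by (simp add: field_simps)
  qed
  with u_add show "sublinear u" by (simp add: sublinear_def)
qed

text \<open>A sublinear functional that is minimal below \<open>p\<close> is linear.\<close>

lemma hahn_banach_sublinear:
  assumes "sublinear p"
  obtains \<xi> where "linear \<xi>" "\<And>x. \<xi> x \<le> p x"
proof -
  let ?A = "{q. sublinear q \<and> (\<forall>x. q x \<le> p x)}"
  let ?P = "\<lambda>q r. \<forall>x. r x \<le> q x"
  have po: "partial_order_on ?A (relation_of ?P ?A)"
  proof (rule partial_order_on_relation_ofI)
    show "?P a c" if "?P a b" "?P b c" for a b c :: "'a \<Rightarrow> real"
    proof
      fix x
      show "c x \<le> a x" using that(1)[rule_format, of x] that(2)[rule_format, of x] by linarith
    qed
    show "a = b" if "?P a b" "?P b a" for a b :: "'a \<Rightarrow> real"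
      using that by (simp add: fun_eq_iff order_eq_iff)
  qed simp
  have "\<exists>u\<in>?A. \<forall>q\<in>C. ?P q u" if C: "C \<in> Chains (relation_of ?P ?A)" for C
  proof (cases "C = {}")
    case True
    then show ?thesis using assms by auto
  next
    case False
    have in_A: "sublinear q \<and> (\<forall>x. q x \<le> p x)" if "q \<in> C" for q
      using C that by (auto simp: Chains_def relation_of_def)
    have chain: "(\<forall>x. q x \<le> r x) \<or> (\<forall>x. r x \<le> q x)" if "q \<in> C" "r \<in> C" for q r
      using C that by (auto simp: Chains_def relation_of_def)
    have inf: "sublinear (\<lambda>x. INF q\<in>C. q x)" "q \<in> C \<Longrightarrow> (INF q\<in>C. q x) \<le> q x" for q x
      using sublinear_chain_inf[where C = C and p = p] False in_A chain by simp_all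
    obtain q where "q \<in> C" using False by blast
    have "(INF q\<in>C. q x) \<le> p x" for x
      by (rule order_trans[OF inf(2)[OF \<open>q \<in> C\<close>]]) (use in_A[OF \<open>q \<in> C\<close>] in simp)
    then show ?thesis
      by (intro bexI[of _ "\<lambda>x. INF q\<in>C. q x"] ballI allI inf(2)) (simp_all add: inf(1))
  qed
  from predicate_Zorn[OF po this] obtain m where m: "m \<in> ?A"
    and minimal: "\<And>a. a \<in> ?A \<Longrightarrow> \<forall>x. a x \<le> m x \<Longrightarrow> a = m" by blast
  have sl: "sublinear m" using m by simp
  have neg: "m (- y) \<le> - m y" for y
  proof -
    note sh = sublinear_shift[OF sl, where y = y]
    define q where "q = (\<lambda>x. INF t\<in>{0..}. m (x + t *\<^sub>R y) - t * m y)"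
    have q: "sublinear q" "q x \<le> m x" "q (- y) \<le> - m y" for x
      using sh unfolding q_def by blast+
    have "q x \<le> p x" for x
      by (rule order_trans[OF q(2)]) (use m in simp)
    with q have "q = m" by (intro minimal) auto
    with q(3) show ?thesis by simp
  qed
  have sub: "m (a + b) \<le> m a + m b" and hom: "0 \<le> c \<Longrightarrow> m (c *\<^sub>R a) = c * m a" for a b c
    using sl by (auto simp: sublinear_def)
  have minus: "m (- y) = - m y" for y
    using neg[of y] sublinear_neg[OF sl, of y] by linarith
  have "linear m"
  proof (rule linearI)
    show "m (a + b) = m a + m b" for a b
      using sub[of a b] sub[of "a + b" "- b"] minus[of b] by simp
    show "m (c *\<^sub>R a) = c *\<^sub>R m a" for c a
    proof (cases "0 \<le> c")
      case True then show ?thesis using hom by simp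
    next
      case False
      then show ?thesis using hom[of "- c" a] minus[of "c *\<^sub>R a"] by simp
    qed
  qed
  with m that show ?thesis by auto
qed

text \<open>A linear functional below the shift of the norm along \<open>u\<close> is at most
  \<open>- norm u\<close> at \<open>- u\<close>. Shifting first replaces the extension of a
  functional from the line through \<open>u\<close>.\<close>

lemma norming_functional:
  fixes u :: "'a::real_normed_vector"
  obtains \<xi> :: "'a \<Rightarrow>\<^sub>L real" where "norm \<xi> \<le> 1" "blinfun_apply \<xi> u = norm u"
proof -
  have sl: "sublinear (norm :: 'a \<Rightarrow> real)"
    by (simp add: sublinear_def norm_triangle_ineq)
  note sh = sublinear_shift[OF sl, where y = u]
  obtain \<xi> where lin: "linear \<xi>"
    and le: "\<And>x. \<xi> x \<le> (INF t\<in>{0..}. norm (x + t *\<^sub>R u) - t * norm u)"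
    using hahn_banach_sublinear[OF sh(1)] by metis
  have le_norm: "\<xi> x \<le> norm x" for x
    using le sh(2) by (rule order_trans)
  have abs: "\<bar>\<xi> x\<bar> \<le> 1 * norm x" for x
    using le_norm[of x] le_norm[of "- x"] linear_neg[OF lin, of x] by simp
  have "\<xi> (- u) \<le> - norm u" using le sh(3) by (rule order_trans)
  then have "\<xi> u = norm u"
    using linear_neg[OF lin, of u] le_norm[of u] by simp
  moreover obtain \<zeta> :: "'a \<Rightarrow>\<^sub>L real" where "blinfun_apply \<zeta> = \<xi>" "norm \<zeta> \<le> 1"
    by (rule bounded_linear_functional[of \<xi> 1])
      (use lin abs in \<open>auto simp: linear_add linear_scale\<close>)
  ultimately show ?thesis using that by metis
qed

section \<open>Weak* sequential compactness in the dual of an Asplund space\<close>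

text \<open>A Loewenheim-Skolem closure: \<open>G\<close> is applied to all finite subsets,
  countably often. A finite subset of the union already lies in one stage, and the next stage
  absorbs its image.\<close>

lemma countable_closing:
  fixes G :: "'a set \<Rightarrow> 'a set"
  assumes "countable C" and G: "\<And>F. finite F \<Longrightarrow> countable (G F)"
  obtains D where "countable D" "C \<subseteq> D" "\<And>F. finite F \<Longrightarrow> F \<subseteq> D \<Longrightarrow> G F \<subseteq> D"
proof -
  define E where "E = rec_nat C (\<lambda>_ D. D \<union> \<Union> (G ` {F. finite F \<and> F \<subseteq> D}))"
  have E0: "E 0 = C" and ES: "E (Suc k) = E k \<union> \<Union> (G ` {F. finite F \<and> F \<subseteq> E k})" for k
    by (simp_all add: E_def)
  have mono: "E k \<subseteq> E l" if "k \<le> l" for k l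
    by (rule lift_Suc_mono_le[OF _ that]) (auto simp: ES)
  have count: "countable (E k)" for k
  proof (induction k)
    case 0
    then show ?case using assms by (simp add: E0)
  next
    case (Suc k)
    then show ?case
      unfolding ES by (intro countable_Un countable_UN countable_Collect_finite_subset) (auto intro: G)
  qed
  have fin: "\<exists>k. F \<subseteq> E k" if "finite F" "F \<subseteq> (\<Union>k. E k)" for F
    using that
  proof (induction F rule: finite_induct)
    case empty
    then show ?case by simp
  next
    case (insert x F)
    then obtain k l where "F \<subseteq> E k" "x \<in> E l" by auto
    then have "insert x F \<subseteq> E (max k l)"
      using mono[of k "max k l"] mono[of l "max k l"] by auto
    then show ?case ..
  qed
  show ?thesis
  proof
    show "countable (\<Union>k. E k)" using count by blast
    show "C \<subseteq> (\<Union>k. E k)" using E0 by blast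
    fix F assume F: "finite F" "F \<subseteq> (\<Union>k. E k)"
    then obtain k where "F \<subseteq> E k" using fin by blast
    with F have "G F \<subseteq> E (Suc k)" unfolding ES by blast
    then show "G F \<subseteq> (\<Union>k. E k)" by blast
  qed
qed

text \<open>Only rational multiples can be demanded of a countable \<open>D\<close>; continuity of
  the operations and density of the rationals supply the rest in the closure.\<close>

lemma subspace_closure_rational:
  fixes D :: "'a::real_normed_vector set"
  assumes D: "0 \<in> D" "\<And>x y. x \<in> D \<Longrightarrow> y \<in> D \<Longrightarrow> x + y \<in> D"
    "\<And>q x. q \<in> \<rat> \<Longrightarrow> x \<in> D \<Longrightarrow> q *\<^sub>R x \<in> D"
  shows "subspace (closure D)"
proof (rule subspaceI)
  show "0 \<in> closure D" using D(1) closure_subset by blast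
  have "(\<lambda>(x, y). x + y) ` closure (D \<times> D) \<subseteq> closure D"
    by (rule image_closure_subset)
      (use D(2) closure_subset[of D] in \<open>auto intro!: continuous_intros simp: case_prod_beta\<close>)
  then show "x + y \<in> closure D" if "x \<in> closure D" "y \<in> closure D" for x y
    using that by (force simp: closure_Times)
  have "(\<lambda>(q, x). q *\<^sub>R x) ` closure (\<rat> \<times> D) \<subseteq> closure D"
    by (rule image_closure_subset)
      (use D(3) closure_subset[of D] in \<open>auto intro!: continuous_intros simp: case_prod_beta\<close>)
  then show "c *\<^sub>R x \<in> closure D" if "x \<in> closure D" for c x
    using that by (force simp: closure_Times Rats_closure_real)
qed

lemma separable_space_closure:
  fixes D :: "'a::metric_space set"
  assumes "countable D"
  shows "separable_space (top_of_set (closure D))"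
  unfolding separable_space_def
  by (rule exI[of _ D]) (use assms closure_subset[of D] in
    \<open>auto simp: closure_of_subtopology Int_absorb1\<close>)

lemma restrict_in_dual_on:
  fixes \<xi> :: "'a::real_normed_vector \<Rightarrow>\<^sub>L real"
  assumes "subspace Y"
  shows "restrict (blinfun_apply \<xi>) Y \<in> dual_on Y"
  unfolding dual_on_def using assms blinfun_le[OF order_refl, of \<xi>]
  by (auto simp: subspace_add subspace_scale blinfun.add_right blinfun.scaleR_right)

text \<open>The points of \<open>C\<close> generate a separable closed subspace, and countably many
  functionals are dense in its dual. Two members of \<open>\<Phi>\<close> with the same
  \<open>\<delta> / 3\<close>-approximant would differ by at most \<open>2 * \<delta> / 3\<close> on
  \<open>C\<close>, so choosing approximants is injective.\<close>

lemma asplund_countable_separated: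
  fixes \<Phi> :: "('a::banach \<Rightarrow>\<^sub>L real) set"
  assumes asp: "asplund TYPE('a)" and C: "countable C" "C \<subseteq> cball 0 1" and "0 < \<delta>"
    and sep: "\<And>f g. f \<in> \<Phi> \<Longrightarrow> g \<in> \<Phi> \<Longrightarrow> f \<noteq> g \<Longrightarrow>
      \<exists>x\<in>C. \<delta> \<le> \<bar>blinfun_apply f x - blinfun_apply g x\<bar>"
  shows "countable \<Phi>"
proof -
  define G where "G F = (\<Union>x\<in>F. \<Union>y\<in>F. {x + y}) \<union> (\<Union>q\<in>\<rat>. \<Union>x\<in>F. {q *\<^sub>R x})" for F :: "'a set"
  have "countable (G F)" if "finite F" for F
    unfolding G_def using that
    by (intro countable_Un countable_UN countable_finite countable_rat) auto
  with C obtain D where D: "countable D" "insert 0 C \<subseteq> D"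
    and cl: "\<And>F. finite F \<Longrightarrow> F \<subseteq> D \<Longrightarrow> G F \<subseteq> D"
    using countable_closing[of "insert 0 C" G] by (metis countable_insert)
  define Y where "Y = closure D"
  have sub: "subspace Y"
    unfolding Y_def
  proof (rule subspace_closure_rational)
    show "x + y \<in> D" if "x \<in> D" "y \<in> D" for x y
      using cl[of "{x, y}"] that by (auto simp: G_def)
    show "q *\<^sub>R x \<in> D" if "q \<in> \<rat>" "x \<in> D" for q x
      using cl[of "{x}"] that by (auto simp: G_def)
  qed (use D in auto)
  have "separable_dual_on Y"
    using asp sub separable_space_closure[OF D(1)] unfolding asplund_def Y_def by auto
  then obtain E where E: "countable E"
    and dense: "\<And>f e. f \<in> dual_on Y \<Longrightarrow> 0 < e \<Longrightarrow> \<exists>g\<in>E. \<forall>y\<in>Y. \<bar>f y - g y\<bar> \<le> e * norm y"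
    unfolding separable_dual_on_def by blast
  have "\<exists>g\<in>E. \<forall>y\<in>Y. \<bar>blinfun_apply f y - g y\<bar> \<le> \<delta> / 3 * norm y" for f
    using dense[OF restrict_in_dual_on[OF sub, of f], of "\<delta> / 3"] \<open>0 < \<delta>\<close> by fastforce
  then obtain h where h: "\<And>f. h f \<in> E"
    "\<And>f y. y \<in> Y \<Longrightarrow> \<bar>blinfun_apply f y - h f y\<bar> \<le> \<delta> / 3 * norm y"
    by metis
  have "inj_on h \<Phi>"
  proof (rule inj_onI, rule ccontr)
    fix f g assume fg: "f \<in> \<Phi>" "g \<in> \<Phi>" "h f = h g" "f \<noteq> g"
    then obtain x where x: "x \<in> C" "\<delta> \<le> \<bar>blinfun_apply f x - blinfun_apply g x\<bar>"
      using sep by blast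
    have "x \<in> Y" "norm x \<le> 1"
      using x C D closure_subset[of D] by (auto simp: Y_def)
    moreover from this have "\<delta> / 3 * norm x \<le> \<delta> / 3" using \<open>0 < \<delta>\<close> by (simp add: mult_left_le)
    ultimately have "\<bar>blinfun_apply f x - h f x\<bar> \<le> \<delta> / 3" "\<bar>blinfun_apply g x - h g x\<bar> \<le> \<delta> / 3"
      using h(2)[of x f] h(2)[of x g] by linarith+
    moreover have "h f x = h g x" using fg(3) by simp
    ultimately show False using x(2) \<open>0 < \<delta>\<close> by linarith
  qed
  moreover have "countable (h ` \<Phi>)"
    using E h(1) by (meson countable_subset image_subsetI)
  ultimately show ?thesis by (rule countable_image_inj_on[rotated])
qed

lemma pointwise_limit_functional:
  fixes \<xi> :: "nat \<Rightarrow> 'a::real_normed_vector \<Rightarrow>\<^sub>L real"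
  assumes bd: "\<And>k. norm (\<xi> k) \<le> K" and conv: "\<And>x. convergent (\<lambda>k. blinfun_apply (\<xi> k) x)"
  obtains \<zeta> where "weak_star_tendsto \<xi> \<zeta>" "norm \<zeta> \<le> K"
proof -
  define z where "z x = lim (\<lambda>k. blinfun_apply (\<xi> k) x)" for x
  have lim: "(\<lambda>k. blinfun_apply (\<xi> k) x) \<longlonglongrightarrow> z x" for x
    using conv[of x] unfolding z_def by (simp add: convergent_LIMSEQ_iff)
  have "z (x + y) = z x + z y" for x y
    using lim[of "x + y"] tendsto_add[OF lim[of x] lim[of y]]
    by (simp add: blinfun.add_right LIMSEQ_unique)
  moreover have "z (c *\<^sub>R x) = c * z x" for c x
    using lim[of "c *\<^sub>R x"] tendsto_mult_left[OF lim[of x], of c]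
    by (simp add: blinfun.scaleR_right LIMSEQ_unique)
  moreover have "\<bar>z x\<bar> \<le> K * norm x" for x
    by (rule LIMSEQ_le_const2[OF tendsto_rabs[OF lim]]) (use blinfun_le[OF bd] in auto)
  moreover have "0 \<le> K" using bd[of 0] norm_ge_zero order_trans by blast
  ultimately obtain \<zeta> :: "'a \<Rightarrow>\<^sub>L real" where "blinfun_apply \<zeta> = z" "norm \<zeta> \<le> K"
    by (rule bounded_linear_functional)
  with lim show ?thesis by (intro that[of \<zeta>]) (simp_all add: weak_star_tendsto_def)
qed

text \<open>\<open>s\<close> is the upper limit of \<open>a\<close> along \<open>M\<close>.
  Infinitely many values are at least \<open>s - \<epsilon> / 4\<close> and only finitely many reach
  \<open>s + \<epsilon> / 4\<close>. If only finitely many were at most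
  \<open>s - \<epsilon> / 2\<close>, a tail would lie in an interval of length
  \<open>3 * \<epsilon> / 4\<close>, against the oscillation.\<close>

lemma split_oscillating:
  fixes a :: "nat \<Rightarrow> real"
  assumes M: "infinite M" and bd: "\<And>m. \<bar>a m\<bar> \<le> K" and "0 < \<epsilon>"
    and osc: "\<And>N. \<exists>m\<in>M. \<exists>n\<in>M. N \<le> m \<and> N \<le> n \<and> \<epsilon> < \<bar>a m - a n\<bar>"
  shows "\<exists>\<alpha> A B. A \<subseteq> M \<and> B \<subseteq> M \<and> infinite A \<and> infinite B \<and>
    (\<forall>m\<in>A. \<alpha> + \<epsilon> / 4 \<le> a m) \<and> (\<forall>m\<in>B. a m \<le> \<alpha>)"
proof -
  define U where "U = {c. infinite {m\<in>M. c \<le> a m}}"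
  have "- K \<in> U"
  proof -
    have "{m\<in>M. - K \<le> a m} = M" using bd by (auto simp: abs_le_iff minus_le_iff)
    then show ?thesis using M by (simp add: U_def)
  qed
  have bdd: "bdd_above U"
  proof (rule bdd_aboveI)
    fix c assume "c \<in> U"
    then obtain m where "c \<le> a m" unfolding U_def using not_finite_existsD by auto
    with bd[of m] show "c \<le> K" by simp
  qed
  define s where "s = Sup U"
  have "\<exists>c\<in>U. s - \<epsilon> / 4 < c"
    using less_cSup_iff[of U "s - \<epsilon> / 4"] bdd \<open>- K \<in> U\<close> \<open>0 < \<epsilon>\<close> unfolding s_def by auto
  then obtain c where c: "infinite {m\<in>M. c \<le> a m}" "s - \<epsilon> / 4 < c" by (auto simp: U_def)
  have "{m\<in>M. c \<le> a m} \<subseteq> {m\<in>M. s - \<epsilon> / 4 \<le> a m}" using c(2) by auto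
  with c(1) have up: "infinite {m\<in>M. s - \<epsilon> / 4 \<le> a m}" using infinite_super by blast
  have "s + \<epsilon> / 4 \<notin> U"
    using cSup_upper[OF _ bdd, of "s + \<epsilon> / 4"] \<open>0 < \<epsilon>\<close> unfolding s_def by auto
  then have fin: "finite {m\<in>M. s + \<epsilon> / 4 \<le> a m}" by (simp add: U_def)
  have low: "infinite {m\<in>M. a m \<le> s - \<epsilon> / 2}"
  proof
    assume "finite {m\<in>M. a m \<le> s - \<epsilon> / 2}"
    with fin have "finite ({m\<in>M. s + \<epsilon> / 4 \<le> a m} \<union> {m\<in>M. a m \<le> s - \<epsilon> / 2})" by simp
    then obtain N where N: "\<forall>m\<in>{m\<in>M. s + \<epsilon> / 4 \<le> a m} \<union> {m\<in>M. a m \<le> s - \<epsilon> / 2}. m < N"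
      unfolding finite_nat_set_iff_bounded by blast
    obtain m n where mn: "m \<in> M" "n \<in> M" "N \<le> m" "N \<le> n" "\<epsilon> < \<bar>a m - a n\<bar>"
      using osc by blast
    have "a m < s + \<epsilon> / 4" "s - \<epsilon> / 2 < a m" "a n < s + \<epsilon> / 4" "s - \<epsilon> / 2 < a n"
      using N mn by (force simp: not_le[symmetric])+
    with mn(5) show False by linarith
  qed
  show ?thesis
    by (rule exI[of _ "s - \<epsilon> / 2"], rule exI[of _ "{m\<in>M. s - \<epsilon> / 4 \<le> a m}"],
        rule exI[of _ "{m\<in>M. a m \<le> s - \<epsilon> / 2}"]) (use up low in auto)
qed

lemma closed_linear_functionals:
  "closed {\<xi> :: 'a::real_vector \<Rightarrow> real.
     (\<forall>x y. \<xi> (x + y) = \<xi> x + \<xi> y) \<and> (\<forall>c x. \<xi> (c *\<^sub>R x) = c * \<xi> x)}"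
  by (intro closed_Collect_conj closed_Collect_all closed_Collect_eq continuous_intros
      continuous_on_product_coordinates)

text \<open>Prefixes of a branch are reversed so that prolonging them by one bit is a
  \<open>#\<close>, matching the recursion for the nodes of the tree.\<close>

primrec prefix_rev :: "(nat \<Rightarrow> 'b) \<Rightarrow> nat \<Rightarrow> 'b list" where
  "prefix_rev b 0 = []"
| "prefix_rev b (Suc k) = b k # prefix_rev b k"

lemma prefix_rev_cong: "(\<And>j. j < k \<Longrightarrow> b j = b' j) \<Longrightarrow> prefix_rev b k = prefix_rev b' k"
  by (induction k) auto

lemma uncountable_nat_bool: "uncountable (UNIV :: (nat \<Rightarrow> bool) set)"
proof
  assume "countable (UNIV :: (nat \<Rightarrow> bool) set)"
  then have "range (from_nat_into (UNIV :: (nat \<Rightarrow> bool) set)) = UNIV"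
    by (intro range_from_nat_into) auto
  then obtain n where "from_nat_into UNIV n = (\<lambda>k. \<not> from_nat_into (UNIV :: (nat \<Rightarrow> bool) set) k k)"
    by (metis rangeE UNIV_I)
  then have "from_nat_into UNIV n n = (\<not> from_nat_into (UNIV :: (nat \<Rightarrow> bool) set) n n)"
    by (rule fun_cong)
  then show False by blast
qed

text \<open>The tree argument of Hagler and Johnson: if every subsequence oscillated by more than a fixed
  amount at some point of the unit ball, then repeated splitting would give a binary tree of points,
  and cluster points along its branches would form an uncountable separated set of functionals.\<close>

lemma asplund_non_oscillating:
  fixes \<xi> :: "nat \<Rightarrow> 'a::banach \<Rightarrow>\<^sub>L real"
  assumes asp: "asplund TYPE('a)" and bd: "\<And>k. norm (\<xi> k) \<le> K" and "0 < \<epsilon>" and M0: "infinite M0"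
  obtains M where "M \<subseteq> M0" "infinite M"
    "\<And>x. norm x \<le> 1 \<Longrightarrow> \<exists>N. \<forall>m\<in>M. \<forall>n\<in>M. N \<le> m \<longrightarrow> N \<le> n \<longrightarrow>
      \<bar>blinfun_apply (\<xi> m) x - blinfun_apply (\<xi> n) x\<bar> \<le> \<epsilon>"
proof (rule ccontr)
  assume "\<not> thesis"
  with that have no: "\<exists>x. norm x \<le> 1 \<and> (\<forall>N. \<exists>m\<in>M. \<exists>n\<in>M. N \<le> m \<and> N \<le> n \<and>
      \<epsilon> < \<bar>blinfun_apply (\<xi> m) x - blinfun_apply (\<xi> n) x\<bar>)" if "M \<subseteq> M0" "infinite M" for M
    using \<open>M \<subseteq> M0\<close> \<open>infinite M\<close> by (meson not_le)
  \<comment> \<open>The gap that the splitting of an oscillating sequence leaves between its two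
    parts.\<close>
  define \<delta> where "\<delta> = \<epsilon> / 4"
  have "0 < \<delta>" using \<open>0 < \<epsilon>\<close> by (simp add: \<delta>_def)
  have "\<exists>x \<alpha> A B. norm x \<le> 1 \<and> A \<subseteq> M \<and> B \<subseteq> M \<and> infinite A \<and> infinite B \<and>
      (\<forall>m\<in>A. \<alpha> + \<delta> \<le> blinfun_apply (\<xi> m) x) \<and> (\<forall>m\<in>B. blinfun_apply (\<xi> m) x \<le> \<alpha>)"
    if M: "M \<subseteq> M0" "infinite M" for M
  proof -
    obtain x where x: "norm x \<le> 1" and osc: "\<And>N. \<exists>m\<in>M. \<exists>n\<in>M. N \<le> m \<and> N \<le> n \<and>
      \<epsilon> < \<bar>blinfun_apply (\<xi> m) x - blinfun_apply (\<xi> n) x\<bar>"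
      using no[OF M] by blast
    from split_oscillating[OF M(2) blinfun_le[OF bd] \<open>0 < \<epsilon>\<close> osc] x show ?thesis
      unfolding \<delta>_def by blast
  qed
  then have ex: "\<exists>x \<alpha> A B. norm x \<le> 1 \<and> A \<subseteq> M \<and> B \<subseteq> M \<and> infinite A \<and> infinite B \<and>
      (\<forall>m\<in>A. \<alpha> + \<delta> \<le> blinfun_apply (\<xi> m) x) \<and> (\<forall>m\<in>B. blinfun_apply (\<xi> m) x \<le> \<alpha>)"
    if "M \<subseteq> M0" "infinite M" for M
    using that .
  define Q where "Q M t \<longleftrightarrow> (case t of (x, \<alpha>, A, B) \<Rightarrow> norm x \<le> 1 \<and> A \<subseteq> M \<and> B \<subseteq> M \<and>
      infinite A \<and> infinite B \<and> (\<forall>m\<in>A. \<alpha> + \<delta> \<le> blinfun_apply (\<xi> m) x) \<and>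
      (\<forall>m\<in>B. blinfun_apply (\<xi> m) x \<le> \<alpha>))" for M t
  have "\<exists>t. Q M t" if "M \<subseteq> M0" "infinite M" for M
    using ex[OF that] by (simp add: Q_def split_paired_Ex)
  then obtain f where f: "\<And>M. M \<subseteq> M0 \<Longrightarrow> infinite M \<Longrightarrow> Q M (f M)"
    by metis
  \<comment> \<open>\<open>X M\<close> is the splitting point of \<open>M\<close>,
    \<open>a M\<close> the level, and \<open>A M\<close>, \<open>B M\<close> are the upper and the
    lower part.\<close>
  define X a A B where "X M = fst (f M)" and "a M = fst (snd (f M))"
    and "A M = fst (snd (snd (f M)))" and "B M = snd (snd (snd (f M)))" for M
  have X: "norm (X M) \<le> 1"
    and AB: "A M \<subseteq> M \<and> B M \<subseteq> M \<and> infinite (A M) \<and> infinite (B M)"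
    and Aa: "m \<in> A M \<Longrightarrow> a M + \<delta> \<le> blinfun_apply (\<xi> m) (X M)"
    and Ba: "m \<in> B M \<Longrightarrow> blinfun_apply (\<xi> m) (X M) \<le> a M"
    if "M \<subseteq> M0" "infinite M" for M m
    using f[OF that] by (auto simp: Q_def X_def a_def A_def B_def split: prod.splits)
  define T where "T = rec_list M0 (\<lambda>b _ M. if b then A M else B M)"
  have T0: "T [] = M0" and TS: "T (b # s) = (if b then A (T s) else B (T s))" for b s
    by (simp_all add: T_def)
  have T: "T s \<subseteq> M0 \<and> infinite (T s)" for s
  proof (induction s)
    case Nil
    then show ?case using M0 by (simp add: T0)
  next
    case (Cons b s)
    then show ?case using AB[of "T s"] by (auto simp: TS)
  qed
  have T_mono: "T (prefix_rev b l) \<subseteq> T (prefix_rev b k)" if "k \<le> l" for b k l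
    by (rule lift_Suc_antimono_le[OF _ that]) (use T AB[OF T[THEN conjunct1] T[THEN conjunct2]] in \<open>simp add: TS\<close>)
  \<comment> \<open>The constraint of depth \<open>k\<close> along branch \<open>b\<close>: at the
    splitting point of the node reached so far, lie on the side of the gap that \<open>b k\<close>
    selects.\<close>
  define C where "C b k = {\<eta> :: 'a \<Rightarrow> real. let M = T (prefix_rev b k) in
      if b k then a M + \<delta> \<le> \<eta> (X M) else \<eta> (X M) \<le> a M}" for b k
  define L where "L = {\<eta> :: 'a \<Rightarrow> real.
     (\<forall>x y. \<eta> (x + y) = \<eta> x + \<eta> y) \<and> (\<forall>c x. \<eta> (c *\<^sub>R x) = c * \<eta> x)}"
  have \<xi>L: "blinfun_apply (\<xi> m) \<in> L" for m
    by (simp add: L_def blinfun.add_right blinfun.scaleR_right)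
  have "0 \<le> K" using bd[of 0] norm_ge_zero order_trans by blast
  have "\<exists>\<eta> :: 'a \<Rightarrow>\<^sub>L real. \<forall>k. blinfun_apply \<eta> \<in> C b k" for b
  proof -
    have "\<exists>\<eta>\<in>\<Inter>(insert L (range (C b))). \<forall>x. \<bar>\<eta> x\<bar> \<le> K * norm x"
    proof (rule box_fip)
      have "closed (C b k)" for k
        by (cases "b k") (auto simp: C_def Let_def intro!: closed_Collect_le continuous_intros)
      moreover have "closed L" unfolding L_def by (rule closed_linear_functionals)
      ultimately show "closed E" if "E \<in> insert L (range (C b))" for E using that by auto
      fix \<B> assume B: "finite \<B>" "\<B> \<subseteq> insert L (range (C b))"
      then obtain J where J: "finite J" "\<B> - {L} \<subseteq> C b ` J"
      proof -
        have "finite (\<B> - {L})" "\<B> - {L} \<subseteq> C b ` UNIV" using B by auto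
        from finite_subset_image[OF this] show ?thesis using that by auto
      qed
      obtain N where N: "\<And>k. k \<in> J \<Longrightarrow> k < N"
        using J(1) unfolding finite_nat_set_iff_bounded by blast
      \<comment> \<open>Nodes decrease along a branch, so an index taken at depth \<open>N\<close>
        satisfies the constraints of all smaller depths at once.\<close>
      obtain m where m: "m \<in> T (prefix_rev b N)"
        using T[of "prefix_rev b N"] infinite_imp_nonempty by blast
      have "blinfun_apply (\<xi> m) \<in> C b k" if "k \<in> J" for k
      proof -
        have "m \<in> T (prefix_rev b (Suc k))"
          using T_mono[of "Suc k" N b] N[OF that] m by auto
        then show ?thesis
          using T[of "prefix_rev b k"] Aa[of "T (prefix_rev b k)" m] Ba[of "T (prefix_rev b k)" m]
          by (auto simp: C_def TS Let_def split: if_splits)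
      qed
      then have "blinfun_apply (\<xi> m) \<in> E" if "E \<in> \<B>" for E
        using J(2) \<xi>L that by blast
      then show "\<exists>\<eta>\<in>\<Inter>\<B>. \<forall>x. \<bar>\<eta> x\<bar> \<le> K * norm x"
        using blinfun_le[OF bd] by (intro bexI[of _ "blinfun_apply (\<xi> m)"]) auto
    qed
    then obtain \<eta> where \<eta>: "\<eta> \<in> L" "\<And>k. \<eta> \<in> C b k" "\<And>x. \<bar>\<eta> x\<bar> \<le> K * norm x" by auto
    obtain \<zeta> :: "'a \<Rightarrow>\<^sub>L real" where "blinfun_apply \<zeta> = \<eta>"
      by (rule bounded_linear_functional[of \<eta> K]) (use \<eta> \<open>0 \<le> K\<close> in \<open>auto simp: L_def\<close>)
    with \<eta>(2) show ?thesis by metis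
  qed
  then obtain \<eta> :: "(nat \<Rightarrow> bool) \<Rightarrow> 'a \<Rightarrow>\<^sub>L real" where \<eta>: "\<And>b k. blinfun_apply (\<eta> b) \<in> C b k"
    by metis
  have sep: "\<exists>x\<in>range (\<lambda>s. X (T s)). \<delta> \<le> \<bar>blinfun_apply (\<eta> b) x - blinfun_apply (\<eta> b') x\<bar>"
    if "b \<noteq> b'" for b b'
  proof -
    \<comment> \<open>At the first disagreement both branches are still in the same node; they share
      its splitting point and level and choose opposite sides of the gap.\<close>
    define k where "k = (LEAST k. b k \<noteq> b' k)"
    have k: "b k \<noteq> b' k" unfolding k_def by (rule LeastI_ex) (use that in auto)
    have "b j = b' j" if "j < k" for j using not_less_Least[OF that[unfolded k_def]] by simp
    then have "prefix_rev b k = prefix_rev b' k" by (rule prefix_rev_cong)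
    with \<eta>[of b k] \<eta>[of b' k] k
    have "\<delta> \<le> \<bar>blinfun_apply (\<eta> b) (X (T (prefix_rev b k))) - blinfun_apply (\<eta> b') (X (T (prefix_rev b k)))\<bar>"
      by (auto simp: C_def Let_def split: if_splits)
    then show ?thesis by blast
  qed
  then have inj: "inj \<eta>"
    using \<open>0 < \<delta>\<close> by (intro injI) (metis abs_zero diff_self not_less)
  have "countable (range \<eta>)"
  proof (rule asplund_countable_separated[OF asp])
    show "countable (range (\<lambda>s. X (T s)))" "range (\<lambda>s. X (T s)) \<subseteq> cball 0 1"
      using X T by auto
    show "\<exists>x\<in>range (\<lambda>s. X (T s)). \<delta> \<le> \<bar>blinfun_apply f x - blinfun_apply g x\<bar>"
      if fg: "f \<in> range \<eta>" "g \<in> range \<eta>" "f \<noteq> g" for f g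
    proof -
      obtain b where f: "f = \<eta> b" using fg(1) by (rule rangeE)
      obtain b' where g: "g = \<eta> b'" using fg(2) by (rule rangeE)
      have "b \<noteq> b'" using fg(3) unfolding f g by blast
      from sep[OF this] show ?thesis unfolding f g .
    qed
  qed (fact \<open>0 < \<delta>\<close>)
  with inj have "countable (UNIV :: (nat \<Rightarrow> bool) set)" using countable_image_inj_on by blast
  with uncountable_nat_bool show False by blast
qed

text \<open>Nested index sets with oscillation tending to zero, then a diagonal choice, give
  pointwise Cauchy sequences. Compactness of the dual ball alone would only yield convergent
  nets.\<close>

lemma asplund_weak_star_subseq:
  fixes \<xi> :: "nat \<Rightarrow> 'a::banach \<Rightarrow>\<^sub>L real"
  assumes asp: "asplund TYPE('a)" and bd: "\<And>k. norm (\<xi> k) \<le> K"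
  obtains r \<zeta> where "strict_mono r" "weak_star_tendsto (\<xi> \<circ> r) \<zeta>" "norm \<zeta> \<le> K"
proof -
  define small where "small k M \<longleftrightarrow> (\<forall>x. norm x \<le> 1 \<longrightarrow> (\<exists>N. \<forall>m\<in>M. \<forall>n\<in>M. N \<le> m \<longrightarrow> N \<le> n \<longrightarrow>
      \<bar>blinfun_apply (\<xi> m) x - blinfun_apply (\<xi> n) x\<bar> \<le> inverse (Suc k)))" for k :: nat and M
  have "\<exists>M. \<forall>k. (infinite (M k) \<and> small k (M k)) \<and> M (Suc k) \<subseteq> M k"
  proof (rule dependent_nat_choice)
    have ex: "\<exists>M'. (infinite M' \<and> small k M') \<and> M' \<subseteq> M" if "infinite M" for M k
    proof -
      obtain M' where "M' \<subseteq> M" "infinite M'"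
        "\<And>x. norm x \<le> 1 \<Longrightarrow> \<exists>N. \<forall>m\<in>M'. \<forall>n\<in>M'. N \<le> m \<longrightarrow> N \<le> n \<longrightarrow>
          \<bar>blinfun_apply (\<xi> m) x - blinfun_apply (\<xi> n) x\<bar> \<le> inverse (Suc k)"
        by (rule asplund_non_oscillating[where \<xi> = \<xi> and \<epsilon> = "inverse (Suc k)", OF asp bd _ \<open>infinite M\<close>]) simp_all
      then show ?thesis unfolding small_def by blast
    qed
    show "\<exists>M. infinite M \<and> small 0 M" using ex[of UNIV 0] by auto
    show "\<exists>M'. (infinite M' \<and> small (Suc k) M') \<and> M' \<subseteq> M" if "infinite M \<and> small k M" for M k
      using ex that by blast
  qed
  then obtain M where M: "\<And>k. infinite (M k)" "\<And>k. small k (M k)" "\<And>k. M (Suc k) \<subseteq> M k" by blast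
  have M_mono: "M l \<subseteq> M k" if "k \<le> l" for k l
    using lift_Suc_antimono_le[OF _ that, of M] M(3) by blast
  \<comment> \<open>The diagonal stays in \<open>M k\<close> from position \<open>k\<close> on and,
    being strictly increasing, passes every threshold \<open>N\<close>.\<close>
  have "\<exists>r. \<forall>k. r k \<in> M k \<and> r k < r (Suc k)"
  proof (rule dependent_nat_choice)
    show "\<exists>n. n \<in> M 0" using infinite_imp_nonempty[OF M(1)[of 0]] by blast
    show "\<exists>n. n \<in> M (Suc k) \<and> m < n" for m k
      using M(1)[of "Suc k"] unfolding infinite_nat_iff_unbounded by blast
  qed
  then obtain r where r: "\<And>k. r k \<in> M k" "\<And>k. r k < r (Suc k)" by blast
  have sm: "strict_mono r" using r(2) by (simp add: strict_mono_Suc_iff)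
  have conv1: "convergent (\<lambda>k. blinfun_apply (\<xi> (r k)) x)" if x: "norm x \<le> 1" for x
  proof (rule Cauchy_convergent, rule metric_CauchyI)
    fix e :: real assume "0 < e"
    then obtain k where k: "inverse (real (Suc k)) < e" using reals_Archimedean by blast
    obtain N where N: "\<And>m n. m \<in> M k \<Longrightarrow> n \<in> M k \<Longrightarrow> N \<le> m \<Longrightarrow> N \<le> n \<Longrightarrow>
      \<bar>blinfun_apply (\<xi> m) x - blinfun_apply (\<xi> n) x\<bar> \<le> inverse (Suc k)"
      using M(2)[of k] x unfolding small_def by blast
    have "dist (blinfun_apply (\<xi> (r i)) x) (blinfun_apply (\<xi> (r j)) x) < e"
      if "max k N \<le> i" "max k N \<le> j" for i j
    proof -
      have "r i \<in> M k" "r j \<in> M k" using r(1) M_mono that by (meson in_mono max.bounded_iff)+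
      moreover have "N \<le> r i" "N \<le> r j" using seq_suble[OF sm] that by (meson le_trans max.bounded_iff)+
      ultimately show ?thesis using N k by (fastforce simp: dist_real_def)
    qed
    then show "\<exists>n0. \<forall>i\<ge>n0. \<forall>j\<ge>n0. dist (blinfun_apply (\<xi> (r i)) x) (blinfun_apply (\<xi> (r j)) x) < e"
      by blast
  qed
  have "convergent (\<lambda>k. blinfun_apply ((\<xi> \<circ> r) k) x)" for x
  proof -
    have "convergent (\<lambda>k. norm x * blinfun_apply (\<xi> (r k)) (inverse (norm x) *\<^sub>R x))"
      by (intro convergent_mult convergent_const conv1) (cases "x = 0"; simp)
    then show ?thesis by (cases "x = 0") (simp_all add: blinfun.scaleR_right convergent_const mult.assoc[symmetric])
  qed
  then obtain \<zeta> where "weak_star_tendsto (\<xi> \<circ> r) \<zeta>" "norm \<zeta> \<le> K"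
    using pointwise_limit_functional[of "\<xi> \<circ> r" K] bd by auto
  with sm that show ?thesis by blast
qed

section \<open>Separable reduction of Frechet subgradients\<close>

text \<open>For \<open>x\<close> in \<open>A\<close> this is a Frechet subgradient of
  \<open>f\<close> plus the indicator function of \<open>A\<close>, and a Frechet normal when
  \<open>f\<close> is constant. \<open>\<xi>\<close> is a plain function because it may be
  controlled on a subspace only.\<close>

definition fsub_on :: "'a::real_normed_vector set \<Rightarrow> ('a \<Rightarrow> real) \<Rightarrow> 'a \<Rightarrow> ('a \<Rightarrow> real) \<Rightarrow> bool" where
  "fsub_on A f x \<xi> \<longleftrightarrow> (\<forall>\<epsilon>>0. \<exists>\<delta>>0. \<forall>z\<in>A. norm (z - x) \<le> \<delta> \<longrightarrow> \<xi> (z - x) \<le> f z - f x + \<epsilon> * norm (z - x))"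

lemma fsub_onI:
  "(\<And>\<epsilon>. 0 < \<epsilon> \<Longrightarrow> \<exists>\<delta>>0. \<forall>z\<in>A. norm (z - x) \<le> \<delta> \<longrightarrow> \<xi> (z - x) \<le> f z - f x + \<epsilon> * norm (z - x)) \<Longrightarrow> fsub_on A f x \<xi>"
  by (simp add: fsub_on_def)

lemma fsub_onD:
  assumes "fsub_on A f x \<xi>" "0 < \<epsilon>"
  obtains \<delta> where "0 < \<delta>" "\<And>z. z \<in> A \<Longrightarrow> norm (z - x) \<le> \<delta> \<Longrightarrow> \<xi> (z - x) \<le> f z - f x + \<epsilon> * norm (z - x)"
  using assms unfolding fsub_on_def by metis

lemma closed_Collect_ball:
  "(\<And>x. x \<in> A \<Longrightarrow> closed {\<xi>. P x \<xi>}) \<Longrightarrow> closed {\<xi>. \<forall>x\<in>A. P x \<xi>}"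
  by (simp add: Collect_ball_eq closed_INT)

lemma closed_Collect_impl:
  "(Q \<Longrightarrow> closed {\<xi>. P \<xi>}) \<Longrightarrow> closed {\<xi>. Q \<longrightarrow> P \<xi>}"
  by (cases Q) auto

text \<open>That \<open>\<xi>\<close> is a Frechet subgradient at \<open>x\<close> is encoded by inequalities
  \<open>\<xi> (z - d) \<le> f z + c\<close> on balls around points \<open>d\<close> near \<open>x\<close>, with \<open>d\<close> in a countable set and rational
  radius and \<open>c\<close>. By compactness a finite system of such inequalities has no solution only if it has
  none on a finite set of vectors. Closing a countable set under such finite sets gives a
  separable subspace \<open>Y\<close>, and every system that is solvable on \<open>Y\<close> is solvable on the whole space.\<close>

lemma separable_reduction:
  fixes Dom :: "nat \<Rightarrow> 'a::real_normed_vector set" and f :: "nat \<Rightarrow> 'a \<Rightarrow> real" and p :: 'a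
  assumes "0 \<le> K" "0 \<le> \<epsilon>"
  obtains Y where "subspace Y" "closed Y" "separable_space (top_of_set Y)" "p \<in> Y"
    "\<And>x y. \<lbrakk>\<And>i. i \<le> n \<Longrightarrow> x i \<in> Y;
       \<And>i a b. i \<le> n \<Longrightarrow> a \<in> Y \<Longrightarrow> b \<in> Y \<Longrightarrow> y i (a + b) = y i a + y i b;
       \<And>i c a. i \<le> n \<Longrightarrow> a \<in> Y \<Longrightarrow> y i (c *\<^sub>R a) = c * y i a;
       \<And>i a. i \<le> n \<Longrightarrow> a \<in> Y \<Longrightarrow> \<bar>y i a\<bar> \<le> K * norm a;
       \<And>a. a \<in> Y \<Longrightarrow> \<bar>\<Sum>i\<le>n. y i a\<bar> \<le> \<epsilon> * norm a;
       \<And>i. i \<le> n \<Longrightarrow> fsub_on (Dom i \<inter> Y) (f i) (x i) (y i)\<rbrakk> \<Longrightarrow>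
     \<exists>\<xi>. (\<forall>i\<le>n. norm (\<xi> i) \<le> K \<and> fsub_on (Dom i) (f i) (x i) (blinfun_apply (\<xi> i))) \<and>
        norm (\<Sum>i\<le>n. \<xi> i) \<le> \<epsilon>"
proof -
  \<comment> \<open>All \<open>n + 1\<close> functionals together are one point of a product indexed
    by pairs. \<open>P1\<close> is imposed everywhere, the other conditions only inside
    \<open>Z\<close>: extension by zero off \<open>Y\<close> preserves the former but need not be
    linear.\<close>
  define P1 where "P1 \<xi> \<longleftrightarrow> (\<forall>h. \<bar>\<Sum>i\<le>n. \<xi> (i, h)\<bar> \<le> \<epsilon> * norm h)"
    for \<xi> :: "nat \<times> 'a \<Rightarrow> real"
  define P2 where "P2 Z \<xi> \<longleftrightarrow> (\<forall>i. \<forall>a\<in>Z. \<forall>b\<in>Z. a + b \<in> Z \<longrightarrow> \<xi> (i, a + b) = \<xi> (i, a) + \<xi> (i, b))"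
    for Z and \<xi> :: "nat \<times> 'a \<Rightarrow> real"
  define P3 where "P3 Z \<xi> \<longleftrightarrow> (\<forall>i c. \<forall>a\<in>Z. c *\<^sub>R a \<in> Z \<longrightarrow> \<xi> (i, c *\<^sub>R a) = c * \<xi> (i, a))"
    for Z and \<xi> :: "nat \<times> 'a \<Rightarrow> real"
  define P4 where "P4 Z \<F> \<xi> \<longleftrightarrow> (\<forall>B\<in>\<F>. case B of (i, d, r, c) \<Rightarrow>
      \<forall>z\<in>Dom i \<inter> Z. norm (z - d) < r \<longrightarrow> z - d \<in> Z \<longrightarrow> \<xi> (i, z - d) \<le> f i z + c)"
    for Z \<F> and \<xi> :: "nat \<times> 'a \<Rightarrow> real"
  define S where "S Z \<F> = {\<xi>. P1 \<xi> \<and> P2 Z \<xi> \<and> P3 Z \<xi> \<and> P4 Z \<F> \<xi>}" for Z \<F>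
  define box where "box \<xi> \<longleftrightarrow> (\<forall>j. \<bar>\<xi> j\<bar> \<le> K * norm (snd j))" for \<xi> :: "nat \<times> 'a \<Rightarrow> real"
  have anti: "S Z' \<F>' \<subseteq> S Z \<F>" if "Z \<subseteq> Z'" "\<F> \<subseteq> \<F>'" for Z Z' \<F> \<F>'
  proof -
    have "P2 Z' \<xi> \<Longrightarrow> P2 Z \<xi>" for \<xi> unfolding P2_def using that(1) by (meson subsetD)
    moreover have "P3 Z' \<xi> \<Longrightarrow> P3 Z \<xi>" for \<xi> unfolding P3_def using that(1) by (meson subsetD)
    moreover have "P4 Z' \<F>' \<xi> \<Longrightarrow> P4 Z \<F> \<xi>" for \<xi> unfolding P4_def using that by fast
    ultimately show ?thesis unfolding S_def by blast
  qed
  have closedS: "closed (S Z \<F>)" for Z \<F>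
    unfolding S_def P1_def P2_def P3_def P4_def case_prod_beta
    by (intro closed_Collect_conj closed_Collect_all closed_Collect_ball closed_Collect_impl
        closed_Collect_le closed_Collect_eq continuous_intros continuous_on_product_coordinates)
  \<comment> \<open>By \<open>anti\<close> and \<open>closedS\<close>, the sets with finite
    \<open>Z\<close> and finite \<open>\<F>\<close> form a directed family of closed sets, so
    solving all finite subsystems solves the whole system.\<close>
  have compact: "\<exists>\<xi>\<in>S UNIV \<B>. box \<xi>"
    if fin: "\<And>Z \<F>. finite Z \<Longrightarrow> finite \<F> \<Longrightarrow> \<F> \<subseteq> \<B> \<Longrightarrow> \<exists>\<xi>\<in>S Z \<F>. box \<xi>" for \<B>
  proof -
    define I where "I = {(Z :: 'a set, \<F>). finite Z \<and> finite \<F> \<and> \<F> \<subseteq> \<B>}"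
    have "\<exists>\<xi>\<in>\<Inter>((\<lambda>(Z, \<F>). S Z \<F>) ` I). \<forall>j. \<bar>\<xi> j\<bar> \<le> K * norm (snd j)"
    proof (rule box_fip)
      show "closed C" if "C \<in> (\<lambda>(Z, \<F>). S Z \<F>) ` I" for C using that closedS by auto
      fix \<A> assume "finite \<A>" "\<A> \<subseteq> (\<lambda>(Z, \<F>). S Z \<F>) ` I"
      from finite_subset_image[OF this] obtain J
        where J: "J \<subseteq> I" "finite J" "\<A> = (\<lambda>(Z, \<F>). S Z \<F>) ` J" by blast
      have "finite Z \<and> finite \<F> \<and> \<F> \<subseteq> \<B>" if "(Z, \<F>) \<in> J" for Z \<F>
        using J(1) that unfolding I_def by blast
      then have "finite (\<Union>(fst ` J))" "finite (\<Union>(snd ` J))" "\<Union>(snd ` J) \<subseteq> \<B>"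
        using J(2) by fastforce+
      from fin[OF this] obtain \<xi> where \<xi>: "\<xi> \<in> S (\<Union>(fst ` J)) (\<Union>(snd ` J))" "box \<xi>" by blast
      have "\<xi> \<in> S Z \<F>" if "(Z, \<F>) \<in> J" for Z \<F>
        using anti[of Z "\<Union>(fst ` J)" \<F> "\<Union>(snd ` J)"] \<xi>(1) that by force
      then show "\<exists>\<xi>\<in>\<Inter>\<A>. \<forall>j. \<bar>\<xi> j\<bar> \<le> K * norm (snd j)"
        using \<xi>(2) unfolding box_def J(3) by (intro bexI[of _ \<xi>]) auto
    qed
    then obtain \<xi> where \<xi>: "\<And>Z \<F>. finite Z \<Longrightarrow> finite \<F> \<Longrightarrow> \<F> \<subseteq> \<B> \<Longrightarrow> \<xi> \<in> S Z \<F>" "box \<xi>"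
      unfolding I_def box_def by auto
    have "P1 \<xi>" using \<xi>(1)[of "{}" "{}"] unfolding S_def by simp
    moreover have "P2 UNIV \<xi>"
      unfolding P2_def
    proof (intro allI ballI impI)
      fix i a b
      have "P2 {a, b, a + b} \<xi>" using \<xi>(1)[of "{a, b, a + b}" "{}"] by (simp add: S_def)
      then show "\<xi> (i, a + b) = \<xi> (i, a) + \<xi> (i, b)" unfolding P2_def by blast
    qed
    moreover have "P3 UNIV \<xi>"
      unfolding P3_def
    proof (intro allI ballI impI)
      fix i c a
      have "P3 {a, c *\<^sub>R a} \<xi>" using \<xi>(1)[of "{a, c *\<^sub>R a}" "{}"] by (simp add: S_def)
      then show "\<xi> (i, c *\<^sub>R a) = c * \<xi> (i, a)" unfolding P3_def by blast
    qed
    moreover have "P4 UNIV \<B> \<xi>"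
    proof -
      have "\<xi> (i, z - d) \<le> f i z + c"
        if "(i, d, r, c) \<in> \<B>" "z \<in> Dom i" "norm (z - d) < r" for i d r c z
      proof -
        have "P4 {z, z - d} {(i, d, r, c)} \<xi>"
          using \<xi>(1)[of "{z, z - d}" "{(i, d, r, c)}"] that(1) by (simp add: S_def)
        then show ?thesis using that by (simp add: P4_def)
      qed
      then show ?thesis unfolding P4_def by auto
    qed
    ultimately show ?thesis using \<xi>(2) unfolding S_def by blast
  qed
  \<comment> \<open>\<open>V \<F>\<close> is a finite set of vectors on which \<open>\<F>\<close> is
    already contradictory, if there is one. The empty default keeps it finite in every case.\<close>
  define bad where "bad \<F> Z \<longleftrightarrow> finite Z \<and> \<not> (\<exists>\<xi>\<in>S Z \<F>. box \<xi>)" for \<F> Z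
  define V where "V \<F> = (if \<exists>Z. bad \<F> Z then SOME Z. bad \<F> Z else {})" for \<F>
  have V: "bad \<F> (V \<F>)" if "bad \<F> Z" for \<F> Z
    using that unfolding V_def by (auto intro: someI)
  have finV: "finite (V \<F>)" for \<F>
  proof (cases "\<exists>Z. bad \<F> Z")
    case True
    then show ?thesis using V unfolding bad_def by blast
  next
    case False
    then show ?thesis by (simp add: V_def)
  qed

  \<comment> \<open>The separable subspace, closed under witnesses of unsolvability\<close>
  define blocks where "blocks F = (UNIV :: nat set) \<times> F \<times> (\<rat> :: real set) \<times> (\<rat> :: real set)" for F :: "'a set"
  define G where "G F = (\<Union>x\<in>F. \<Union>y\<in>F. {x + y}) \<union> (\<Union>q\<in>\<rat>. \<Union>x\<in>F. {q *\<^sub>R x}) \<union>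
      (\<Union>\<F>\<in>{\<F>. finite \<F> \<and> \<F> \<subseteq> blocks F}. V \<F>)" for F :: "'a set"
  have "countable (G F)" if "finite F" for F
  proof -
    have "countable F" using that by (rule countable_finite)
    then have "countable (blocks F)" unfolding blocks_def
      by (intro countable_SIGMA) (simp_all add: countable_rat)
    then have "countable {\<F>. finite \<F> \<and> \<F> \<subseteq> blocks F}" by (rule countable_Collect_finite_subset)
    then have "countable (\<Union>\<F>\<in>{\<F>. finite \<F> \<and> \<F> \<subseteq> blocks F}. V \<F>)"
      by (rule countable_UN) (rule countable_finite[OF finV])
    then show ?thesis
      unfolding G_def using \<open>countable F\<close> countable_rat finV \<open>countable {\<F>. _ \<F>}\<close>
      by (intro countable_Un countable_UN) (auto intro: countable_finite)
  qed
  then obtain D where D: "countable D" "{0, p} \<subseteq> D"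
    and cl: "\<And>F. finite F \<Longrightarrow> F \<subseteq> D \<Longrightarrow> G F \<subseteq> D"
    using countable_closing[of "{0, p}" G] by (metis countable_finite finite.emptyI finite_insert)
  define Y where "Y = closure D"
  have DY: "D \<subseteq> Y" unfolding Y_def by (rule closure_subset)
  have sub: "subspace Y"
    unfolding Y_def
  proof (rule subspace_closure_rational)
    show "x + y \<in> D" if "x \<in> D" "y \<in> D" for x y
      using cl[of "{x, y}"] that by (auto simp: G_def)
    show "q *\<^sub>R x \<in> D" if "q \<in> \<rat>" "x \<in> D" for q x
      using cl[of "{x}"] that by (auto simp: G_def)
  qed (use D in auto)
  \<comment> \<open>Finitely many blocks have finitely many centers, so their witness set was added
    when \<open>D\<close> was closed under \<open>G\<close>.\<close>
  have VD: "V \<F> \<subseteq> D" if "finite \<F>" "\<F> \<subseteq> blocks D" for \<F>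
  proof -
    define F where "F = (\<lambda>B. fst (snd B)) ` \<F>"
    have F: "finite F" "F \<subseteq> D"
      using that unfolding F_def blocks_def by (simp, fastforce)
    have "B \<in> blocks F" if "B \<in> \<F>" for B
    proof -
      have "B \<in> blocks D" "fst (snd B) \<in> F"
        using that \<open>\<F> \<subseteq> blocks D\<close> unfolding F_def by auto
      then show ?thesis unfolding blocks_def by (cases B) simp
    qed
    then have "\<F> \<in> {\<F>. finite \<F> \<and> \<F> \<subseteq> blocks F}" using that(1) by (simp add: subsetI)
    then have "V \<F> \<subseteq> G F" unfolding G_def by (intro le_supI2 UN_upper)
    with cl[OF F] show ?thesis by (rule order_trans[rotated])
  qed
  show ?thesis
  proof
    show "subspace Y" by (rule sub)
    show "closed Y" unfolding Y_def by simp
    show "separable_space (top_of_set Y)" unfolding Y_def using D(1) by (rule separable_space_closure)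
    show "p \<in> Y" using D(2) DY by auto
    fix x :: "nat \<Rightarrow> 'a" and y :: "nat \<Rightarrow> 'a \<Rightarrow> real"
    assume xY: "\<And>i. i \<le> n \<Longrightarrow> x i \<in> Y"
      and add: "\<And>i a b. i \<le> n \<Longrightarrow> a \<in> Y \<Longrightarrow> b \<in> Y \<Longrightarrow> y i (a + b) = y i a + y i b"
      and scale: "\<And>i c a. i \<le> n \<Longrightarrow> a \<in> Y \<Longrightarrow> y i (c *\<^sub>R a) = c * y i a"
      and bd: "\<And>i a. i \<le> n \<Longrightarrow> a \<in> Y \<Longrightarrow> \<bar>y i a\<bar> \<le> K * norm a"
      and sm: "\<And>a. a \<in> Y \<Longrightarrow> \<bar>\<Sum>i\<le>n. y i a\<bar> \<le> \<epsilon> * norm a"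
      and fs: "\<And>i. i \<le> n \<Longrightarrow> fsub_on (Dom i \<inter> Y) (f i) (x i) (y i)"

    \<comment> \<open>Transfer of a solution from \<open>Y\<close> to the whole space\<close>
    define y' where "y' j = (if fst j \<le> n \<and> snd j \<in> Y then y (fst j) (snd j) else 0)" for j
    \<comment> \<open>\<open>\<B>\<close> records every block inequality valid for \<open>y\<close>
      on \<open>Y\<close>. The extension \<open>y'\<close> by zero solves it on \<open>Y\<close>,
      hence on each witness set inside \<open>Y\<close>, so no finite part of \<open>\<B>\<close>
      can be contradictory.\<close>
    define \<B> where "\<B> = {(i, d, r, c). i \<le> n \<and> (i, d, r, c) \<in> blocks D \<and>
        (\<forall>z\<in>Dom i \<inter> Y. norm (z - d) < r \<longrightarrow> y i (z - d) \<le> f i z + c)}"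
    have box_y': "box y'" unfolding box_def y'_def using bd \<open>0 \<le> K\<close> by auto
    have y'S: "y' \<in> S Y \<F>" if "\<F> \<subseteq> \<B>" for \<F>
    proof -
      have "P1 y'"
        unfolding P1_def
      proof
        fix h
        have "(\<Sum>i\<le>n. y' (i, h)) = (if h \<in> Y then \<Sum>i\<le>n. y i h else 0)"
          by (auto simp: y'_def intro: sum.cong)
        then show "\<bar>\<Sum>i\<le>n. y' (i, h)\<bar> \<le> \<epsilon> * norm h" using sm \<open>0 \<le> \<epsilon>\<close> by simp
      qed
      moreover have "P2 Y y'" unfolding P2_def y'_def using add by simp
      moreover have "P3 Y y'" unfolding P3_def y'_def using scale by simp
      moreover have "P4 Y \<F> y'" unfolding P4_def y'_def using that by (fastforce simp: \<B>_def)
      ultimately show ?thesis by (simp add: S_def)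
    qed
    have "\<exists>\<xi>\<in>S UNIV \<B>. box \<xi>"
    proof (rule compact, rule ccontr)
      fix Z \<F> assume fin: "finite Z" "finite \<F>" "\<F> \<subseteq> \<B>" and "\<not> (\<exists>\<xi>\<in>S Z \<F>. box \<xi>)"
      then have "bad \<F> Z" unfolding bad_def by blast
      then have "bad \<F> (V \<F>)" by (rule V)
      moreover have "\<F> \<subseteq> blocks D" using fin(3) unfolding \<B>_def by auto
      then have "V \<F> \<subseteq> Y" using VD fin(2) DY by blast
      then have "y' \<in> S (V \<F>) \<F>" using anti[of "V \<F>" Y \<F> \<F>] y'S[OF fin(3)] by auto
      ultimately show False using box_y' unfolding bad_def by blast
    qed
    then obtain \<xi> where \<xi>: "P1 \<xi>" "P2 UNIV \<xi>" "P3 UNIV \<xi>" "P4 UNIV \<B> \<xi>" "box \<xi>"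
      unfolding S_def by blast
    have \<xi>_add: "\<xi> (i, a + b) = \<xi> (i, a) + \<xi> (i, b)"
      and \<xi>_scale: "\<xi> (i, c *\<^sub>R a) = c * \<xi> (i, a)" and \<xi>_bd: "\<bar>\<xi> (i, a)\<bar> \<le> K * norm a" for i a b c
      using \<xi>(2,3,5) unfolding P2_def P3_def box_def by auto
    have "\<exists>\<zeta> :: 'a \<Rightarrow>\<^sub>L real. blinfun_apply \<zeta> = (\<lambda>a. \<xi> (i, a)) \<and> norm \<zeta> \<le> K" for i
      by (rule bounded_linear_functional[of "\<lambda>a. \<xi> (i, a)" K])
        (use \<xi>_add \<xi>_scale \<xi>_bd \<open>0 \<le> K\<close> in auto)
    then obtain \<zeta> :: "nat \<Rightarrow> 'a \<Rightarrow>\<^sub>L real" where \<zeta>: "\<And>i. blinfun_apply (\<zeta> i) = (\<lambda>a. \<xi> (i, a))" "\<And>i. norm (\<zeta> i) \<le> K"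
      by metis
    have "norm (\<Sum>i\<le>n. \<zeta> i) \<le> \<epsilon>"
      by (rule norm_blinfun_bound) (use \<xi>(1) \<open>0 \<le> \<epsilon>\<close> in \<open>auto simp: P1_def blinfun.sum_left \<zeta>\<close>)
    moreover have "fsub_on (Dom i) (f i) (x i) (blinfun_apply (\<zeta> i))" if i: "i \<le> n" for i
    proof (rule fsub_onI)
      fix e :: real assume "0 < e"
      then have "0 < e / 8" by simp
      then obtain \<delta> where "0 < \<delta>" and \<delta>: "\<And>z. z \<in> Dom i \<inter> Y \<Longrightarrow> norm (z - x i) \<le> \<delta> \<Longrightarrow>
          y i (z - x i) \<le> f i z - f i (x i) + e / 8 * norm (z - x i)"
        using fsub_onD[OF fs[OF i]] by metis
      have "blinfun_apply (\<zeta> i) (z - x i) \<le> f i z - f i (x i) + e * norm (z - x i)"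
        if z: "z \<in> Dom i" "norm (z - x i) \<le> \<delta> / 2" for z
      proof (cases "z = x i")
        case True then show ?thesis by simp
      next
        case False
        define \<rho> where "\<rho> = norm (z - x i)"
        have "0 < \<rho>" using False by (simp add: \<rho>_def)
        \<comment> \<open>\<open>x i\<close> need not lie in \<open>D\<close>, so a center
          \<open>d\<close> within \<open>\<eta>\<close> replaces it. In units of
          \<open>e * \<rho>\<close>: the subgradient inequality up to distance
          \<open>2 * \<rho>\<close> costs 1/4 and the move to \<open>d\<close> costs 1/8, so
          \<open>c\<close> is taken between the offsets 3/8 and 1/2; moving back costs another
          1/8.\<close>
        define \<eta> where "\<eta> = min (\<rho> / 4) (e * \<rho> / (8 * (K + 1)))"
        have \<eta>: "0 < \<eta>" "\<eta> \<le> \<rho> / 4" "K * \<eta> \<le> e * \<rho> / 8"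
        proof -
          show "0 < \<eta>" using \<open>0 < \<rho>\<close> \<open>0 < e\<close> \<open>0 \<le> K\<close> by (simp add: \<eta>_def)
          show "\<eta> \<le> \<rho> / 4" unfolding \<eta>_def by (rule min.cobounded1)
          have "K * \<eta> \<le> (K + 1) * \<eta>" using \<open>0 < \<eta>\<close> by (simp add: algebra_simps)
          also have "\<dots> \<le> (K + 1) * (e * \<rho> / (8 * (K + 1)))"
            using \<open>0 \<le> K\<close> by (intro mult_left_mono) (auto simp: \<eta>_def)
          also have "\<dots> = e * \<rho> / 8" using \<open>0 \<le> K\<close> by (simp add: field_simps)
          finally show "K * \<eta> \<le> e * \<rho> / 8" .
        qed
        obtain d where d: "d \<in> D" "norm (d - x i) < \<eta>"
          using xY[OF i] \<eta>(1) unfolding Y_def closure_approachable dist_norm by blast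
        then have dY: "d \<in> Y" using DY by blast
        \<comment> \<open>Large enough for the ball around \<open>d\<close> to contain
          \<open>z\<close>, small enough to keep it within \<open>2 * \<rho>\<close> of
          \<open>x i\<close>, where the estimate for \<open>y i\<close> is available.\<close>
        obtain r where r: "r \<in> \<rat>" "\<rho> + \<eta> < r" "r < 2 * \<rho> - \<eta>"
          using Rats_dense_in_real[of "\<rho> + \<eta>" "2 * \<rho> - \<eta>"] \<eta> \<open>0 < \<rho>\<close> by auto
        have "- f i (x i) + 3 * (e * \<rho>) / 8 < - f i (x i) + e * \<rho> / 2"
          using \<open>0 < e\<close> \<open>0 < \<rho>\<close> by simp
        then obtain c where c: "c \<in> \<rat>" "- f i (x i) + 3 * (e * \<rho>) / 8 < c" "c < - f i (x i) + e * \<rho> / 2"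
          using Rats_dense_in_real by blast
        have "y i (z' - d) \<le> f i z' + c" if z': "z' \<in> Dom i \<inter> Y" "norm (z' - d) < r" for z'
        proof -
          have "norm (z' - x i) \<le> norm (z' - d) + norm (d - x i)"
            using norm_triangle_ineq[of "z' - d" "d - x i"] by simp
          then have n2: "norm (z' - x i) \<le> 2 * \<rho>" using z' d r by linarith
          then have "y i (z' - x i) \<le> f i z' - f i (x i) + e / 8 * norm (z' - x i)"
            using z(2) z'(1) by (intro \<delta>) (auto simp: \<rho>_def)
          also have "e / 8 * norm (z' - x i) \<le> e / 8 * (2 * \<rho>)"
            using n2 \<open>0 < e\<close> by (intro mult_left_mono) auto
          finally have 1: "y i (z' - x i) \<le> f i z' - f i (x i) + e * \<rho> / 4" by (simp add: mult.commute)
          have "y i ((z' - x i) + (x i - d)) = y i (z' - x i) + y i (x i - d)"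
            using z' dY xY[OF i] sub by (intro add[OF i]) (auto simp: subspace_diff)
          then have 2: "y i (z' - d) = y i (z' - x i) + y i (x i - d)" by simp
          have "\<bar>y i (x i - d)\<bar> \<le> K * norm (x i - d)"
            using dY xY[OF i] sub by (intro bd[OF i]) (auto simp: subspace_diff)
          also have "\<dots> \<le> K * \<eta>"
            using d(2) \<open>0 \<le> K\<close> by (intro mult_left_mono) (auto simp: norm_minus_commute)
          finally have "y i (x i - d) \<le> K * \<eta>" by simp
          with 1 2 \<eta>(3) c(2) show ?thesis by linarith
        qed
        then have "(i, d, r, c) \<in> \<B>"
          using i d(1) r(1) c(1) by (auto simp: \<B>_def blocks_def)
        moreover have "norm (z - d) < r"
          using norm_triangle_ineq[of "z - x i" "x i - d"] d(2) r(2)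
          by (simp add: \<rho>_def norm_minus_commute)
        ultimately have "\<xi> (i, z - d) \<le> f i z + c"
          using \<xi>(4) z(1) unfolding P4_def by fastforce
        moreover have "\<xi> (i, z - x i) = \<xi> (i, z - d) + \<xi> (i, d - x i)"
          using \<xi>_add[of i "z - d" "d - x i"] by simp
        moreover have "\<xi> (i, d - x i) \<le> K * \<eta>"
        proof -
          have "\<xi> (i, d - x i) \<le> K * norm (d - x i)" using \<xi>_bd[of i "d - x i"] by simp
          also have "\<dots> \<le> K * \<eta>" using d(2) \<open>0 \<le> K\<close> by (intro mult_left_mono) auto
          finally show ?thesis .
        qed
        moreover have "0 \<le> e * \<rho>" using \<open>0 < e\<close> \<open>0 < \<rho>\<close> by simp
        ultimately show ?thesis
          using \<eta>(3) c(3) unfolding \<zeta>(1) \<rho>_def[symmetric] by simp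
      qed
      then show "\<exists>\<delta>>0. \<forall>z\<in>Dom i. norm (z - x i) \<le> \<delta> \<longrightarrow>
          blinfun_apply (\<zeta> i) (z - x i) \<le> f i z - f i (x i) + e * norm (z - x i)"
        using \<open>0 < \<delta>\<close> by (intro exI[of _ "\<delta> / 2"]) auto
    qed
    ultimately show "\<exists>\<xi>. (\<forall>i\<le>n. norm (\<xi> i) \<le> K \<and> fsub_on (Dom i) (f i) (x i) (blinfun_apply (\<xi> i))) \<and>
        norm (\<Sum>i\<le>n. \<xi> i) \<le> \<epsilon>"
      using \<zeta>(2) by blast
  qed
qed

section \<open>A gauge that is differentiable from above\<close>

text \<open>Distances to the members of a dense sequence are convex, and weak* lower semicontinuous
  as suprema of weak* continuous functions. Together they detect norm convergence on
  \<open>Y\<close>, because some member is arbitrarily close to the limit.\<close>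

lemma separable_dual_gauges:
  fixes Y :: "'a::real_normed_vector set"
  assumes sub: "subspace Y" and sep: "separable_dual_on Y"
  obtains \<rho> :: "nat \<Rightarrow> ('a \<Rightarrow>\<^sub>L real) \<Rightarrow> real" where
    "\<And>n \<xi>. norm \<xi> \<le> 1 \<Longrightarrow> 0 \<le> \<rho> n \<xi> \<and> \<rho> n \<xi> \<le> 1"
    "\<And>n \<xi> \<zeta>. norm \<xi> \<le> 1 \<Longrightarrow> norm \<zeta> \<le> 1 \<Longrightarrow>
      \<rho> n ((1/2) *\<^sub>R \<xi> + (1/2) *\<^sub>R \<zeta>) \<le> (\<rho> n \<xi> + \<rho> n \<zeta>) / 2"
    "\<And>n \<xi>s \<xi> r. (\<And>k. norm (\<xi>s k) \<le> 1) \<Longrightarrow> weak_star_tendsto \<xi>s \<xi> \<Longrightarrow>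
      (\<lambda>k. \<rho> n (\<xi>s k)) \<longlonglongrightarrow> r \<Longrightarrow> \<rho> n \<xi> \<le> r"
    "\<And>\<xi>s \<xi> e. (\<And>k. norm (\<xi>s k) \<le> 1) \<Longrightarrow> norm \<xi> \<le> 1 \<Longrightarrow>
      (\<And>n. (\<lambda>k. \<rho> n (\<xi>s k)) \<longlonglongrightarrow> \<rho> n \<xi>) \<Longrightarrow> 0 < e \<Longrightarrow>
      \<forall>\<^sub>F k in sequentially. \<forall>y\<in>Y. \<bar>blinfun_apply (\<xi>s k) y - blinfun_apply \<xi> y\<bar> \<le> e * norm y"
proof -
  from sep obtain E where E: "countable E" "E \<subseteq> dual_on Y"
    and dense: "\<And>f e. f \<in> dual_on Y \<Longrightarrow> 0 < e \<Longrightarrow> \<exists>g\<in>E. \<forall>y\<in>Y. \<bar>f y - g y\<bar> \<le> e * norm y"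
    unfolding separable_dual_on_def by metis
  have "E \<noteq> {}" using dense[OF restrict_in_dual_on[OF sub], of 1] by auto
  define g where "g n = from_nat_into E n" for n
  have g_dual: "g n \<in> dual_on Y" for n
    using from_nat_into[OF \<open>E \<noteq> {}\<close>] E(2) unfolding g_def by blast
  have g_scale: "g n (c *\<^sub>R y) = c * g n y" if "y \<in> Y" for n c y
    using g_dual[of n] that unfolding dual_on_def by blast
  have "\<exists>G\<ge>0. \<forall>y\<in>Y. \<bar>g n y\<bar> \<le> G * norm y" for n
  proof -
    obtain G where G: "\<And>y. y \<in> Y \<Longrightarrow> \<bar>g n y\<bar> \<le> G * norm y"
      using g_dual[of n] unfolding dual_on_def by blast
    have "\<bar>g n y\<bar> \<le> \<bar>G\<bar> * norm y" if "y \<in> Y" for y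
      by (rule order_trans[OF G[OF that]]) (simp add: mult_right_mono)
    then show ?thesis by (intro exI[of _ "\<bar>G\<bar>"]) auto
  qed
  then obtain G where G0: "\<And>n. 0 \<le> G n" and G: "\<And>n y. y \<in> Y \<Longrightarrow> \<bar>g n y\<bar> \<le> G n * norm y"
    by metis
  have g_near: "\<exists>n. \<forall>y\<in>Y. \<bar>blinfun_apply \<xi> y - g n y\<bar> \<le> e * norm y" if "0 < e" for \<xi> e
  proof -
    obtain h where "h \<in> E" "\<forall>y\<in>Y. \<bar>restrict (blinfun_apply \<xi>) Y y - h y\<bar> \<le> e * norm y"
      using dense[OF restrict_in_dual_on[OF sub] \<open>0 < e\<close>] by blast
    moreover from this obtain n where "g n = h"
      using from_nat_into_surj[OF E(1)] unfolding g_def by metis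
    ultimately show ?thesis by (intro exI[of _ n]) auto
  qed
  define T where "T = Y \<inter> cball 0 1"
  have T: "0 \<in> T" "T \<noteq> {}" using subspace_0[OF sub] by (auto simp: T_def)
  \<comment> \<open>For \<open>\<xi>\<close> in the dual ball and \<open>y\<close> in
    \<open>T\<close> the difference is at most \<open>1 + G n\<close>, hence the
    normalization.\<close>
  define \<rho> where "\<rho> n \<xi> = (SUP y\<in>T. \<bar>blinfun_apply \<xi> y - g n y\<bar> / (1 + G n))"
    for n and \<xi> :: "'a \<Rightarrow>\<^sub>L real"
  have le1: "\<bar>blinfun_apply \<xi> y - g n y\<bar> / (1 + G n) \<le> 1" if "norm \<xi> \<le> 1" "y \<in> T" for \<xi> y n
  proof -
    have y: "y \<in> Y" "norm y \<le> 1" using that(2) by (auto simp: T_def)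
    have "\<bar>blinfun_apply \<xi> y\<bar> \<le> 1" using blinfun_le[OF that(1), of y] y(2) by simp
    moreover have "\<bar>g n y\<bar> \<le> G n"
      using G[OF y(1), of n] mult_left_mono[OF y(2) G0[of n]] by simp
    ultimately show ?thesis using G0[of n] by (simp add: field_simps)
  qed
  have upper: "\<bar>blinfun_apply \<xi> y - g n y\<bar> / (1 + G n) \<le> \<rho> n \<xi>" if "norm \<xi> \<le> 1" "y \<in> T" for \<xi> y n
    unfolding \<rho>_def using le1[OF that(1)] that(2) by (intro cSUP_upper bdd_aboveI2[of _ _ 1])
  have least: "\<rho> n \<xi> \<le> c" if "\<And>y. y \<in> T \<Longrightarrow> \<bar>blinfun_apply \<xi> y - g n y\<bar> / (1 + G n) \<le> c" for n \<xi> c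
    unfolding \<rho>_def using that T(2) by (intro cSUP_least)
  show ?thesis
  proof
    show "0 \<le> \<rho> n \<xi> \<and> \<rho> n \<xi> \<le> 1" if "norm \<xi> \<le> 1" for n \<xi>
    proof
      have "0 \<le> \<bar>blinfun_apply \<xi> 0 - g n 0\<bar> / (1 + G n)" using G0[of n] by simp
      also have "\<dots> \<le> \<rho> n \<xi>" by (rule upper[OF that T(1)])
      finally show "0 \<le> \<rho> n \<xi>" .
      show "\<rho> n \<xi> \<le> 1" using le1[OF that] by (rule least)
    qed
    show "\<rho> n ((1/2) *\<^sub>R \<xi> + (1/2) *\<^sub>R \<zeta>) \<le> (\<rho> n \<xi> + \<rho> n \<zeta>) / 2"
      if n: "norm \<xi> \<le> 1" "norm \<zeta> \<le> 1" for n \<xi> \<zeta>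
    proof (rule least)
      fix y assume y: "y \<in> T"
      have "\<bar>blinfun_apply ((1/2) *\<^sub>R \<xi> + (1/2) *\<^sub>R \<zeta>) y - g n y\<bar>
          = \<bar>(blinfun_apply \<xi> y - g n y) / 2 + (blinfun_apply \<zeta> y - g n y) / 2\<bar>"
        by (rule arg_cong[where f = abs]) (simp add: blinfun.add_left blinfun.scaleR_left field_simps)
      also have "\<dots> \<le> \<bar>blinfun_apply \<xi> y - g n y\<bar> / 2 + \<bar>blinfun_apply \<zeta> y - g n y\<bar> / 2"
        by (rule order_trans[OF abs_triangle_ineq]) simp
      finally have "\<bar>blinfun_apply ((1/2) *\<^sub>R \<xi> + (1/2) *\<^sub>R \<zeta>) y - g n y\<bar> / (1 + G n)
          \<le> (\<bar>blinfun_apply \<xi> y - g n y\<bar> / 2 + \<bar>blinfun_apply \<zeta> y - g n y\<bar> / 2) / (1 + G n)"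
        using G0[of n] by (intro divide_right_mono) auto
      also have "\<dots> = (\<bar>blinfun_apply \<xi> y - g n y\<bar> / (1 + G n) + \<bar>blinfun_apply \<zeta> y - g n y\<bar> / (1 + G n)) / 2"
        by (simp add: add_divide_distrib mult.commute)
      also have "\<dots> \<le> (\<rho> n \<xi> + \<rho> n \<zeta>) / 2"
        using upper[OF n(1) y] upper[OF n(2) y] by (intro divide_right_mono add_mono) auto
      finally show "\<bar>blinfun_apply ((1/2) *\<^sub>R \<xi> + (1/2) *\<^sub>R \<zeta>) y - g n y\<bar> / (1 + G n) \<le> (\<rho> n \<xi> + \<rho> n \<zeta>) / 2" .
    qed
    show "\<rho> n \<xi> \<le> r" if b: "\<And>k. norm (\<xi>s k) \<le> 1" and w: "weak_star_tendsto \<xi>s \<xi>"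
      and l: "(\<lambda>k. \<rho> n (\<xi>s k)) \<longlonglongrightarrow> r" for n \<xi>s \<xi> r
    proof (rule least)
      fix y assume y: "y \<in> T"
      have "(\<lambda>k. \<bar>blinfun_apply (\<xi>s k) y - g n y\<bar> / (1 + G n)) \<longlonglongrightarrow> \<bar>blinfun_apply \<xi> y - g n y\<bar> / (1 + G n)"
        using w G0[of n] unfolding weak_star_tendsto_def
        by (intro tendsto_divide tendsto_rabs tendsto_diff tendsto_const) auto
      then show "\<bar>blinfun_apply \<xi> y - g n y\<bar> / (1 + G n) \<le> r"
        by (rule LIMSEQ_le[OF _ l]) (use upper[OF b y] in auto)
    qed
    show "\<forall>\<^sub>F k in sequentially. \<forall>y\<in>Y. \<bar>blinfun_apply (\<xi>s k) y - blinfun_apply \<xi> y\<bar> \<le> e * norm y"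
      if b: "\<And>k. norm (\<xi>s k) \<le> 1" "norm \<xi> \<le> 1" and l: "\<And>n. (\<lambda>k. \<rho> n (\<xi>s k)) \<longlonglongrightarrow> \<rho> n \<xi>"
        and "0 < e" for \<xi>s \<xi> e
    proof -
      \<comment> \<open>One \<open>g n\<close> within \<open>e / 4\<close> of \<open>\<xi>\<close>
        suffices: convergence of this single gauge eventually brings \<open>\<xi>s k\<close> within
        \<open>e / 2\<close> of the same \<open>g n\<close>.\<close>
      obtain n where n: "\<And>y. y \<in> Y \<Longrightarrow> \<bar>blinfun_apply \<xi> y - g n y\<bar> \<le> e / 4 * norm y"
        using g_near[of "e / 4" \<xi>] \<open>0 < e\<close> by auto
      define c where "c = 1 + G n"
      have c: "0 < c" using G0[of n] by (simp add: c_def)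
      have "\<rho> n \<xi> \<le> e / 4 / c"
      proof (rule least)
        fix y assume "y \<in> T"
        then have "y \<in> Y" "norm y \<le> 1" by (auto simp: T_def)
        then have "\<bar>blinfun_apply \<xi> y - g n y\<bar> \<le> e / 4"
          using \<open>0 < e\<close> by (intro order_trans[OF n]) (auto simp: mult_left_le)
        then show "\<bar>blinfun_apply \<xi> y - g n y\<bar> / (1 + G n) \<le> e / 4 / c"
          using c unfolding c_def by (intro divide_right_mono) auto
      qed
      then have "\<rho> n \<xi> < e / 2 / c" using c \<open>0 < e\<close> by (simp add: field_simps)
      then have "\<forall>\<^sub>F k in sequentially. \<rho> n (\<xi>s k) < e / 2 / c"
        by (rule order_tendstoD(2)[OF l])
      then show ?thesis
      proof (rule eventually_mono, intro ballI)
        fix k y assume k: "\<rho> n (\<xi>s k) < e / 2 / c" and y: "y \<in> Y"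
        show "\<bar>blinfun_apply (\<xi>s k) y - blinfun_apply \<xi> y\<bar> \<le> e * norm y"
        proof (cases "y = 0")
          case True then show ?thesis by simp
        next
          case False
          define u where "u = inverse (norm y) *\<^sub>R y"
          have u: "u \<in> T" using sub y False by (simp add: T_def u_def subspace_scale)
          have "\<bar>blinfun_apply (\<xi>s k) u - g n u\<bar> / c \<le> \<rho> n (\<xi>s k)"
            using upper[OF b(1) u] unfolding c_def .
          also note k
          finally have "\<bar>blinfun_apply (\<xi>s k) u - g n u\<bar> \<le> e / 2"
            using c unfolding divide_less_cancel by simp
          moreover have "blinfun_apply (\<xi>s k) u - g n u = inverse (norm y) * (blinfun_apply (\<xi>s k) y - g n y)"
            by (simp add: u_def blinfun.scaleR_right g_scale[OF y] right_diff_distrib)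
          ultimately have "\<bar>blinfun_apply (\<xi>s k) y - g n y\<bar> \<le> e / 2 * norm y"
            using False by (simp add: abs_mult field_simps)
          moreover have "0 \<le> e * norm y" using \<open>0 < e\<close> by simp
          ultimately show ?thesis using n[OF y] by linarith
        qed
      qed
    qed
  qed
qed

text \<open>The function is the symmetrization of the conjugate, over the dual ball, of \<open>\<Sum>n. 2\<^sup>-\<^sup>n (\<rho> n)\<^sup>2\<close>,
  where \<open>\<rho> n\<close> is the normalized distance on \<open>Y\<close> to the \<open>n\<close>-th element of a dense sequence of the
  dual. Maximizing sequences of the conjugate converge in norm on \<open>Y\<close>, as in the construction of
  locally uniformly rotund dual norms, which gives differentiability from above.\<close>

lemma smooth_gauge:
  fixes Y :: "'a::banach set"
  assumes asp: "asplund TYPE('a)" and sub: "subspace Y" and sep: "separable_dual_on Y"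
  obtains \<phi> :: "'a \<Rightarrow> real" where "\<And>u. 0 \<le> \<phi> u" "\<phi> 0 = 0" "\<And>u. norm u - 2 \<le> \<phi> u"
    "\<And>u w. \<phi> u \<le> \<phi> w + norm (u - w)"
    "\<And>x. x \<in> Y \<Longrightarrow> \<exists>\<alpha> :: 'a \<Rightarrow>\<^sub>L real. norm \<alpha> \<le> 1 \<and> fsub_on Y (\<lambda>z. - \<phi> z) x (blinfun_apply (- \<alpha>))"
proof (rule separable_dual_gauges[OF sub sep])
  fix \<rho> :: "nat \<Rightarrow> ('a \<Rightarrow>\<^sub>L real) \<Rightarrow> real"
  assume r_bd: "\<And>n \<xi>. norm \<xi> \<le> 1 \<Longrightarrow> 0 \<le> \<rho> n \<xi> \<and> \<rho> n \<xi> \<le> 1"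
    and r_mid: "\<And>n \<xi> \<zeta>. norm \<xi> \<le> 1 \<Longrightarrow> norm \<zeta> \<le> 1 \<Longrightarrow>
      \<rho> n ((1/2) *\<^sub>R \<xi> + (1/2) *\<^sub>R \<zeta>) \<le> (\<rho> n \<xi> + \<rho> n \<zeta>) / 2"
    and r_lsc: "\<And>n \<xi>s \<xi> r. (\<And>k. norm (\<xi>s k) \<le> 1) \<Longrightarrow> weak_star_tendsto \<xi>s \<xi> \<Longrightarrow>
      (\<lambda>k. \<rho> n (\<xi>s k)) \<longlonglongrightarrow> r \<Longrightarrow> \<rho> n \<xi> \<le> r"
    and r_conv: "\<And>\<xi>s \<xi> e. (\<And>k. norm (\<xi>s k) \<le> 1) \<Longrightarrow> norm \<xi> \<le> 1 \<Longrightarrow>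
      (\<And>n. (\<lambda>k. \<rho> n (\<xi>s k)) \<longlonglongrightarrow> \<rho> n \<xi>) \<Longrightarrow> 0 < e \<Longrightarrow>
      \<forall>\<^sub>F k in sequentially. \<forall>y\<in>Y. \<bar>blinfun_apply (\<xi>s k) y - blinfun_apply \<xi> y\<bar> \<le> e * norm y"
  define B where "B = {\<xi> :: 'a \<Rightarrow>\<^sub>L real. norm \<xi> \<le> 1}"
  \<comment> \<open>The weights sum to 2 and the gauges are at most 1 on \<open>B\<close>. The
    resulting bound \<open>q \<xi> \<le> 2\<close> is the origin of the constant in
    \<open>norm u - 2 \<le> \<phi> u\<close>.\<close>
  define q where "q \<xi> = (\<Sum>n. (1/2)^n * (\<rho> n \<xi>)\<^sup>2)" for \<xi>
  have geo: "summable (\<lambda>n. (1/2)^n :: real)" by (simp add: summable_geometric)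
  have sq_le: "(1/2)^n * t\<^sup>2 \<le> (1/2)^n" if "\<bar>t\<bar> \<le> 1" for n and t :: real
    using that abs_square_le_1[of t] by (simp add: mult_left_le)
  have sm: "summable (\<lambda>n. (1/2)^n * (\<rho> n \<xi>)\<^sup>2)" if "\<xi> \<in> B" for \<xi>
    by (rule summable_comparison_test'[OF geo]) (use that r_bd sq_le in \<open>auto simp: B_def\<close>)
  have q0: "0 \<le> q \<xi>" if "\<xi> \<in> B" for \<xi>
    unfolding q_def using sm[OF that] by (intro suminf_nonneg) auto
  have q2: "q \<xi> \<le> 2" if "\<xi> \<in> B" for \<xi>
  proof -
    have "q \<xi> \<le> (\<Sum>n. (1/2)^n)"
      unfolding q_def by (rule suminf_le[OF _ sm[OF that] geo]) (use that r_bd sq_le in \<open>auto simp: B_def\<close>)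
    then show ?thesis by (simp add: suminf_geometric)
  qed
  define mid where "mid \<xi> \<zeta> = (1/2) *\<^sub>R \<xi> + (1/2) *\<^sub>R \<zeta>" for \<xi> \<zeta> :: "'a \<Rightarrow>\<^sub>L real"
  have midB: "mid \<xi> \<zeta> \<in> B" if "\<xi> \<in> B" "\<zeta> \<in> B" for \<xi> \<zeta>
    using that norm_triangle_ineq[of "(1/2) *\<^sub>R \<xi>" "(1/2) *\<^sub>R \<zeta>"] by (simp add: B_def mid_def)
  \<comment> \<open>Convexity with a remainder: the parallelogram identity for the numbers
    \<open>\<rho> n \<xi>\<close> and \<open>\<rho> n \<zeta>\<close>, keeping one term of the
    remainder series.\<close>
  have q_mid: "q (mid \<xi> \<zeta>) + (1/2)^n * (\<rho> n \<xi> - \<rho> n \<zeta>)\<^sup>2 / 4 \<le> (q \<xi> + q \<zeta>) / 2"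
    if B: "\<xi> \<in> B" "\<zeta> \<in> B" for \<xi> \<zeta> n
  proof -
    have sd: "summable (\<lambda>n. (1/2)^n * (\<rho> n \<xi> - \<rho> n \<zeta>)\<^sup>2)"
    proof (rule summable_comparison_test'[OF geo])
      fix n
      have "\<bar>\<rho> n \<xi> - \<rho> n \<zeta>\<bar> \<le> 1" using r_bd[of \<xi> n] r_bd[of \<zeta> n] B by (auto simp: B_def)
      then show "norm ((1/2)^n * (\<rho> n \<xi> - \<rho> n \<zeta>)\<^sup>2) \<le> (1/2)^n" using sq_le by simp
    qed
    have "q (mid \<xi> \<zeta>) \<le> (\<Sum>n. ((1/2)^n * (\<rho> n \<xi>)\<^sup>2 + (1/2)^n * (\<rho> n \<zeta>)\<^sup>2) / 2 - (1/2)^n * (\<rho> n \<xi> - \<rho> n \<zeta>)\<^sup>2 / 4)"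
      unfolding q_def
    proof (rule suminf_le[OF _ sm[OF midB[OF B]]])
      show "summable (\<lambda>n. ((1/2)^n * (\<rho> n \<xi>)\<^sup>2 + (1/2)^n * (\<rho> n \<zeta>)\<^sup>2) / 2 - (1/2)^n * (\<rho> n \<xi> - \<rho> n \<zeta>)\<^sup>2 / 4)"
        by (intro summable_diff summable_divide summable_add sm B sd)
      fix n
      have "(\<rho> n (mid \<xi> \<zeta>))\<^sup>2 \<le> ((\<rho> n \<xi> + \<rho> n \<zeta>) / 2)\<^sup>2"
        using r_mid[of \<xi> \<zeta> n] r_bd[of "mid \<xi> \<zeta>" n] B midB[OF B] by (intro power_mono) (auto simp: B_def mid_def)
      also have "\<dots> = ((\<rho> n \<xi>)\<^sup>2 + (\<rho> n \<zeta>)\<^sup>2) / 2 - (\<rho> n \<xi> - \<rho> n \<zeta>)\<^sup>2 / 4"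
        by (simp add: power2_eq_square field_simps)
      finally have "(1/2)^n * (\<rho> n (mid \<xi> \<zeta>))\<^sup>2 \<le> (1/2)^n * (((\<rho> n \<xi>)\<^sup>2 + (\<rho> n \<zeta>)\<^sup>2) / 2 - (\<rho> n \<xi> - \<rho> n \<zeta>)\<^sup>2 / 4)"
        by (rule mult_left_mono) simp
      then show "(1/2)^n * (\<rho> n (mid \<xi> \<zeta>))\<^sup>2 \<le> ((1/2)^n * (\<rho> n \<xi>)\<^sup>2 + (1/2)^n * (\<rho> n \<zeta>)\<^sup>2) / 2 - (1/2)^n * (\<rho> n \<xi> - \<rho> n \<zeta>)\<^sup>2 / 4"
        by (simp add: algebra_simps)
    qed
    also have "\<dots> = (q \<xi> + q \<zeta>) / 2 - (\<Sum>n. (1/2)^n * (\<rho> n \<xi> - \<rho> n \<zeta>)\<^sup>2) / 4"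
      unfolding q_def
      by (rule sums_unique[symmetric], intro sums_diff sums_divide sums_add summable_sums sm B sd)
    finally have "q (mid \<xi> \<zeta>) \<le> (q \<xi> + q \<zeta>) / 2 - (\<Sum>n. (1/2)^n * (\<rho> n \<xi> - \<rho> n \<zeta>)\<^sup>2) / 4" .
    moreover have "(\<Sum>n\<in>{n}. (1/2)^n * (\<rho> n \<xi> - \<rho> n \<zeta>)\<^sup>2) \<le> (\<Sum>n. (1/2)^n * (\<rho> n \<xi> - \<rho> n \<zeta>)\<^sup>2)"
      by (rule sum_le_suminf[OF sd]) auto
    then have "(1/2)^n * (\<rho> n \<xi> - \<rho> n \<zeta>)\<^sup>2 / 4 \<le> (\<Sum>n. (1/2)^n * (\<rho> n \<xi> - \<rho> n \<zeta>)\<^sup>2) / 4"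
      by (intro divide_right_mono) auto
    ultimately show ?thesis by linarith
  qed

  \<comment> \<open>The conjugate of \<open>q\<close>: attainment and differentiability from
    above\<close>
  define \<psi> where "\<psi> x = (SUP \<xi>\<in>B. blinfun_apply \<xi> x - q \<xi>)" for x
  have ap_le: "blinfun_apply \<xi> x \<le> norm x" if "\<xi> \<in> B" for \<xi> x
    using blinfun_le[of \<xi> 1 x] that by (simp add: B_def)
  have "bdd_above ((\<lambda>\<xi>. blinfun_apply \<xi> x - q \<xi>) ` B)" for x
    by (rule bdd_aboveI2[of _ _ "norm x"]) (use ap_le q0 in \<open>smt (verit)\<close>)
  then have up: "blinfun_apply \<xi> x - q \<xi> \<le> \<psi> x" if "\<xi> \<in> B" for \<xi> x
    unfolding \<psi>_def using that by (intro cSUP_upper)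
  \<comment> \<open>The midpoint competes in the supremum \<open>\<psi> x\<close>, so the remainder
    is bounded by the deficits of the two functionals. Almost maximizers thus have almost equal
    gauges.\<close>
  have gap: "(\<rho> n \<xi> - \<rho> n \<zeta>)\<^sup>2 \<le> 2 * 2^n * ((\<psi> x - (blinfun_apply \<xi> x - q \<xi>)) + (\<psi> x - (blinfun_apply \<zeta> x - q \<zeta>)))"
    if B: "\<xi> \<in> B" "\<zeta> \<in> B" for \<xi> \<zeta> x n
  proof -
    have "blinfun_apply (mid \<xi> \<zeta>) x = (blinfun_apply \<xi> x + blinfun_apply \<zeta> x) / 2"
      by (simp add: mid_def blinfun.add_left blinfun.scaleR_left)
    moreover define P where "P = (1/2)^n * (\<rho> n \<xi> - \<rho> n \<zeta>)\<^sup>2"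
    ultimately have "P \<le> 2 * ((\<psi> x - (blinfun_apply \<xi> x - q \<xi>)) + (\<psi> x - (blinfun_apply \<zeta> x - q \<zeta>)))"
      using up[OF midB[OF B], of x] q_mid[OF B, of n] unfolding P_def[symmetric] by argo
    then have "2^n * P \<le> 2^n * (2 * ((\<psi> x - (blinfun_apply \<xi> x - q \<xi>)) + (\<psi> x - (blinfun_apply \<zeta> x - q \<zeta>))))"
      by (rule mult_left_mono) simp
    then show ?thesis by (simp add: P_def power_one_over mult.assoc mult.left_commute[of 2])
  qed
  \<comment> \<open>Along a maximizing sequence the gauges converge by \<open>gap\<close>. A weak*
    limit still maximizes: evaluation at \<open>x\<close> is weak* continuous and the gauges can
    only drop.\<close>
  have attain: "\<exists>\<xi>\<in>B. \<psi> x = blinfun_apply \<xi> x - q \<xi>" for x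
  proof -
    have "0 \<in> B" by (simp add: B_def)
    have "\<exists>\<xi>\<in>B. \<psi> x - inverse (Suc k) < blinfun_apply \<xi> x - q \<xi>" for k
      using less_cSUP_iff[of B "\<lambda>\<xi>. blinfun_apply \<xi> x - q \<xi>" "\<psi> x - inverse (Suc k)"]
        \<open>bdd_above ((\<lambda>\<xi>. blinfun_apply \<xi> x - q \<xi>) ` B)\<close> \<open>0 \<in> B\<close>
      unfolding \<psi>_def[symmetric] by auto
    then obtain z where z: "\<And>k. z k \<in> B" "\<And>k. \<psi> x - inverse (Suc k) < blinfun_apply (z k) x - q (z k)"
      by metis
    obtain r \<xi> where r: "strict_mono r" "weak_star_tendsto (z \<circ> r) \<xi>" "norm \<xi> \<le> 1"
      by (rule asplund_weak_star_subseq[OF asp, of z 1]) (use z(1) in \<open>auto simp: B_def\<close>)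
    define s where "s k = z (r k)" for k
    define d where "d k = \<psi> x - (blinfun_apply (s k) x - q (s k))" for k
    have sB: "s k \<in> B" for k using z(1) by (simp add: s_def)
    have d0: "0 \<le> d k" for k using up[OF sB, of k x] by (simp add: d_def)
    have d_le: "d k \<le> inverse (Suc k)" for k
    proof -
      have "d k \<le> inverse (Suc (r k))" using z(2)[of "r k"] by (simp add: d_def s_def)
      also have "\<dots> \<le> inverse (Suc k)" using seq_suble[OF r(1), of k] by (simp add: field_simps)
      finally show ?thesis .
    qed
    have d_lim: "d \<longlonglongrightarrow> 0"
      by (rule tendsto_sandwich[OF _ _ tendsto_const LIMSEQ_inverse_real_of_nat]) (use d0 d_le in auto)
    have "convergent (\<lambda>k. \<rho> n (s k))" for n
    proof (rule Cauchy_convergent, rule metric_CauchyI)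
      fix e :: real assume "0 < e"
      then have "0 < e\<^sup>2 / (4 * 2^n)" by simp
      then have "\<forall>\<^sub>F k in sequentially. d k < e\<^sup>2 / (4 * 2^n)"
        by (rule order_tendstoD(2)[OF d_lim])
      then obtain N where N: "\<And>k. N \<le> k \<Longrightarrow> d k < e\<^sup>2 / (4 * 2^n)"
        unfolding eventually_sequentially by blast
      have "dist (\<rho> n (s i)) (\<rho> n (s j)) < e" if "N \<le> i" "N \<le> j" for i j
      proof -
        have "(\<rho> n (s i) - \<rho> n (s j))\<^sup>2 \<le> 2 * 2^n * (d i + d j)"
          using gap[OF sB[of i] sB[of j], where n = n and x = x] by (simp add: d_def)
        also have "\<dots> < 2 * 2^n * (e\<^sup>2 / (4 * 2^n) + e\<^sup>2 / (4 * 2^n))"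
          using N that by (intro mult_strict_left_mono add_strict_mono) auto
        also have "\<dots> = e\<^sup>2" by simp
        finally have "\<bar>\<rho> n (s i) - \<rho> n (s j)\<bar>\<^sup>2 < e\<^sup>2" by simp
        then show ?thesis using \<open>0 < e\<close> unfolding dist_real_def by (rule power2_less_imp_less[OF _ less_imp_le])
      qed
      then show "\<exists>M. \<forall>i\<ge>M. \<forall>j\<ge>M. dist (\<rho> n (s i)) (\<rho> n (s j)) < e" by blast
    qed
    then have t: "(\<lambda>k. \<rho> n (s k)) \<longlonglongrightarrow> lim (\<lambda>k. \<rho> n (s k))" for n
      by (simp add: convergent_LIMSEQ_iff)
    define t where "t n = lim (\<lambda>k. \<rho> n (s k))" for n
    note t = t[folded t_def]
    have ws: "weak_star_tendsto s \<xi>" using r(2) by (simp add: s_def[abs_def] comp_def)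
    have \<xi>B: "\<xi> \<in> B" using r(3) by (simp add: B_def)
    have \<rho>t: "\<rho> n \<xi> \<le> t n" for n using r_lsc[OF _ ws t] sB by (simp add: B_def)
    \<comment> \<open>Finite partial sums allow the limit in \<open>k\<close> to be taken term by
      term; \<open>q \<xi>\<close> is reached afterwards as their supremum.\<close>
    have part: "(\<Sum>n<N. (1/2)^n * (\<rho> n \<xi>)\<^sup>2) \<le> blinfun_apply \<xi> x - \<psi> x" for N
    proof -
      have "(\<Sum>n<N. (1/2)^n * (\<rho> n \<xi>)\<^sup>2) \<le> (\<Sum>n<N. (1/2)^n * (t n)\<^sup>2)"
        using \<rho>t r_bd[OF r(3)] by (intro sum_mono mult_left_mono power_mono) auto
      also have "\<dots> \<le> blinfun_apply \<xi> x - \<psi> x"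
      proof (rule LIMSEQ_le)
        show "(\<lambda>k. \<Sum>n<N. (1/2)^n * (\<rho> n (s k))\<^sup>2) \<longlonglongrightarrow> (\<Sum>n<N. (1/2)^n * (t n)\<^sup>2)"
          by (intro tendsto_intros t)
        have "(\<lambda>k. blinfun_apply (s k) x - \<psi> x + d k) \<longlonglongrightarrow> blinfun_apply \<xi> x - \<psi> x + 0"
          using ws unfolding weak_star_tendsto_def
          by (intro tendsto_add tendsto_diff tendsto_const d_lim) auto
        then show "(\<lambda>k. blinfun_apply (s k) x - \<psi> x + d k) \<longlonglongrightarrow> blinfun_apply \<xi> x - \<psi> x" by simp
        have "(\<Sum>n<N. (1/2)^n * (\<rho> n (s k))\<^sup>2) \<le> blinfun_apply (s k) x - \<psi> x + d k" for k
        proof -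
          have "(\<Sum>n<N. (1/2)^n * (\<rho> n (s k))\<^sup>2) \<le> q (s k)"
            unfolding q_def by (rule sum_le_suminf[OF sm[OF sB]]) auto
          then show ?thesis by (simp add: d_def)
        qed
        then show "\<exists>K. \<forall>k\<ge>K. (\<Sum>n<N. (1/2)^n * (\<rho> n (s k))\<^sup>2) \<le> blinfun_apply (s k) x - \<psi> x + d k" by blast
      qed
      finally show ?thesis .
    qed
    have "q \<xi> \<le> blinfun_apply \<xi> x - \<psi> x"
      unfolding q_def by (rule suminf_le_const[OF sm[OF \<xi>B] part])
    with up[OF \<xi>B, of x] \<xi>B show ?thesis by (intro bexI[of _ \<xi>]) auto
  qed
  have \<psi>_lip: "\<psi> u \<le> \<psi> w + norm (u - w)" for u w
  proof -
    obtain \<xi> where \<xi>: "\<xi> \<in> B" "\<psi> u = blinfun_apply \<xi> u - q \<xi>" using attain by blast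
    with up[OF \<xi>(1), of w] ap_le[OF \<xi>(1), of "u - w"] show ?thesis by (simp add: blinfun.diff_right)
  qed
  \<comment> \<open>If this failed, maximizers at the bad points \<open>z k\<close> would almost
    maximize at \<open>x\<close>, with deficit at most twice the distance. By \<open>gap\<close> and
    \<open>r_conv\<close> they would be \<open>e\<close>-close to \<open>\<xi>\<close> on
    \<open>Y\<close>, which the excess \<open>e * norm (z k - x)\<close> forbids.\<close>
  have \<psi>_super: "fsub_on Y (\<lambda>z. - \<psi> z) x (blinfun_apply (- \<xi>))"
    if x: "x \<in> Y" and \<xi>: "\<xi> \<in> B" "\<psi> x = blinfun_apply \<xi> x - q \<xi>" for x \<xi>
  proof (rule ccontr)
    assume "\<not> ?thesis"
    then obtain e where "0 < e" and e: "\<And>\<delta>. 0 < \<delta> \<Longrightarrow> \<exists>z\<in>Y. norm (z - x) \<le> \<delta> \<and>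
        \<not> blinfun_apply (- \<xi>) (z - x) \<le> - \<psi> z - - \<psi> x + e * norm (z - x)"
      unfolding fsub_on_def by blast
    have "\<exists>z\<in>Y. norm (z - x) \<le> inverse (Suc k) \<and>
        \<psi> x + blinfun_apply \<xi> (z - x) + e * norm (z - x) < \<psi> z" for k
      using e[of "inverse (Suc k)"] by (auto simp: blinfun.minus_left not_le algebra_simps)
    then obtain z where z: "\<And>k. z k \<in> Y" "\<And>k. norm (z k - x) \<le> inverse (Suc k)"
      "\<And>k. \<psi> x + blinfun_apply \<xi> (z k - x) + e * norm (z k - x) < \<psi> (z k)" by metis
    have "\<forall>k. \<exists>\<xi>. \<xi> \<in> B \<and> \<psi> (z k) = blinfun_apply \<xi> (z k) - q \<xi>"
      using attain by blast
    from choice[OF this] obtain s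
      where s: "\<And>k. s k \<in> B" "\<And>k. \<psi> (z k) = blinfun_apply (s k) (z k) - q (s k)" by blast
    have nz: "(\<lambda>k. norm (z k - x)) \<longlonglongrightarrow> 0"
      by (rule tendsto_sandwich[OF _ _ tendsto_const LIMSEQ_inverse_real_of_nat]) (use z(2) in auto)
    define d where "d k = \<psi> x - (blinfun_apply (s k) x - q (s k))" for k
    have d_le: "d k \<le> 2 * norm (z k - x)" for k
      using \<psi>_lip[of x "z k"] s(2)[of k] ap_le[OF s(1), of k "z k - x"]
      by (simp add: d_def blinfun.diff_right norm_minus_commute)
    have conv: "(\<lambda>k. \<rho> n (s k)) \<longlonglongrightarrow> \<rho> n \<xi>" for n
    proof -
      have g: "(\<rho> n (s k) - \<rho> n \<xi>)\<^sup>2 \<le> 2 * 2^n * (2 * norm (z k - x))" for k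
      proof -
        have "(\<rho> n (s k) - \<rho> n \<xi>)\<^sup>2 \<le> 2 * 2^n * d k"
          using gap[OF s(1)[of k] \<xi>(1), where n = n and x = x] \<xi>(2) by (simp add: d_def)
        also have "\<dots> \<le> 2 * 2^n * (2 * norm (z k - x))" using d_le by (intro mult_left_mono) auto
        finally show ?thesis .
      qed
      have "(\<lambda>k. 2 * 2^n * (2 * norm (z k - x))) \<longlonglongrightarrow> 2 * 2^n * (2 * 0)"
        by (intro tendsto_intros nz)
      then have lim: "(\<lambda>k. 2 * 2^n * (2 * norm (z k - x))) \<longlonglongrightarrow> 0" by simp
      have "(\<lambda>k. (\<rho> n (s k) - \<rho> n \<xi>)\<^sup>2) \<longlonglongrightarrow> 0"
        by (rule tendsto_sandwich[OF _ _ tendsto_const lim]) (use g in auto)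
      from tendsto_real_sqrt[OF this] have "(\<lambda>k. \<rho> n (s k) - \<rho> n \<xi>) \<longlonglongrightarrow> 0"
        by (simp add: tendsto_rabs_zero_iff)
      then show ?thesis by (simp add: LIM_zero_iff)
    qed
    have "\<forall>\<^sub>F k in sequentially. \<forall>y\<in>Y. \<bar>blinfun_apply (s k) y - blinfun_apply \<xi> y\<bar> \<le> e * norm y"
      using s(1) \<xi>(1) conv \<open>0 < e\<close> by (intro r_conv) (auto simp: B_def)
    then obtain k where k: "\<And>y. y \<in> Y \<Longrightarrow> \<bar>blinfun_apply (s k) y - blinfun_apply \<xi> y\<bar> \<le> e * norm y"
      by (auto simp: eventually_sequentially)
    have "\<bar>blinfun_apply (s k) (z k - x) - blinfun_apply \<xi> (z k - x)\<bar> \<le> e * norm (z k - x)"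
      using sub z(1) x by (intro k) (auto simp: subspace_diff)
    with up[OF s(1), of k x] s(2)[of k] z(3)[of k] show False
      by (simp add: blinfun.diff_right)
  qed
  \<comment> \<open>Symmetrizing puts the minimum at the origin: a maximizer at \<open>0\<close>
    bounds both \<open>\<psi> u\<close> and \<open>\<psi> (- u)\<close> from below, and its values
    at \<open>u\<close> and \<open>- u\<close> cancel.\<close>
  define \<phi> where "\<phi> u = (\<psi> u + \<psi> (- u)) / 2 - \<psi> 0" for u
  have \<psi>0: "\<psi> 0 \<le> 0"
    using attain[of 0] q0 by auto
  show ?thesis
  proof
    show "\<phi> 0 = 0" by (simp add: \<phi>_def)
    show "0 \<le> \<phi> u" for u
    proof -
      obtain \<xi> where \<xi>: "\<xi> \<in> B" "\<psi> 0 = blinfun_apply \<xi> 0 - q \<xi>" using attain by blast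
      with up[OF \<xi>(1), of u] up[OF \<xi>(1), of "- u"] show ?thesis
        by (simp add: \<phi>_def blinfun.minus_right field_simps)
    qed
    show "norm u - 2 \<le> \<phi> u" for u
    proof -
      have "norm u - 2 \<le> \<psi> u" for u
      proof -
        obtain \<xi> :: "'a \<Rightarrow>\<^sub>L real" where \<xi>: "norm \<xi> \<le> 1" "blinfun_apply \<xi> u = norm u"
          by (rule norming_functional)
        then have "\<xi> \<in> B" by (simp add: B_def)
        with up[OF this, of u] q2[OF this] \<xi>(2) show ?thesis by simp
      qed
      from this[of u] this[of "- u"] \<psi>0 show ?thesis by (simp add: \<phi>_def field_simps)
    qed
    show "\<phi> u \<le> \<phi> w + norm (u - w)" for u w
      using \<psi>_lip[of u w] \<psi>_lip[of "- u" "- w"] norm_minus_commute[of u w]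
      by (simp add: \<phi>_def field_simps)
    show "\<exists>\<alpha> :: 'a \<Rightarrow>\<^sub>L real. norm \<alpha> \<le> 1 \<and> fsub_on Y (\<lambda>z. - \<phi> z) x (blinfun_apply (- \<alpha>))"
      if x: "x \<in> Y" for x
    proof -
      obtain \<xi> where \<xi>: "\<xi> \<in> B" "\<psi> x = blinfun_apply \<xi> x - q \<xi>" using attain by blast
      obtain \<zeta> where \<zeta>: "\<zeta> \<in> B" "\<psi> (- x) = blinfun_apply \<zeta> (- x) - q \<zeta>" using attain by blast
      \<comment> \<open>\<open>- \<zeta>\<close> is the slope at \<open>x\<close> of the reflected
        function, and averaging two slopes stays in the dual ball.\<close>
      define \<alpha> where "\<alpha> = mid \<xi> (- \<zeta>)"
      have "- \<zeta> \<in> B" using \<zeta>(1) by (simp add: B_def)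
      then have "norm \<alpha> \<le> 1" using midB[OF \<xi>(1)] unfolding \<alpha>_def by (simp add: B_def)
      moreover have "fsub_on Y (\<lambda>z. - \<phi> z) x (blinfun_apply (- \<alpha>))"
      proof (rule fsub_onI)
        fix e :: real assume "0 < e"
        obtain d1 where d1: "0 < d1" "\<And>z. z \<in> Y \<Longrightarrow> norm (z - x) \<le> d1 \<Longrightarrow>
            blinfun_apply (- \<xi>) (z - x) \<le> - \<psi> z - - \<psi> x + e * norm (z - x)"
          using fsub_onD[OF \<psi>_super[OF x \<xi>] \<open>0 < e\<close>] by metis
        obtain d2 where d2: "0 < d2" "\<And>z. z \<in> Y \<Longrightarrow> norm (z - (- x)) \<le> d2 \<Longrightarrow>
            blinfun_apply (- \<zeta>) (z - (- x)) \<le> - \<psi> z - - \<psi> (- x) + e * norm (z - (- x))"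
          using fsub_onD[OF \<psi>_super[OF subspace_neg[OF sub x] \<zeta>] \<open>0 < e\<close>] by metis
        have "blinfun_apply (- \<alpha>) (z - x) \<le> - \<phi> z - - \<phi> x + e * norm (z - x)"
          if z: "z \<in> Y" "norm (z - x) \<le> min d1 d2" for z
        proof -
          have n: "norm (- z + x) = norm (z - x)" using norm_minus_commute[of z x] by simp
          have "- z \<in> Y" using z(1) sub by (simp add: subspace_neg)
          then have "blinfun_apply (- \<zeta>) (- z + x) \<le> - \<psi> (- z) + \<psi> (- x) + e * norm (z - x)"
            using d2(2)[of "- z"] z(2) n by simp
          moreover have "blinfun_apply (- \<xi>) (z - x) \<le> - \<psi> z + \<psi> x + e * norm (z - x)"
            using d1(2)[of z] z by simp
          moreover have "blinfun_apply (- \<alpha>) (z - x) = (blinfun_apply (- \<xi>) (z - x) + blinfun_apply (- \<zeta>) (- z + x)) / 2"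
            by (simp add: \<alpha>_def mid_def blinfun.minus_left blinfun.add_left blinfun.diff_left blinfun.scaleR_left
                blinfun.diff_right blinfun.add_right blinfun.minus_right field_simps)
          ultimately show ?thesis by (simp add: \<phi>_def field_simps)
        qed
        then show "\<exists>\<delta>>0. \<forall>z\<in>Y. norm (z - x) \<le> \<delta> \<longrightarrow> blinfun_apply (- \<alpha>) (z - x) \<le> - \<phi> z - - \<phi> x + e * norm (z - x)"
          using d1(1) d2(1) by (intro exI[of _ "min d1 d2"]) auto
      qed
      ultimately show ?thesis by blast
    qed
  qed
qed

section \<open>Variational principle and calculus of subgradients\<close>

lemma fsub_on_mono: "fsub_on A f x \<xi> \<Longrightarrow> B \<subseteq> A \<Longrightarrow> fsub_on B f x \<xi>"
  unfolding fsub_on_def by (meson subsetD)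

text \<open>At a local minimum of \<open>f + g\<close>, the increment of \<open>f\<close> is at
  least that of \<open>- g\<close>, so a subgradient of \<open>- g\<close> serves for
  \<open>f\<close>. This is why penalties have to be differentiable from above.\<close>

lemma fsub_on_of_min:
  assumes "0 < d" and min: "\<And>z. z \<in> A \<Longrightarrow> norm (z - x) \<le> d \<Longrightarrow> f x + g x \<le> f z + g z"
    and g: "fsub_on A (\<lambda>z. - g z) x \<xi>"
  shows "fsub_on A f x \<xi>"
proof (rule fsub_onI)
  fix \<epsilon> :: real assume "0 < \<epsilon>"
  then obtain \<delta> where \<delta>: "0 < \<delta>"
    "\<And>z. z \<in> A \<Longrightarrow> norm (z - x) \<le> \<delta> \<Longrightarrow> \<xi> (z - x) \<le> - g z - - g x + \<epsilon> * norm (z - x)"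
    using fsub_onD[OF g] by metis
  have "\<xi> (z - x) \<le> f z - f x + \<epsilon> * norm (z - x)" if "z \<in> A" "norm (z - x) \<le> min d \<delta>" for z
    using \<delta>(2)[of z] min[of z] that by simp
  then show "\<exists>\<delta>>0. \<forall>z\<in>A. norm (z - x) \<le> \<delta> \<longrightarrow> \<xi> (z - x) \<le> f z - f x + \<epsilon> * norm (z - x)"
    using \<open>0 < d\<close> \<delta>(1) by (intro exI[of _ "min d \<delta>"]) auto
qed

lemma fsub_on_add:
  assumes f: "fsub_on A f x \<xi>" and g: "fsub_on A g x \<zeta>"
  shows "fsub_on A (\<lambda>z. f z + g z) x (\<lambda>v. \<xi> v + \<zeta> v)"
proof (rule fsub_onI)
  fix \<epsilon> :: real assume "0 < \<epsilon>"
  then have e: "0 < \<epsilon> / 2" by simp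
  obtain \<delta> where \<delta>: "0 < \<delta>"
    "\<And>z. z \<in> A \<Longrightarrow> norm (z - x) \<le> \<delta> \<Longrightarrow> \<xi> (z - x) \<le> f z - f x + \<epsilon> / 2 * norm (z - x)"
    using fsub_onD[OF f e] by metis
  obtain \<delta>' where \<delta>': "0 < \<delta>'"
    "\<And>z. z \<in> A \<Longrightarrow> norm (z - x) \<le> \<delta>' \<Longrightarrow> \<zeta> (z - x) \<le> g z - g x + \<epsilon> / 2 * norm (z - x)"
    using fsub_onD[OF g e] by metis
  have "\<xi> (z - x) + \<zeta> (z - x) \<le> f z + g z - (f x + g x) + \<epsilon> * norm (z - x)"
    if "z \<in> A" "norm (z - x) \<le> min \<delta> \<delta>'" for z
    using \<delta>(2)[of z] \<delta>'(2)[of z] that by (simp add: field_simps)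
  then show "\<exists>\<delta>>0. \<forall>z\<in>A. norm (z - x) \<le> \<delta> \<longrightarrow>
      \<xi> (z - x) + \<zeta> (z - x) \<le> f z + g z - (f x + g x) + \<epsilon> * norm (z - x)"
    using \<delta>(1) \<delta>'(1) by (intro exI[of _ "min \<delta> \<delta>'"]) auto
qed

lemma fsub_on_zero: "fsub_on A (\<lambda>_. c) x (\<lambda>_. 0)"
  by (rule fsub_onI) (auto intro!: exI[of _ 1])

lemma fsub_on_sum:
  assumes "finite I" "\<And>i. i \<in> I \<Longrightarrow> fsub_on A (f i) x (\<xi> i)"
  shows "fsub_on A (\<lambda>z. \<Sum>i\<in>I. f i z) x (\<lambda>v. \<Sum>i\<in>I. \<xi> i v)"
  using assms by (induction I rule: finite_induct) (simp_all add: fsub_on_zero fsub_on_add)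

lemma fsub_on_cmult:
  assumes f: "fsub_on A f x \<xi>" and "0 \<le> c"
  shows "fsub_on A (\<lambda>z. c * f z) x (\<lambda>v. c * \<xi> v)"
proof (rule fsub_onI)
  fix \<epsilon> :: real assume "0 < \<epsilon>"
  then have e: "0 < \<epsilon> / (c + 1)" using \<open>0 \<le> c\<close> by simp
  obtain \<delta> where \<delta>: "0 < \<delta>"
    "\<And>z. z \<in> A \<Longrightarrow> norm (z - x) \<le> \<delta> \<Longrightarrow> \<xi> (z - x) \<le> f z - f x + \<epsilon> / (c + 1) * norm (z - x)"
    using fsub_onD[OF f e] by metis
  have "c * \<xi> (z - x) \<le> c * f z - c * f x + \<epsilon> * norm (z - x)"
    if "z \<in> A" "norm (z - x) \<le> \<delta>" for z
  proof -
    have "c * (\<epsilon> / (c + 1)) \<le> \<epsilon>" using \<open>0 \<le> c\<close> \<open>0 < \<epsilon>\<close> by (simp add: field_simps)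
    then have "c * (\<epsilon> / (c + 1)) * norm (z - x) \<le> \<epsilon> * norm (z - x)" by (rule mult_right_mono) simp
    with mult_left_mono[OF \<delta>(2)[OF that] \<open>0 \<le> c\<close>] show ?thesis by (simp add: algebra_simps)
  qed
  then show "\<exists>\<delta>>0. \<forall>z\<in>A. norm (z - x) \<le> \<delta> \<longrightarrow> c * \<xi> (z - x) \<le> c * f z - c * f x + \<epsilon> * norm (z - x)"
    using \<delta>(1) by blast
qed

lemma fsub_on_affine:
  assumes sub: "subspace Y" and w: "w \<in> Y" and f: "fsub_on Y f (c *\<^sub>R (x - w)) \<xi>"
  shows "fsub_on Y (\<lambda>z. f (c *\<^sub>R (z - w))) x (\<lambda>v. \<xi> (c *\<^sub>R v))"
proof (rule fsub_onI)
  fix \<epsilon> :: real assume "0 < \<epsilon>"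
  then have e: "0 < \<epsilon> / (\<bar>c\<bar> + 1)" by (simp add: add_nonneg_pos)
  obtain \<delta> where \<delta>: "0 < \<delta>" "\<And>z. z \<in> Y \<Longrightarrow> norm (z - c *\<^sub>R (x - w)) \<le> \<delta> \<Longrightarrow>
      \<xi> (z - c *\<^sub>R (x - w)) \<le> f z - f (c *\<^sub>R (x - w)) + \<epsilon> / (\<bar>c\<bar> + 1) * norm (z - c *\<^sub>R (x - w))"
    using fsub_onD[OF f e] by metis
  have "\<xi> (c *\<^sub>R (z - x)) \<le> f (c *\<^sub>R (z - w)) - f (c *\<^sub>R (x - w)) + \<epsilon> * norm (z - x)"
    if z: "z \<in> Y" "norm (z - x) \<le> \<delta> / (\<bar>c\<bar> + 1)" for z
  proof -
    have eq: "c *\<^sub>R (z - w) - c *\<^sub>R (x - w) = c *\<^sub>R (z - x)" by (simp add: algebra_simps)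
    have "\<bar>c\<bar> * norm (z - x) \<le> (\<bar>c\<bar> + 1) * norm (z - x)" by (simp add: algebra_simps)
    also have "\<dots> \<le> \<delta>" using z(2) by (simp add: field_simps add_nonneg_pos)
    finally have "norm (c *\<^sub>R (z - w) - c *\<^sub>R (x - w)) \<le> \<delta>" unfolding eq by simp
    moreover have "c *\<^sub>R (z - w) \<in> Y" using sub w z(1) by (simp add: subspace_diff subspace_scale)
    ultimately have "\<xi> (c *\<^sub>R (z - x)) \<le> f (c *\<^sub>R (z - w)) - f (c *\<^sub>R (x - w)) + \<epsilon> / (\<bar>c\<bar> + 1) * norm (c *\<^sub>R (z - x))"
      using \<delta>(2)[of "c *\<^sub>R (z - w)"] unfolding eq by simp
    moreover have "\<epsilon> / (\<bar>c\<bar> + 1) * norm (c *\<^sub>R (z - x)) \<le> \<epsilon> * norm (z - x)"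
    proof -
      have "\<epsilon> / (\<bar>c\<bar> + 1) * \<bar>c\<bar> \<le> \<epsilon>"
        using \<open>0 < \<epsilon>\<close> by (simp add: pos_divide_le_eq add_nonneg_pos algebra_simps)
      then have "\<epsilon> / (\<bar>c\<bar> + 1) * \<bar>c\<bar> * norm (z - x) \<le> \<epsilon> * norm (z - x)" by (rule mult_right_mono) simp
      then show ?thesis by (simp add: mult.assoc)
    qed
    ultimately show ?thesis by linarith
  qed
  then show "\<exists>\<delta>>0. \<forall>z\<in>Y. norm (z - x) \<le> \<delta> \<longrightarrow>
      \<xi> (c *\<^sub>R (z - x)) \<le> f (c *\<^sub>R (z - w)) - f (c *\<^sub>R (x - w)) + \<epsilon> * norm (z - x)"
    using \<delta>(1) by (intro exI[of _ "\<delta> / (\<bar>c\<bar> + 1)"]) (auto simp: add_nonneg_pos)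
qed

text \<open>The terms have no common \<open>\<delta>\<close>. The constants \<open>l p\<close> bound
  the tails of functionals and of functions by a small multiple of \<open>norm (z - x)\<close>, a
  quarter of \<open>\<epsilon>\<close> each; the remaining finite sum gets the other half.\<close>

lemma fsub_on_suminf:
  fixes f :: "nat \<Rightarrow> 'a::real_normed_vector \<Rightarrow> real" and \<xi> :: "nat \<Rightarrow> 'a \<Rightarrow>\<^sub>L real"
  assumes x: "x \<in> A" and fs: "\<And>p. fsub_on A (f p) x (blinfun_apply (\<xi> p))"
    and n: "\<And>p. norm (\<xi> p) \<le> l p" and l: "summable l"
    and lip: "\<And>p z. z \<in> A \<Longrightarrow> f p x \<le> f p z + l p * norm (z - x)"
    and sf: "\<And>z. z \<in> A \<Longrightarrow> summable (\<lambda>p. f p z)"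
  shows "fsub_on A (\<lambda>z. \<Sum>p. f p z) x (blinfun_apply (\<Sum>p. \<xi> p))"
    and "norm (\<Sum>p. \<xi> p) \<le> (\<Sum>p. l p)"
proof -
  have snorm: "summable (\<lambda>p. norm (\<xi> p))"
    by (rule summable_comparison_test'[OF l]) (use n in auto)
  then have s\<xi>: "summable \<xi>" by (rule summable_norm_cancel)
  show "norm (\<Sum>p. \<xi> p) \<le> (\<Sum>p. l p)"
    using summable_norm[OF snorm] suminf_le[OF n snorm l] by linarith
  have s\<xi>v: "summable (\<lambda>p. blinfun_apply (\<xi> p) v)" and sum\<xi>v: "blinfun_apply (\<Sum>p. \<xi> p) v = (\<Sum>p. blinfun_apply (\<xi> p) v)" for v
    using bounded_linear.summable[OF blinfun.bounded_linear_left s\<xi>]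
      bounded_linear.suminf[OF blinfun.bounded_linear_left s\<xi>] by (auto)
  show "fsub_on A (\<lambda>z. \<Sum>p. f p z) x (blinfun_apply (\<Sum>p. \<xi> p))"
  proof (rule fsub_onI)
    fix \<epsilon> :: real assume "0 < \<epsilon>"
    then have e: "0 < \<epsilon> / 4" "0 < \<epsilon> / 2" by auto
    obtain N where "\<And>m. m \<ge> N \<Longrightarrow> norm (\<Sum>p. l (p + m)) < \<epsilon> / 4"
      using suminf_exist_split[OF e(1) l] by blast
    from this[OF order_refl] have N: "(\<Sum>p. l (p + N)) < \<epsilon> / 4" by simp
    have lN: "summable (\<lambda>p. l (p + N))" using l by (simp add: summable_iff_shift)
    have "fsub_on A (\<lambda>z. \<Sum>p<N. f p z) x (\<lambda>v. \<Sum>p<N. blinfun_apply (\<xi> p) v)"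
      by (rule fsub_on_sum[OF finite_lessThan fs])
    note fsN = fsub_onD[OF this e(2)]
    obtain \<delta> where \<delta>: "0 < \<delta>" "\<And>z. z \<in> A \<Longrightarrow> norm (z - x) \<le> \<delta> \<Longrightarrow>
      (\<Sum>p<N. blinfun_apply (\<xi> p) (z - x)) \<le> (\<Sum>p<N. f p z) - (\<Sum>p<N. f p x) + \<epsilon> / 2 * norm (z - x)"
      using fsN by metis
    have "blinfun_apply (\<Sum>p. \<xi> p) (z - x) \<le> (\<Sum>p. f p z) - (\<Sum>p. f p x) + \<epsilon> * norm (z - x)"
      if z: "z \<in> A" "norm (z - x) \<le> \<delta>" for z
    proof -
      have t1: "(\<Sum>p. blinfun_apply (\<xi> (p + N)) (z - x)) \<le> (\<Sum>p. l (p + N)) * norm (z - x)"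
      proof -
        have "(\<Sum>p. blinfun_apply (\<xi> (p + N)) (z - x)) \<le> (\<Sum>p. l (p + N) * norm (z - x))"
        proof (rule suminf_le)
          show "blinfun_apply (\<xi> (p + N)) (z - x) \<le> l (p + N) * norm (z - x)" for p
            using blinfun_le[OF n, of "p + N" "z - x"] by simp
        qed (use s\<xi>v[of "z - x"] lN in \<open>simp_all add: summable_iff_shift[where f = "\<lambda>p. blinfun_apply (\<xi> p) (z - x)"] summable_mult2\<close>)
        then show ?thesis using suminf_mult2[OF lN, of "norm (z - x)"] by simp
      qed
      have t2: "(\<Sum>p. f (p + N) x) \<le> (\<Sum>p. f (p + N) z) + (\<Sum>p. l (p + N)) * norm (z - x)"
      proof -
        have sz: "summable (\<lambda>p. f (p + N) z)" and sx: "summable (\<lambda>p. f (p + N) x)"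
          using sf[OF z(1)] sf[OF x]
            summable_iff_shift[of "\<lambda>p. f p z" N] summable_iff_shift[of "\<lambda>p. f p x" N] by auto
        have "(\<Sum>p. f (p + N) x) \<le> (\<Sum>p. f (p + N) z + l (p + N) * norm (z - x))"
          by (rule suminf_le[OF lip[OF z(1)] sx summable_add[OF sz summable_mult2[OF lN]]])
        also have "\<dots> = (\<Sum>p. f (p + N) z) + (\<Sum>p. l (p + N)) * norm (z - x)"
          using suminf_add[OF sz summable_mult2[OF lN, of "norm (z - x)"]] suminf_mult2[OF lN, of "norm (z - x)"] by simp
        finally show ?thesis .
      qed
      have "(\<Sum>p. l (p + N)) * norm (z - x) \<le> \<epsilon> / 4 * norm (z - x)"
        using N by (intro mult_right_mono) auto
      with t1 t2 \<delta>(2)[OF z] show ?thesis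
        unfolding sum\<xi>v suminf_split_initial_segment[OF s\<xi>v, of _ N]
          suminf_split_initial_segment[OF sf[OF z(1)], of N] suminf_split_initial_segment[OF sf[OF x], of N]
        by (simp add: field_simps)
    qed
    then show "\<exists>\<delta>>0. \<forall>z\<in>A. norm (z - x) \<le> \<delta> \<longrightarrow>
        blinfun_apply (\<Sum>p. \<xi> p) (z - x) \<le> (\<Sum>p. f p z) - (\<Sum>p. f p x) + \<epsilon> * norm (z - x)"
      using \<delta>(1) by blast
  qed
qed

text \<open>Difference quotients along \<open>h\<close> and \<open>- h\<close> are at most
  \<open>L * norm h\<close>; the strict inequality for \<open>x\<close> leaves room for a step
  inside the ball.\<close>

lemma fsub_on_lipschitz_bound:
  fixes \<xi> :: "'a::real_normed_vector \<Rightarrow>\<^sub>L real"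
  assumes sub: "subspace Y" and x: "x \<in> Y" "norm (x - c) < r" and "0 \<le> L"
    and lip: "L-lipschitz_on (cball c r) f" and fs: "fsub_on Y f x (blinfun_apply \<xi>)" and h: "h \<in> Y"
  shows "\<bar>blinfun_apply \<xi> h\<bar> \<le> L * norm h"
proof -
  have le: "blinfun_apply \<xi> h \<le> L * norm h" if h: "h \<in> Y" for h
  proof (rule field_le_epsilon)
    fix e :: real assume "0 < e"
    define \<epsilon> where "\<epsilon> = e / (norm h + 1)"
    have \<epsilon>: "0 < \<epsilon>" using \<open>0 < e\<close> by (simp add: \<epsilon>_def add_nonneg_pos)
    have "\<epsilon> * norm h \<le> \<epsilon> * (norm h + 1)" using \<epsilon> by simp
    also have "\<dots> = e"
      using norm_ge_zero[of h] by (simp add: \<epsilon>_def del: norm_ge_zero)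
    finally have e_le: "\<epsilon> * norm h \<le> e" .
    obtain \<delta> where \<delta>: "0 < \<delta>" "\<And>z. z \<in> Y \<Longrightarrow> norm (z - x) \<le> \<delta> \<Longrightarrow>
        blinfun_apply \<xi> (z - x) \<le> f z - f x + \<epsilon> * norm (z - x)"
      using fsub_onD[OF fs \<epsilon>] by metis
    define t where "t = min \<delta> (r - norm (x - c)) / (norm h + 1)"
    have t: "0 < t" using \<delta>(1) x(2) by (simp add: t_def add_nonneg_pos)
    have "t * norm h \<le> t * (norm h + 1)" using t by simp
    also have "\<dots> = min \<delta> (r - norm (x - c))"
      using norm_ge_zero[of h] by (simp add: t_def del: norm_ge_zero)
    finally have tn: "t * norm h \<le> \<delta>" "t * norm h \<le> r - norm (x - c)" by auto
    define z where "z = x + t *\<^sub>R h"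
    have z: "z \<in> Y" "z - x = t *\<^sub>R h" "norm (z - x) = t * norm h"
      using sub x(1) h t by (simp_all add: z_def subspace_add subspace_scale)
    have "z \<in> cball c r" "x \<in> cball c r"
      using norm_triangle_ineq[of "z - x" "x - c"] z(3) tn(2) x(2) by (auto simp: dist_norm norm_minus_commute)
    then have "f z - f x \<le> L * norm (z - x)"
      using lipschitz_onD[OF lip, of z x] by (simp add: dist_norm abs_le_iff)
    then have "blinfun_apply \<xi> (t *\<^sub>R h) \<le> L * (t * norm h) + \<epsilon> * (t * norm h)"
      using \<delta>(2)[OF z(1)] tn(1) t unfolding z(2,3) by simp
    then have "t * blinfun_apply \<xi> h \<le> t * (L * norm h + \<epsilon> * norm h)"
      by (simp add: blinfun.scaleR_right algebra_simps)
    then have "blinfun_apply \<xi> h \<le> L * norm h + \<epsilon> * norm h" using t by simp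
    then show "blinfun_apply \<xi> h \<le> L * norm h + e" using e_le by linarith
  qed
  have "- h \<in> Y" using sub h by (rule subspace_neg)
  from le[OF h] le[OF this] show ?thesis by (simp add: blinfun.minus_right)
qed

text \<open>As in the Borwein--Preiss principle, each \<open>a p\<close> almost minimizes the sum of \<open>F\<close> and the penalties of
  the earlier points.\<close>

lemma perturbed_minimization:
  fixes S :: "'b set" and F :: "'b \<Rightarrow> real" and pen :: "nat \<Rightarrow> 'b \<Rightarrow> 'b \<Rightarrow> real"
  assumes a0: "a0 \<in> S" "\<And>x. x \<in> S \<Longrightarrow> F a0 \<le> F x + \<eta> 0"
    and \<eta>: "\<And>p. 0 < \<eta> p" "\<eta> \<longlonglongrightarrow> 0"
    and pen: "\<And>p a x. 0 \<le> pen p a x" "\<And>p a. pen p a a = 0"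
    and conv: "\<And>a. (\<And>p. a p \<in> S) \<Longrightarrow> (\<And>p q. p \<le> q \<Longrightarrow> pen p (a p) (a q) \<le> \<eta> p) \<Longrightarrow>
      \<exists>x\<in>S. (\<lambda>q. F (a q)) \<longlonglongrightarrow> F x \<and> (\<forall>p. (\<lambda>q. pen p (a p) (a q)) \<longlonglongrightarrow> pen p (a p) x)"
    and sm: "\<And>a x. (\<And>p. a p \<in> S) \<Longrightarrow> x \<in> S \<Longrightarrow> summable (\<lambda>p. pen p (a p) x)"
  obtains a x where "\<And>p. a p \<in> S" "a 0 = a0" "x \<in> S" "\<And>p. pen p (a p) x \<le> \<eta> p"
    "\<And>z. z \<in> S \<Longrightarrow> F x + (\<Sum>p. pen p (a p) x) \<le> F z + (\<Sum>p. pen p (a p) z)"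
proof -
  \<comment> \<open>The state pairs the current perturbed function with its almost minimizer,
    because the next function depends on the point just chosen.\<close>
  define P where "P p t \<longleftrightarrow> snd t \<in> S \<and> (\<forall>x\<in>S. fst t (snd t) \<le> fst t x + \<eta> p) \<and> (p = 0 \<longrightarrow> t = (F, a0))"
    for p and t :: "('b \<Rightarrow> real) \<times> 'b"
  define Q where "Q p t t' \<longleftrightarrow> fst t' = (\<lambda>x. fst t x + pen p (snd t) x) \<and> fst t' (snd t') \<le> fst t' (snd t)"
    for p and t t' :: "('b \<Rightarrow> real) \<times> 'b"
  have "\<exists>t. \<forall>p. P p (t p) \<and> Q p (t p) (t (Suc p))"
  proof (rule dependent_nat_choice)
    show "\<exists>t. P 0 t" using a0 by (auto simp: P_def)
    fix t p assume t: "P p t"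
    define a where "a = snd t"
    define G where "G x = fst t x + pen p a x" for x
    have aS: "a \<in> S" using t by (simp add: P_def a_def)
    have "fst t a - \<eta> p \<le> G x" if "x \<in> S" for x
      using t that pen(1)[of p a x] unfolding P_def a_def G_def by (smt (verit))
    then have bdd: "bdd_below (G ` S)" by (rule bdd_belowI2)
    have "\<exists>b\<in>S. G b < (INF x\<in>S. G x) + \<eta> (Suc p)"
      using cINF_less_iff[OF _ bdd, of "(INF x\<in>S. G x) + \<eta> (Suc p)"] aS \<eta>(1)[of "Suc p"] by auto
    then obtain b where b: "b \<in> S" "G b < (INF x\<in>S. G x) + \<eta> (Suc p)" by blast
    have b': "G b \<le> G x + \<eta> (Suc p)" if "x \<in> S" for x
      using cINF_lower[OF bdd that] b(2) by linarith
    \<comment> \<open>Keeping \<open>a\<close> when \<open>b\<close> is worse makes the perturbed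
      values nonincreasing, which almost minimality alone does not ensure.\<close>
    define c where "c = (if G b \<le> G a then b else a)"
    have "c \<in> S" "G c \<le> G a" "G c \<le> G b"
      using b(1) aS by (auto simp: c_def)
    moreover from this(3) have "G c \<le> G x + \<eta> (Suc p)" if "x \<in> S" for x
      using b'[OF that] by linarith
    ultimately have "P (Suc p) (G, c) \<and> Q p t (G, c)"
      by (auto simp: P_def Q_def a_def G_def)
    then show "\<exists>t'. P (Suc p) t' \<and> Q p t t'" by blast
  qed
  then obtain t where t: "\<And>p. P p (t p)" "\<And>p. Q p (t p) (t (Suc p))" by blast
  define a where "a p = snd (t p)" for p
  define G where "G p x = F x + (\<Sum>j<p. pen j (a j) x)" for p x
  have G: "fst (t p) = G p" for p
  proof (induction p)
    case 0
    then show ?case using t(1)[of 0] by (simp add: P_def G_def)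
  next
    case (Suc p)
    then show ?case using t(2)[of p] by (simp add: Q_def G_def a_def fun_eq_iff)
  qed
  have aS: "a p \<in> S" and a_min: "x \<in> S \<Longrightarrow> G p (a p) \<le> G p x + \<eta> p" for p x
    using t(1)[of p] G[of p] by (auto simp: P_def a_def)
  have a0': "a 0 = a0" using t(1)[of 0] by (simp add: P_def a_def)
  have G_Suc: "G (Suc p) x = G p x + pen p (a p) x" for p x by (simp add: G_def)
  have dec: "G (Suc p) (a (Suc p)) \<le> G p (a p)" for p
    using t(2)[of p] G_Suc[of p "a p"] pen(2)[of p "a p"] unfolding Q_def G a_def[symmetric]
    by (simp add: G_Suc)
  have G_mono: "G p x \<le> G q x" if "p \<le> q" for p q x
    by (rule lift_Suc_mono_le[of "\<lambda>p. G p x", OF _ that]) (simp add: G_Suc pen(1))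
  have decr: "G q (a q) \<le> G p (a p)" if "p \<le> q" for p q
    by (rule lift_Suc_antimono_le[of "\<lambda>p. G p (a p)", OF dec that])
  \<comment> \<open>Later perturbed functions dominate \<open>G (Suc p)\<close> while their values
    at the chosen points decrease. With almost minimality of \<open>a p\<close> this bounds its
    penalty at all later points by \<open>\<eta> p\<close>, which is what \<open>conv\<close> asks
    for.\<close>
  have key: "G (Suc p) (a q) \<le> G p (a p)" if "p \<le> q" for p q
  proof (cases "p = q")
    case True
    then show ?thesis by (simp add: G_Suc pen(2))
  next
    case False
    with that have "Suc p \<le> q" by simp
    then show ?thesis using G_mono[of "Suc p" q "a q"] decr[OF that] by linarith
  qed
  have "pen p (a p) (a q) \<le> \<eta> p" if "p \<le> q" for p q
    using key[OF that] a_min[OF aS, of p q] G_Suc[of p "a q"] by linarith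
  from conv[OF aS this] obtain x where x: "x \<in> S" "(\<lambda>q. F (a q)) \<longlonglongrightarrow> F x"
    "\<And>p. (\<lambda>q. pen p (a p) (a q)) \<longlonglongrightarrow> pen p (a p) x" by blast
  \<comment> \<open>Only finitely many penalties enter \<open>G (Suc p)\<close>, so the limit in
    \<open>q\<close> is taken term by term.\<close>
  have Gx: "G (Suc p) x \<le> G p (a p)" for p
  proof (rule LIMSEQ_le_const2)
    show "(\<lambda>q. G (Suc p) (a q)) \<longlonglongrightarrow> G (Suc p) x"
      unfolding G_def by (intro tendsto_intros x)
    show "\<exists>N. \<forall>q\<ge>N. G (Suc p) (a q) \<le> G p (a p)" using key by blast
  qed
  show ?thesis
  proof
    show "pen p (a p) x \<le> \<eta> p" for p
      using Gx[of p] a_min[OF x(1), of p] G_Suc[of p x] by linarith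
    fix z assume z: "z \<in> S"
    have lim: "(\<lambda>p. G p z) \<longlonglongrightarrow> F z + (\<Sum>p. pen p (a p) z)" if "z \<in> S" for z
      unfolding G_def using summable_LIMSEQ[OF sm[OF aS that]] by (intro tendsto_intros)
    have "(\<lambda>p. G p z + \<eta> p) \<longlonglongrightarrow> F z + (\<Sum>p. pen p (a p) z) + 0"
      by (intro tendsto_add lim z \<eta>)
    then have "(\<lambda>p. G p z + \<eta> p) \<longlonglongrightarrow> F z + (\<Sum>p. pen p (a p) z)" by simp
    moreover have "G p x \<le> G p z + \<eta> p" for p
      using Gx[of p] a_min[OF z, of p] G_Suc[of p x] pen(1)[of p "a p" x] by linarith
    ultimately show "F x + (\<Sum>p. pen p (a p) x) \<le> F z + (\<Sum>p. pen p (a p) z)"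
      by (intro LIMSEQ_le[OF lim[OF x(1)]]) auto
  qed (use aS a0' x(1) in auto)
qed

section \<open>Fuzzy sum rule\<close>

lemma sum_fun_upd:
  fixes g :: "'i \<Rightarrow> 'b \<Rightarrow> 'c::comm_monoid_add"
  assumes "finite J" "i \<in> J"
  shows "(\<Sum>j\<in>J. g j ((x(i := z)) j)) = g i z + (\<Sum>j\<in>J - {i}. g j (x j))"
  using assms by (subst sum.remove[OF assms]) (auto intro: sum.cong)

lemma sum_atMost_split_0:
  fixes g :: "nat \<Rightarrow> 'b::comm_monoid_add"
  shows "(\<Sum>i\<le>n. g i) = g 0 + (\<Sum>i=1..n. g i)"
proof -
  have "{..n} = insert 0 {1..n}" by auto
  then show ?thesis by simp
qed

text \<open>Each \<open>f i\<close> gets its own variable, tied to \<open>x 0\<close> by a penalty.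
  At a minimizer every variable separately minimizes its \<open>f i\<close> plus terms
  differentiable from above. The slopes of the ties cancel in the sum, which leaves those of the
  small perturbations.\<close>

lemma fuzzy_sum_rule_separable:
  fixes f :: "nat \<Rightarrow> 'a::banach \<Rightarrow> real"
  assumes asp: "asplund TYPE('a)" and sub: "subspace Y" and clY: "closed Y"
    and sep: "separable_dual_on Y" and cY: "c \<in> Y" and cA: "c \<in> A" and clA: "closed A"
    and r: "0 < r" and L: "0 \<le> L"
    and lip: "\<And>i. i \<le> n \<Longrightarrow> L-lipschitz_on (cball c r) (f i)"
    and min: "\<And>x. x \<in> A \<Longrightarrow> norm (x - c) \<le> r \<Longrightarrow> (\<Sum>i\<le>n. f i c) \<le> (\<Sum>i\<le>n. f i x)"
    and \<epsilon>: "0 < \<epsilon>"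
  obtains x :: "nat \<Rightarrow> 'a" and \<xi> :: "nat \<Rightarrow> 'a \<Rightarrow>\<^sub>L real" where "\<And>i. i \<le> n \<Longrightarrow> x i \<in> Y"
    "\<And>i. i \<le> n \<Longrightarrow> norm (x i - c) < r" "x 0 \<in> A"
    "\<And>i. i \<le> n \<Longrightarrow> fsub_on ((if i = 0 then A else UNIV) \<inter> Y) (f i) (x i) (blinfun_apply (\<xi> i))"
    "norm (\<Sum>i\<le>n. \<xi> i) \<le> \<epsilon>"
proof (rule smooth_gauge[OF asp sub sep])
  fix \<phi> :: "'a \<Rightarrow> real"
  assume \<phi>_ge0: "\<And>u. 0 \<le> \<phi> u" and \<phi>_0: "\<phi> 0 = 0" and \<phi>_ge: "\<And>u. norm u - 2 \<le> \<phi> u"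
    and \<phi>_lip: "\<And>u w. \<phi> u \<le> \<phi> w + norm (u - w)"
    and \<phi>_sup: "\<And>x. x \<in> Y \<Longrightarrow> \<exists>\<alpha> :: 'a \<Rightarrow>\<^sub>L real. norm \<alpha> \<le> 1 \<and> fsub_on Y (\<lambda>z. - \<phi> z) x (blinfun_apply (- \<alpha>))"
  have \<phi>_le: "\<phi> u \<le> norm u" for u using \<phi>_lip[of u 0] \<phi>_0 by simp
  have "1-lipschitz_on UNIV \<phi>"
  proof (rule lipschitz_onI)
    show "dist (\<phi> u) (\<phi> w) \<le> 1 * dist u w" for u w
      using \<phi>_lip[of u w] \<phi>_lip[of w u] by (simp add: dist_norm norm_minus_commute abs_le_iff)
  qed simp
  then have \<phi>_cont: "continuous_on UNIV \<phi>" by (rule lipschitz_on_continuous_on)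
  \<comment> \<open>The first perturbation is centered at \<open>c\<close> and confines the
    minimizer to distance \<open>3 / s0 = 3 * r / 4\<close>, strictly inside the ball.\<close>
  define s0 where "s0 = 4 / r"
  define s where "s p = s0 * 2^p" for p :: nat
  \<comment> \<open>Perturbation slopes are at most \<open>\<eta> p * s p\<close>, a geometric
    sequence with sum \<open>2 * \<eta>0 * s0\<close>. This choice gives each of the
    \<open>n + 1\<close> variables the share \<open>\<epsilon> / (n + 1)\<close>.\<close>
  define \<eta>0 where "\<eta>0 = \<epsilon> / (2 * s0 * (n + 1))"
  define \<eta> where "\<eta> p = \<eta>0 * (1/4)^p" for p :: nat
  \<comment> \<open>Stiff enough to make the constant configuration \<open>\<eta>0\<close>-minimal:
    at distance \<open>u\<close> the tie is at least \<open>k * u - 2\<close>. Either this exceeds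
    \<open>L * u\<close>, or \<open>(k - L) * u \<le> 2\<close> and then \<open>L * u\<close> is at
    most \<open>\<eta>0 / (n + 1)\<close>.\<close>
  define k where "k = L + 1 + 2 * L * (n + 1) / \<eta>0"
  have s0: "0 < s0" using r by (simp add: s0_def)
  have s: "0 < s p" for p using s0 by (simp add: s_def)
  have \<eta>0: "0 < \<eta>0" using \<epsilon> s0 by (simp add: \<eta>0_def)
  have \<eta>: "0 < \<eta> p" for p using \<eta>0 by (simp add: \<eta>_def)
  have \<eta>_lim: "\<eta> \<longlonglongrightarrow> 0"
    unfolding \<eta>_def by (rule tendsto_mult_right_zero) (rule LIMSEQ_realpow_zero, auto)
  have s_lim: "(\<lambda>p. 3 / s p) \<longlonglongrightarrow> 0"
  proof -
    have "(\<lambda>p. 3 / s0 * (1/2)^p) \<longlonglongrightarrow> 0"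
      by (rule tendsto_mult_right_zero) (rule LIMSEQ_realpow_zero, auto)
    then show ?thesis by (simp add: s_def power_one_over field_simps)
  qed
  define l where "l p = \<eta> p * s p" for p
  have l_eq: "l p = \<eta>0 * s0 * (1/2)^p" for p
  proof -
    have "(1/4 :: real)^p * 2^p = (1/2)^p" by (simp add: power_mult_distrib[symmetric])
    then show ?thesis by (simp add: l_def \<eta>_def s_def mult_ac)
  qed
  have l0: "0 \<le> l p" for p using \<eta>[of p] s[of p] by (simp add: l_def)
  have l_sm: "summable l" unfolding l_eq by (intro summable_mult summable_geometric) simp
  have l_sum: "(\<Sum>p. l p) = \<epsilon> / (n + 1)"
  proof -
    have "(\<Sum>p. l p) = \<eta>0 * s0 * (\<Sum>p. (1/2)^p)"
      unfolding l_eq by (intro suminf_mult summable_geometric) simp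
    also have "(\<Sum>p. (1/2)^p :: real) = 2" by (subst suminf_geometric) auto
    also have "\<eta>0 * s0 * 2 = \<epsilon> / (n + 1)"
    proof -
      have "\<eta>0 * s0 * 2 = \<epsilon> * (2 * s0) / ((n + 1) * (2 * s0))" by (simp add: \<eta>0_def mult_ac)
      also have "\<dots> = \<epsilon> / (n + 1)"
        by (rule mult_divide_mult_cancel_right) (use s0 in simp)
      finally show ?thesis .
    qed
    finally show ?thesis .
  qed
  \<comment> \<open>Minimization stays in \<open>Y\<close>, where \<open>\<phi>\<close> is
    differentiable from above. Coordinates beyond \<open>n\<close> are unconstrained and enter
    neither \<open>F\<close> nor \<open>pen\<close>.\<close>
  define S where "S = {x. (\<forall>i\<le>n. x i \<in> Y \<and> norm (x i - c) \<le> r) \<and> x 0 \<in> A}"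
  define F where "F x = (\<Sum>i\<le>n. f i (x i)) + (\<Sum>i=1..n. \<phi> (k *\<^sub>R (x i - x 0)))" for x
  define pen where "pen p a x = \<eta> p * (\<Sum>i\<le>n. \<phi> (s p *\<^sub>R (x i - a i)))" for p and a x :: "nat \<Rightarrow> 'a"
  \<comment> \<open>The growth \<open>norm u - 2\<close> of the gauge turns a value of at most 1
    into \<open>norm u \<le> 3\<close>. Since \<open>s p\<close> doubles, small penalties force
    Cauchy sequences.\<close>
  have pen_small: "norm (x i - a i) \<le> 3 / s p" if "pen p a x \<le> \<eta> p" "i \<le> n" for p a x i
  proof -
    have "(\<Sum>i\<le>n. \<phi> (s p *\<^sub>R (x i - a i))) \<le> 1" using that(1) \<eta>[of p] by (simp add: pen_def)
    then have "\<phi> (s p *\<^sub>R (x i - a i)) \<le> 1"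
      using member_le_sum[of i "{..n}" "\<lambda>i. \<phi> (s p *\<^sub>R (x i - a i))"] that(2) \<phi>_ge0 by auto
    then have "s p * norm (x i - a i) \<le> 3" using \<phi>_ge[of "s p *\<^sub>R (x i - a i)"] s[of p] by simp
    then show ?thesis using s[of p] by (simp add: field_simps)
  qed
  have term_le: "\<eta> p * \<phi> (s p *\<^sub>R (z - b)) \<le> l p * (norm (z - c) + r)" if "norm (b - c) \<le> r" for p z b
  proof -
    have "\<eta> p * \<phi> (s p *\<^sub>R (z - b)) \<le> \<eta> p * (s p * norm (z - b))"
      using \<phi>_le[of "s p *\<^sub>R (z - b)"] \<eta>[of p] s[of p] by (intro mult_left_mono) auto
    also have "\<dots> = l p * norm (z - b)" by (simp add: l_def)
    also have "\<dots> \<le> l p * (norm (z - c) + r)"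
      using norm_triangle_ineq[of "z - c" "c - b"] that l0[of p]
      by (intro mult_left_mono) (auto simp: norm_minus_commute)
    finally show ?thesis .
  qed
  have term_sm: "summable (\<lambda>p. \<eta> p * \<phi> (s p *\<^sub>R (z - a p)))" if "\<And>p. norm (a p - c) \<le> r" for a z
  proof (rule summable_comparison_test')
    show "summable (\<lambda>p. l p * (norm (z - c) + r))" using l_sm by (rule summable_mult2)
    show "norm (\<eta> p * \<phi> (s p *\<^sub>R (z - a p))) \<le> l p * (norm (z - c) + r)" if "0 \<le> p" for p
      using term_le[OF \<open>\<And>p. norm (a p - c) \<le> r\<close>] \<eta>[of p] \<phi>_ge0[of "s p *\<^sub>R (z - a p)"] by simp
  qed
  have F_low: "F (\<lambda>_. c) \<le> F x + \<eta> 0" if x: "x \<in> S" for x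
  proof -
    have each: "f i (x 0) - \<eta>0 / (n + 1) \<le> f i (x i) + \<phi> (k *\<^sub>R (x i - x 0))" if i: "i \<in> {1..n}" for i
    proof -
      define u where "u = norm (x i - x 0)"
      have "x i \<in> cball c r" "x 0 \<in> cball c r"
        using x i by (auto simp: S_def dist_norm norm_minus_commute)
      then have "f i (x 0) \<le> f i (x i) + L * u"
        using lipschitz_onD[OF lip, of i "x 0" "x i"] i
        by (simp add: dist_norm u_def abs_le_iff norm_minus_commute)
      moreover have "L * u \<le> \<phi> (k *\<^sub>R (x i - x 0)) + \<eta>0 / (n + 1)"
      proof (cases "(k - L) * u \<le> 2")
        case True
        have "2 * L * (n + 1) / \<eta>0 * u \<le> (k - L) * u"
          by (rule mult_right_mono) (simp_all add: k_def u_def)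
        with True have "2 * L * (n + 1) / \<eta>0 * u \<le> 2" by linarith
        then have "L * u \<le> \<eta>0 / (n + 1)" using \<eta>0 by (simp add: field_simps)
        then show ?thesis using \<phi>_ge0[of "k *\<^sub>R (x i - x 0)"] by linarith
      next
        case False
        have "0 \<le> k" using L \<eta>0 by (simp add: k_def)
        then have "k * u - 2 \<le> \<phi> (k *\<^sub>R (x i - x 0))"
          using \<phi>_ge[of "k *\<^sub>R (x i - x 0)"] by (simp add: u_def)
        moreover have "0 \<le> \<eta>0 / (n + 1)" using \<eta>0 by simp
        ultimately show ?thesis using False by (simp add: algebra_simps)
      qed
      ultimately show ?thesis by linarith
    qed
    have "F (\<lambda>_. c) = (\<Sum>i\<le>n. f i c)" by (simp add: F_def \<phi>_0)
    also have "\<dots> \<le> (\<Sum>i\<le>n. f i (x 0))" using x by (intro min) (auto simp: S_def)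
    also have "\<dots> = f 0 (x 0) + (\<Sum>i=1..n. f i (x 0) - \<eta>0 / (n + 1)) + n * (\<eta>0 / (n + 1))"
      by (simp add: sum_atMost_split_0 sum_subtractf)
    also have "(\<Sum>i=1..n. f i (x 0) - \<eta>0 / (n + 1)) \<le> (\<Sum>i=1..n. f i (x i) + \<phi> (k *\<^sub>R (x i - x 0)))"
      by (rule sum_mono) (use each in auto)
    also have "f 0 (x 0) + (\<Sum>i=1..n. f i (x i) + \<phi> (k *\<^sub>R (x i - x 0))) = F x"
      by (simp add: F_def sum_atMost_split_0 sum.distrib)
    also have "n * (\<eta>0 / (n + 1)) \<le> \<eta> 0" using \<eta>0 by (simp add: \<eta>_def field_simps)
    finally show ?thesis by simp
  qed

  \<comment> \<open>Existence of a minimizer of the perturbed decoupled problem\<close>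
  have conv: "\<exists>x\<in>S. (\<lambda>q. F (a q)) \<longlonglongrightarrow> F x \<and> (\<forall>p. (\<lambda>q. pen p (a p) (a q)) \<longlonglongrightarrow> pen p (a p) x)"
    if a: "\<And>p. a p \<in> S" and small: "\<And>p q. p \<le> q \<Longrightarrow> pen p (a p) (a q) \<le> \<eta> p" for a
  proof -
    have aS: "a q i \<in> Y" "norm (a q i - c) \<le> r" "a q 0 \<in> A" if "i \<le> n" for q i
      using a[of q] that by (auto simp: S_def)
    have "convergent (\<lambda>q. a q i)" if i: "i \<le> n" for i
    proof (rule Cauchy_convergent, rule metric_CauchyI)
      fix e :: real assume "0 < e"
      then have "\<forall>\<^sub>F p in sequentially. 3 / s p < e / 2" by (intro order_tendstoD(2)[OF s_lim]) simp
      then obtain N where N: "3 / s N < e / 2" by (auto simp: eventually_sequentially)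
      have "dist (a p i) (a q i) < e" if "N \<le> p" "N \<le> q" for p q
      proof -
        have "norm (a p i - a N i) \<le> 3 / s N" "norm (a q i - a N i) \<le> 3 / s N"
          using pen_small[OF small i] that by blast+
        then show ?thesis
          using N norm_triangle_ineq[of "a p i - a N i" "a N i - a q i"]
          by (simp add: dist_norm norm_minus_commute)
      qed
      then show "\<exists>M. \<forall>p\<ge>M. \<forall>q\<ge>M. dist (a p i) (a q i) < e" by blast
    qed
    define x where "x i = lim (\<lambda>q. a q i)" for i
    have lim: "(\<lambda>q. a q i) \<longlonglongrightarrow> x i" if "i \<le> n" for i
      using \<open>\<And>i. i \<le> n \<Longrightarrow> convergent (\<lambda>q. a q i)\<close>[OF that] by (simp add: x_def convergent_LIMSEQ_iff)
    have xr: "norm (x i - c) \<le> r" if "i \<le> n" for i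
      by (rule LIMSEQ_le_const2[OF tendsto_norm[OF tendsto_diff[OF lim[OF that] tendsto_const]]])
        (use aS[OF that] in auto)
    have xS: "x \<in> S"
      using closed_sequentially[OF clY aS(1) lim] closed_sequentially[OF clA aS(3)[OF le0] lim[OF le0]] xr
      by (auto simp: S_def)
    have \<phi>_tendsto: "(\<lambda>q. \<phi> (g q)) \<longlonglongrightarrow> \<phi> b" if "g \<longlonglongrightarrow> b" for g b
      using continuous_on_tendsto_compose[OF \<phi>_cont that] by simp
    have f_tendsto: "(\<lambda>q. f i (a q i)) \<longlonglongrightarrow> f i (x i)" if i: "i \<le> n" for i
      by (rule continuous_on_tendsto_compose[OF lipschitz_on_continuous_on[OF lip[OF i]] lim[OF i]])
        (use xr[OF i] aS[OF i] in \<open>auto simp: dist_norm norm_minus_commute\<close>)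
    have "(\<lambda>q. F (a q)) \<longlonglongrightarrow> F x"
      unfolding F_def
      by (intro tendsto_add tendsto_sum f_tendsto \<phi>_tendsto tendsto_scaleR tendsto_const tendsto_diff lim) auto
    moreover have "(\<lambda>q. pen p (a p) (a q)) \<longlonglongrightarrow> pen p (a p) x" for p
      unfolding pen_def
      by (intro tendsto_mult tendsto_sum \<phi>_tendsto tendsto_scaleR tendsto_const tendsto_diff lim) auto
    ultimately show ?thesis using xS by blast
  qed
  have cS: "(\<lambda>_. c) \<in> S" using cY cA r by (simp add: S_def)
  have pen_sm: "summable (\<lambda>p. pen p (a p) x)" if "\<And>p. a p \<in> S" for a x
    unfolding pen_def sum_distrib_left
    by (intro summable_sum term_sm) (use that in \<open>auto simp: S_def\<close>)
  obtain a x where aS: "\<And>p. a p \<in> S" and a0: "a 0 = (\<lambda>_. c)" and xS: "x \<in> S"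
    and px: "\<And>p. pen p (a p) x \<le> \<eta> p"
    and xmin: "\<And>z. z \<in> S \<Longrightarrow> F x + (\<Sum>p. pen p (a p) x) \<le> F z + (\<Sum>p. pen p (a p) z)"
  proof (rule perturbed_minimization[where S = S and F = F and pen = pen and \<eta> = \<eta> and ?a0.0 = "\<lambda>_. c"])
    show "0 \<le> pen p a x" for p a x
      unfolding pen_def using \<eta>[of p] by (intro mult_nonneg_nonneg sum_nonneg \<phi>_ge0) auto
    show "pen p a a = 0" for p a by (simp add: pen_def \<phi>_0)
  qed (use cS F_low \<eta> \<eta>_lim conv pen_sm in blast)+
  \<comment> \<open>The perturbation series separates into one function per variable, so the
    variables can be moved one at a time.\<close>
  define \<Psi> where "\<Psi> i z = (\<Sum>p. \<eta> p * \<phi> (s p *\<^sub>R (z - a p i)))" for i z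
  have ar: "norm (a p i - c) \<le> r" "a p i \<in> Y" if "i \<le> n" for p i using aS[of p] that by (auto simp: S_def)
  have pen_sum: "(\<Sum>p. pen p (a p) z) = (\<Sum>i\<le>n. \<Psi> i (z i))" for z
    unfolding pen_def sum_distrib_left \<Psi>_def
    by (rule suminf_sum) (use term_sm ar in auto)
  have xY: "x i \<in> Y" if "i \<le> n" for i using xS that by (simp add: S_def)
  have xr: "norm (x i - c) < r" if "i \<le> n" for i
  proof -
    have "norm (x i - c) \<le> 3 / s 0" using pen_small[OF px[of 0] that] a0 by simp
    also have "\<dots> < r" using r by (simp add: s_def s0_def)
    finally show ?thesis .
  qed

  \<comment> \<open>Slopes of the perturbations and of the ties\<close>
  have "\<exists>\<beta> :: 'a \<Rightarrow>\<^sub>L real. norm \<beta> \<le> \<epsilon> / (n + 1) \<and> fsub_on Y (\<lambda>z. - \<Psi> i z) (x i) (blinfun_apply \<beta>)"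
    if i: "i \<le> n" for i
  proof -
    have "s p *\<^sub>R (x i - a p i) \<in> Y" for p
      using sub xY[OF i] ar(2)[OF i] by (simp add: subspace_scale subspace_diff)
    then have "\<forall>p. \<exists>\<alpha> :: 'a \<Rightarrow>\<^sub>L real. norm \<alpha> \<le> 1 \<and>
        fsub_on Y (\<lambda>z. - \<phi> z) (s p *\<^sub>R (x i - a p i)) (blinfun_apply (- \<alpha>))"
      using \<phi>_sup by blast
    from choice[OF this] obtain \<alpha> :: "nat \<Rightarrow> 'a \<Rightarrow>\<^sub>L real" where \<alpha>: "\<And>p. norm (\<alpha> p) \<le> 1"
      "\<And>p. fsub_on Y (\<lambda>z. - \<phi> z) (s p *\<^sub>R (x i - a p i)) (blinfun_apply (- \<alpha> p))" by blast
    define \<beta> where "\<beta> p = - (l p *\<^sub>R \<alpha> p)" for p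
    define h where "h p z = \<eta> p * - \<phi> (s p *\<^sub>R (z - a p i))" for p z
    have hb: "fsub_on Y (h p) (x i) (blinfun_apply (\<beta> p))" for p
    proof -
      have "fsub_on Y (h p) (x i) (\<lambda>v. \<eta> p * blinfun_apply (- \<alpha> p) (s p *\<^sub>R v))"
        unfolding h_def using \<eta>[of p]
        by (intro fsub_on_cmult fsub_on_affine[OF sub ar(2)[OF i] \<alpha>(2)]) auto
      moreover have "(\<lambda>v. \<eta> p * blinfun_apply (- \<alpha> p) (s p *\<^sub>R v)) = blinfun_apply (\<beta> p)"
        by (simp add: fun_eq_iff \<beta>_def l_def blinfun.minus_left blinfun.scaleR_left blinfun.scaleR_right)
      ultimately show ?thesis by simp
    qed
    have nb: "norm (\<beta> p) \<le> l p" for p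
      using mult_left_mono[OF \<alpha>(1)[of p] l0[of p]] l0[of p] by (simp add: \<beta>_def)
    have lb: "h p (x i) \<le> h p z + l p * norm (z - x i)" for p z
    proof -
      have "s p *\<^sub>R (z - a p i) - s p *\<^sub>R (x i - a p i) = s p *\<^sub>R (z - x i)"
        by (simp add: algebra_simps)
      then have "\<phi> (s p *\<^sub>R (z - a p i)) \<le> \<phi> (s p *\<^sub>R (x i - a p i)) + s p * norm (z - x i)"
        using \<phi>_lip[of "s p *\<^sub>R (z - a p i)" "s p *\<^sub>R (x i - a p i)"] s[of p] by simp
      from mult_left_mono[OF this less_imp_le[OF \<eta>[of p]]] show ?thesis
        by (simp add: h_def l_def algebra_simps)
    qed
    have sb: "summable (\<lambda>p. h p z)" for z
      using summable_minus[OF term_sm[of "\<lambda>p. a p i" z]] ar(1)[OF i] by (simp add: h_def)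
    note res = fsub_on_suminf[OF xY[OF i] hb nb l_sm lb sb]
    have "(\<Sum>p. h p z) = - \<Psi> i z" for z
      using suminf_minus[OF term_sm[of "\<lambda>p. a p i" z]] ar(1)[OF i] by (simp add: h_def \<Psi>_def)
    with res l_sum show ?thesis by (intro exI[of _ "\<Sum>p. \<beta> p"]) simp
  qed
  then obtain \<beta> :: "nat \<Rightarrow> 'a \<Rightarrow>\<^sub>L real" where \<beta>: "\<And>i. i \<le> n \<Longrightarrow> norm (\<beta> i) \<le> \<epsilon> / (n + 1)"
    "\<And>i. i \<le> n \<Longrightarrow> fsub_on Y (\<lambda>z. - \<Psi> i z) (x i) (blinfun_apply (\<beta> i))" by metis
  have "k *\<^sub>R (x j - x 0) \<in> Y" if "j \<le> n" for j
    using sub xY[OF that] xY[of 0] by (simp add: subspace_scale subspace_diff)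
  then have "\<forall>j. \<exists>\<alpha> :: 'a \<Rightarrow>\<^sub>L real. j \<le> n \<longrightarrow> fsub_on Y (\<lambda>z. - \<phi> z) (k *\<^sub>R (x j - x 0)) (blinfun_apply (- \<alpha>))"
    using \<phi>_sup by blast
  from choice[OF this] obtain \<alpha> :: "nat \<Rightarrow> 'a \<Rightarrow>\<^sub>L real" where
    \<alpha>: "\<And>j. j \<le> n \<Longrightarrow> fsub_on Y (\<lambda>z. - \<phi> z) (k *\<^sub>R (x j - x 0)) (blinfun_apply (- \<alpha> j))" by blast
  \<comment> \<open>Moving \<open>x 0\<close> changes every tie, moving \<open>x i\<close> only its
    own and with the opposite sign; so all \<open>\<alpha>\<close> terms cancel in the total
    sum.\<close>
  define \<xi> where "\<xi> i = (if i = 0 then k *\<^sub>R (\<Sum>j=1..n. \<alpha> j) + \<beta> 0 else \<beta> i - k *\<^sub>R \<alpha> i)" for i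
  have xmin': "(\<Sum>j\<le>n. f j (x j)) + (\<Sum>j=1..n. \<phi> (k *\<^sub>R (x j - x 0))) + (\<Sum>j\<le>n. \<Psi> j (x j))
      \<le> (\<Sum>j\<le>n. f j (z j)) + (\<Sum>j=1..n. \<phi> (k *\<^sub>R (z j - z 0))) + (\<Sum>j\<le>n. \<Psi> j (z j))" if "z \<in> S" for z
    using xmin[OF that] unfolding pen_sum F_def .
  have near: "norm (z - c) \<le> r" if "norm (z - x i) \<le> r - norm (x i - c)" for z i
    using norm_triangle_ineq[of "z - x i" "x i - c"] that by simp
  have fs0: "fsub_on (A \<inter> Y) (f 0) (x 0) (blinfun_apply (\<xi> 0))"
  proof (rule fsub_on_of_min)
    show "0 < r - norm (x 0 - c)" using xr[of 0] by simp
    \<comment> \<open>The factor \<open>- k\<close> presents each tie as an affine function of the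
      variable \<open>0\<close> with base point \<open>x j\<close>, the form required by
      \<open>fsub_on_affine\<close>.\<close>
    show "f 0 (x 0) + ((\<Sum>j=1..n. \<phi> (- k *\<^sub>R (x 0 - x j))) + \<Psi> 0 (x 0))
        \<le> f 0 z + ((\<Sum>j=1..n. \<phi> (- k *\<^sub>R (z - x j))) + \<Psi> 0 z)"
      if z: "z \<in> A \<inter> Y" "norm (z - x 0) \<le> r - norm (x 0 - c)" for z
    proof -
      have "x(0 := z) \<in> S" using xS z near[OF z(2)] by (auto simp: S_def)
      from xmin'[OF this]
      have "(\<Sum>j\<le>n. f j (x j)) + (\<Sum>j=1..n. \<phi> (k *\<^sub>R (x j - x 0))) + (\<Sum>j\<le>n. \<Psi> j (x j))
        \<le> f 0 z + (\<Sum>j\<in>{..n} - {0}. f j (x j)) + (\<Sum>j=1..n. \<phi> (k *\<^sub>R (x j - z)))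
          + (\<Psi> 0 z + (\<Sum>j\<in>{..n} - {0}. \<Psi> j (x j)))"
        by (simp add: sum_fun_upd[of "{..n}" 0 f] sum_fun_upd[of "{..n}" 0 \<Psi>] del: fun_upd_apply)
          (simp add: add_ac)
      moreover have "(\<Sum>j\<le>n. f j (x j)) = f 0 (x 0) + (\<Sum>j\<in>{..n} - {0}. f j (x j))"
        "(\<Sum>j\<le>n. \<Psi> j (x j)) = \<Psi> 0 (x 0) + (\<Sum>j\<in>{..n} - {0}. \<Psi> j (x j))"
        by (simp_all add: sum.remove[of "{..n}" 0])
      moreover have "- k *\<^sub>R (w - x j) = k *\<^sub>R (x j - w)" for w j by (simp add: algebra_simps)
      ultimately show ?thesis by simp
    qed
    have "fsub_on Y (\<lambda>z. (\<Sum>j=1..n. - \<phi> (- k *\<^sub>R (z - x j))) + - \<Psi> 0 z) (x 0)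
        (\<lambda>v. (\<Sum>j=1..n. blinfun_apply (- \<alpha> j) (- k *\<^sub>R v)) + blinfun_apply (\<beta> 0) v)"
    proof (intro fsub_on_add fsub_on_sum \<beta>(2))
      fix j assume j: "j \<in> {1..n}"
      then have fj: "fsub_on Y (\<lambda>z. - \<phi> z) (- k *\<^sub>R (x 0 - x j)) (blinfun_apply (- \<alpha> j))"
        using \<alpha>[of j] by (simp add: algebra_simps)
      show "fsub_on Y (\<lambda>z. - \<phi> (- k *\<^sub>R (z - x j))) (x 0) (\<lambda>v. blinfun_apply (- \<alpha> j) (- k *\<^sub>R v))"
        by (rule fsub_on_affine[OF sub xY fj]) (use j in auto)
    qed auto
    moreover have "(\<lambda>v. (\<Sum>j=1..n. blinfun_apply (- \<alpha> j) (- k *\<^sub>R v)) + blinfun_apply (\<beta> 0) v) = blinfun_apply (\<xi> 0)"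
      by (simp add: fun_eq_iff \<xi>_def blinfun.add_left blinfun.scaleR_left blinfun.minus_left
          blinfun.minus_right blinfun.scaleR_right blinfun.sum_left sum_distrib_left)
    moreover have "(\<Sum>j=1..n. - \<phi> (- k *\<^sub>R (z - x j))) + - \<Psi> 0 z = - ((\<Sum>j=1..n. \<phi> (- k *\<^sub>R (z - x j))) + \<Psi> 0 z)" for z
      by (simp add: sum_negf)
    ultimately have "fsub_on Y (\<lambda>z. - ((\<Sum>j=1..n. \<phi> (- k *\<^sub>R (z - x j))) + \<Psi> 0 z)) (x 0) (blinfun_apply (\<xi> 0))"
      by simp
    then show "fsub_on (A \<inter> Y) (\<lambda>z. - ((\<Sum>j=1..n. \<phi> (- k *\<^sub>R (z - x j))) + \<Psi> 0 z)) (x 0) (blinfun_apply (\<xi> 0))"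
      by (rule fsub_on_mono) auto
  qed
  have fsi: "fsub_on Y (f i) (x i) (blinfun_apply (\<xi> i))" if i: "i \<in> {1..n}" for i
  proof (rule fsub_on_of_min)
    show "0 < r - norm (x i - c)" using xr[of i] i by simp
    show "f i (x i) + (\<phi> (k *\<^sub>R (x i - x 0)) + \<Psi> i (x i)) \<le> f i z + (\<phi> (k *\<^sub>R (z - x 0)) + \<Psi> i z)"
      if z: "z \<in> Y" "norm (z - x i) \<le> r - norm (x i - c)" for z
    proof -
      have i': "i \<in> {..n}" "i \<noteq> 0" using i by auto
      have "x(i := z) \<in> S" using xS z near[OF z(2)] i' by (auto simp: S_def)
      from xmin'[OF this]
      have "(\<Sum>j\<le>n. f j (x j)) + (\<Sum>j=1..n. \<phi> (k *\<^sub>R (x j - x 0))) + (\<Sum>j\<le>n. \<Psi> j (x j))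
        \<le> f i z + (\<Sum>j\<in>{..n} - {i}. f j (x j))
          + (\<phi> (k *\<^sub>R (z - x 0)) + (\<Sum>j\<in>{1..n} - {i}. \<phi> (k *\<^sub>R (x j - x 0))))
          + (\<Psi> i z + (\<Sum>j\<in>{..n} - {i}. \<Psi> j (x j)))"
        unfolding sum_fun_upd[OF finite_atMost i'(1), of f] sum_fun_upd[OF finite_atMost i'(1), of \<Psi>]
          fun_upd_other[OF i'(2)[symmetric]]
          sum_fun_upd[OF finite_atLeastAtMost i, of "\<lambda>_ y. \<phi> (k *\<^sub>R (y - x 0))"] .
      moreover have "(\<Sum>j\<le>n. f j (x j)) = f i (x i) + (\<Sum>j\<in>{..n} - {i}. f j (x j))"
        "(\<Sum>j\<le>n. \<Psi> j (x j)) = \<Psi> i (x i) + (\<Sum>j\<in>{..n} - {i}. \<Psi> j (x j))"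
        using i' by (simp_all add: sum.remove[of "{..n}" i])
      moreover have "(\<Sum>j=1..n. \<phi> (k *\<^sub>R (x j - x 0))) = \<phi> (k *\<^sub>R (x i - x 0)) + (\<Sum>j\<in>{1..n} - {i}. \<phi> (k *\<^sub>R (x j - x 0)))"
        by (rule sum.remove) (use i in auto)
      ultimately show ?thesis by linarith
    qed
    have "fsub_on Y (\<lambda>z. - \<phi> (k *\<^sub>R (z - x 0)) + - \<Psi> i z) (x i)
        (\<lambda>v. blinfun_apply (- \<alpha> i) (k *\<^sub>R v) + blinfun_apply (\<beta> i) v)"
      using i by (intro fsub_on_add \<beta>(2) fsub_on_affine[OF sub xY \<alpha>]) auto
    moreover have "(\<lambda>v. blinfun_apply (- \<alpha> i) (k *\<^sub>R v) + blinfun_apply (\<beta> i) v) = blinfun_apply (\<xi> i)"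
      using i by (auto simp: fun_eq_iff \<xi>_def blinfun.diff_left blinfun.scaleR_left blinfun.minus_left
          blinfun.scaleR_right)
    ultimately show "fsub_on Y (\<lambda>z. - (\<phi> (k *\<^sub>R (z - x 0)) + \<Psi> i z)) (x i) (blinfun_apply (\<xi> i))"
      by simp
  qed
  show thesis
  proof
    show "x 0 \<in> A" using xS by (simp add: S_def)
    show "fsub_on ((if i = 0 then A else UNIV) \<inter> Y) (f i) (x i) (blinfun_apply (\<xi> i))" if "i \<le> n" for i
      using fs0 fsi[of i] that by (cases "i = 0") auto
    have "(\<Sum>i\<le>n. \<xi> i) = (\<Sum>i\<le>n. \<beta> i)"
      by (simp add: sum_atMost_split_0 \<xi>_def sum_subtractf scaleR_sum_right)
    also have "norm \<dots> \<le> (\<Sum>i\<le>n. \<epsilon> / (n + 1))" using \<beta>(1) by (intro sum_norm_le) auto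
    also have "\<dots> = \<epsilon>" by simp
    finally show "norm (\<Sum>i\<le>n. \<xi> i) \<le> \<epsilon>" .
  qed (use xY xr in auto)
qed

text \<open>The bound \<open>K\<close> enters the choice of \<open>Y\<close>, so it must not depend
  on \<open>Y\<close>. For \<open>i > 0\<close> it comes from the Lipschitz constant; the functional
  of the set is minus the sum of the others up to \<open>\<epsilon> \<le> 1\<close>. The reduction
  keeps the points and replaces the functionals.\<close>

lemma fuzzy_sum_rule:
  fixes f :: "nat \<Rightarrow> 'a::banach \<Rightarrow> real"
  assumes asp: "asplund TYPE('a)" and cA: "c \<in> A" and clA: "closed A"
    and r: "0 < r" and L: "0 \<le> L"
    and lip: "\<And>i. i \<le> n \<Longrightarrow> L-lipschitz_on (cball c r) (f i)"
    and min: "\<And>x. x \<in> A \<Longrightarrow> norm (x - c) \<le> r \<Longrightarrow> (\<Sum>i\<le>n. f i c) \<le> (\<Sum>i\<le>n. f i x)"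
    and \<epsilon>: "0 < \<epsilon>" "\<epsilon> \<le> 1"
  obtains x :: "nat \<Rightarrow> 'a" and \<xi> :: "nat \<Rightarrow> 'a \<Rightarrow>\<^sub>L real" where
    "\<And>i. i \<le> n \<Longrightarrow> norm (x i - c) < r" "x 0 \<in> A" "\<And>i. i \<le> n \<Longrightarrow> norm (\<xi> i) \<le> real (n + 1) * L + 1"
    "\<And>i. i \<le> n \<Longrightarrow> fsub_on (if i = 0 then A else UNIV) (f i) (x i) (blinfun_apply (\<xi> i))"
    "norm (\<Sum>i\<le>n. \<xi> i) \<le> \<epsilon>"
proof -
  define K where "K = real (n + 1) * L + 1"
  have K: "0 \<le> K" using L by (simp add: K_def)
  show ?thesis
  proof (rule separable_reduction[where K = K and \<epsilon> = \<epsilon> and p = c and n = n and f = f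
        and Dom = "\<lambda>i. if i = 0 then A else UNIV", OF K less_imp_le[OF \<epsilon>(1)]])
    fix Y
    assume Y: "subspace Y" "closed Y" "separable_space (top_of_set Y)" "c \<in> Y"
      and ext: "\<And>x y. \<lbrakk>\<And>i. i \<le> n \<Longrightarrow> x i \<in> Y;
       \<And>i a b. i \<le> n \<Longrightarrow> a \<in> Y \<Longrightarrow> b \<in> Y \<Longrightarrow> y i (a + b) = y i a + y i b;
       \<And>i c a. i \<le> n \<Longrightarrow> a \<in> Y \<Longrightarrow> y i (c *\<^sub>R a) = c * y i a;
       \<And>i a. i \<le> n \<Longrightarrow> a \<in> Y \<Longrightarrow> \<bar>y i a\<bar> \<le> K * norm a;
       \<And>a. a \<in> Y \<Longrightarrow> \<bar>\<Sum>i\<le>n. y i a\<bar> \<le> \<epsilon> * norm a;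
       \<And>i. i \<le> n \<Longrightarrow> fsub_on ((if i = 0 then A else UNIV) \<inter> Y) (f i) (x i) (y i)\<rbrakk> \<Longrightarrow>
     \<exists>\<xi>. (\<forall>i\<le>n. norm (\<xi> i) \<le> K \<and> fsub_on (if i = 0 then A else UNIV) (f i) (x i) (blinfun_apply (\<xi> i))) \<and>
        norm (\<Sum>i\<le>n. \<xi> i) \<le> \<epsilon>"
    have "separable_dual_on Y" using asp Y unfolding asplund_def by blast
    then show ?thesis
    proof (rule fuzzy_sum_rule_separable[OF asp Y(1,2) _ Y(4) cA clA r L lip min \<epsilon>(1)])
      fix x :: "nat \<Rightarrow> 'a" and \<xi> :: "nat \<Rightarrow> 'a \<Rightarrow>\<^sub>L real"
      assume xY: "\<And>i. i \<le> n \<Longrightarrow> x i \<in> Y" and xr: "\<And>i. i \<le> n \<Longrightarrow> norm (x i - c) < r" and xA: "x 0 \<in> A"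
        and fs: "\<And>i. i \<le> n \<Longrightarrow> fsub_on ((if i = 0 then A else UNIV) \<inter> Y) (f i) (x i) (blinfun_apply (\<xi> i))"
        and sm: "norm (\<Sum>i\<le>n. \<xi> i) \<le> \<epsilon>"
      have sm': "\<bar>\<Sum>i\<le>n. blinfun_apply (\<xi> i) h\<bar> \<le> \<epsilon> * norm h" for h
        using blinfun_le[OF sm, of h] by (simp add: blinfun.sum_left)
      have bi: "\<bar>blinfun_apply (\<xi> i) h\<bar> \<le> L * norm h" if "i \<in> {1..n}" "h \<in> Y" for i h
        using that fs[of i] by (intro fsub_on_lipschitz_bound[OF Y(1) xY xr L lip]) auto
      have bd: "\<bar>blinfun_apply (\<xi> i) h\<bar> \<le> K * norm h" if i: "i \<le> n" and h: "h \<in> Y" for i h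
      proof (cases "i = 0")
        case True
        have "\<bar>\<Sum>j=1..n. blinfun_apply (\<xi> j) h\<bar> \<le> (\<Sum>j=1..n. L * norm h)"
          using bi[OF _ h] by (intro order_trans[OF sum_abs] sum_mono) auto
        then have "\<bar>\<Sum>j=1..n. blinfun_apply (\<xi> j) h\<bar> \<le> n * L * norm h" by simp
        moreover have "\<epsilon> * norm h \<le> 1 * norm h" using \<epsilon>(2) by (intro mult_right_mono) auto
        moreover have "0 \<le> L * norm h" using L by simp
        moreover have "K * norm h = n * L * norm h + L * norm h + norm h"
          by (simp add: K_def algebra_simps)
        ultimately show ?thesis
          using sm'[of h] unfolding sum_atMost_split_0[of "\<lambda>i. blinfun_apply (\<xi> i) h"] True by linarith
      next
        case False
        then have "\<bar>blinfun_apply (\<xi> i) h\<bar> \<le> L * norm h" using i h by (intro bi) auto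
        also have "\<dots> \<le> K * norm h"
          using L by (intro mult_right_mono) (auto simp: K_def algebra_simps)
        finally show ?thesis .
      qed
      have "\<exists>\<xi>'. (\<forall>i\<le>n. norm (\<xi>' i) \<le> K \<and> fsub_on (if i = 0 then A else UNIV) (f i) (x i) (blinfun_apply (\<xi>' i))) \<and>
        norm (\<Sum>i\<le>n. \<xi>' i) \<le> \<epsilon>"
        by (rule ext[where y = "\<lambda>i. blinfun_apply (\<xi> i)"])
          (use xY bd sm' fs in \<open>auto simp: blinfun.add_right blinfun.scaleR_right\<close>)
      then obtain \<xi>' where \<xi>': "\<And>i. i \<le> n \<Longrightarrow> norm (\<xi>' i) \<le> K"
        "\<And>i. i \<le> n \<Longrightarrow> fsub_on (if i = 0 then A else UNIV) (f i) (x i) (blinfun_apply (\<xi>' i))"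
        "norm (\<Sum>i\<le>n. \<xi>' i) \<le> \<epsilon>" by blast
      show ?thesis by (rule that[OF xr xA \<xi>'[unfolded K_def]])
    qed
  qed
qed

section \<open>Minimal time functions\<close>

lemma min_time_nonneg: "0 \<le> min_time v \<Omega> x"
  unfolding min_time_def by (rule Inf_greatest) auto

lemma min_time_le: "0 \<le> t \<Longrightarrow> x + t *\<^sub>R v \<in> \<Omega> \<Longrightarrow> min_time v \<Omega> x \<le> ereal t"
  unfolding min_time_def by (rule Inf_lower) auto

lemma real_min_time_le:
  assumes "0 \<le> t" "x + t *\<^sub>R v \<in> \<Omega>"
  shows "real_of_ereal (min_time v \<Omega> x) \<le> t"
  using min_time_le[OF assms] min_time_nonneg[of v \<Omega> x] by (cases "min_time v \<Omega> x") auto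

lemma min_time_attained:
  fixes \<Omega> :: "'a::real_normed_vector set"
  assumes cl: "closed \<Omega>" and fin: "\<bar>min_time v \<Omega> x\<bar> \<noteq> \<infinity>"
  shows "x + real_of_ereal (min_time v \<Omega> x) *\<^sub>R v \<in> \<Omega>"
proof -
  define E where "E = {t. 0 \<le> t \<and> x + t *\<^sub>R v \<in> \<Omega>}"
  have "E \<noteq> {}" using fin by (auto simp: min_time_def E_def[symmetric] top_ereal_def)
  have bdd: "bdd_below E" by (rule bdd_belowI[of _ 0]) (auto simp: E_def)
  have "closed E"
  proof -
    have "closed ((\<lambda>t. x + t *\<^sub>R v) -` \<Omega>)"
      by (intro closed_vimage cl continuous_intros)
    moreover have "E = {0..} \<inter> (\<lambda>t. x + t *\<^sub>R v) -` \<Omega>" by (auto simp: E_def)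
    ultimately show ?thesis by (simp add: closed_Int)
  qed
  then have "Inf E \<in> E" using closed_contains_Inf \<open>E \<noteq> {}\<close> bdd by blast
  moreover have "min_time v \<Omega> x = ereal (Inf E)"
    using ereal_Inf'[OF bdd \<open>E \<noteq> {}\<close>] by (simp add: min_time_def E_def)
  ultimately show ?thesis by (simp add: E_def)
qed

lemma fsub_on_direction:
  fixes \<xi> :: "'a::real_normed_vector \<Rightarrow>\<^sub>L real"
  assumes fs: "fsub_on UNIV f x (blinfun_apply \<xi>)" and "0 < t0"
    and le: "\<And>t. 0 < t \<Longrightarrow> t \<le> t0 \<Longrightarrow> f (x + t *\<^sub>R v) \<le> f x + c * t"
  shows "blinfun_apply \<xi> v \<le> c"
proof (rule field_le_epsilon)
  fix e :: real assume "0 < e"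
  have nv: "0 < norm v + 1" by (simp add: add_nonneg_pos)
  define \<epsilon> where "\<epsilon> = e / (norm v + 1)"
  have \<epsilon>: "0 < \<epsilon>" using \<open>0 < e\<close> nv by (simp add: \<epsilon>_def)
  have "\<epsilon> * norm v \<le> \<epsilon> * (norm v + 1)" using \<epsilon> by simp
  also have "\<dots> = e" using nv by (simp add: \<epsilon>_def)
  finally have e_le: "\<epsilon> * norm v \<le> e" .
  obtain \<delta> where \<delta>: "0 < \<delta>" "\<And>z. norm (z - x) \<le> \<delta> \<Longrightarrow> blinfun_apply \<xi> (z - x) \<le> f z - f x + \<epsilon> * norm (z - x)"
    using fsub_onD[OF fs \<epsilon>] by (metis UNIV_I)
  define t where "t = min t0 (\<delta> / (norm v + 1))"
  have t: "0 < t" "t \<le> t0" using \<open>0 < t0\<close> \<delta>(1) nv by (auto simp: t_def)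
  have "t * norm v \<le> \<delta> / (norm v + 1) * (norm v + 1)"
    using nv t by (intro mult_mono) (auto simp: t_def)
  also have "\<dots> = \<delta>" using nv by simp
  finally have "blinfun_apply \<xi> (t *\<^sub>R v) \<le> f (x + t *\<^sub>R v) - f x + \<epsilon> * (t * norm v)"
    using \<delta>(2)[of "x + t *\<^sub>R v"] t by simp
  with le[OF t] have "t * blinfun_apply \<xi> v \<le> t * (c + \<epsilon> * norm v)"
    by (simp add: blinfun.scaleR_right algebra_simps)
  then have "blinfun_apply \<xi> v \<le> c + \<epsilon> * norm v" using t by simp
  then show "blinfun_apply \<xi> v \<le> c + e" using e_le by linarith
qed

text \<open>The translate of \<open>\<Omega>\<close> by \<open>- (\<tau> x *\<^sub>R v)\<close>
  contains \<open>x\<close>, and the time on it is at most \<open>\<tau> x\<close>, so the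
  subgradient inequality becomes that of a Frechet normal. Stepping back by \<open>t\<close> raises
  the time by at most \<open>t\<close>; stepping forward lowers it by at least \<open>t\<close>
  while \<open>t \<le> \<tau> x\<close>, which needs positive time.\<close>

lemma min_time_subgradient:
  fixes \<Omega> :: "'a::real_normed_vector set" and v x :: 'a
  defines "\<tau> \<equiv> \<lambda>y. real_of_ereal (min_time v \<Omega> y)"
  assumes cl: "closed \<Omega>" and fin: "\<bar>min_time v \<Omega> x\<bar> \<noteq> \<infinity>"
    and fs: "fsub_on UNIV \<tau> x (blinfun_apply \<xi>)"
  shows "\<xi> \<in> frechet_normal_cone (x + \<tau> x *\<^sub>R v) \<Omega>" "blinfun_apply \<xi> (- v) \<le> 1"
    "0 < \<tau> x \<Longrightarrow> blinfun_apply \<xi> v = - 1"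
proof -
  have hit: "x + \<tau> x *\<^sub>R v \<in> \<Omega>" unfolding \<tau>_def using cl fin by (rule min_time_attained)
  have \<tau>0: "0 \<le> \<tau> x" unfolding \<tau>_def using min_time_nonneg by (rule real_of_ereal_pos)
  have \<tau>_le: "\<tau> y \<le> t" if "0 \<le> t" "y + t *\<^sub>R v \<in> \<Omega>" for y t
    unfolding \<tau>_def using that by (rule real_min_time_le)
  show "\<xi> \<in> frechet_normal_cone (x + \<tau> x *\<^sub>R v) \<Omega>"
    unfolding frechet_normal_cone_def
  proof (intro CollectI conjI hit allI impI)
    fix \<epsilon> :: real assume "0 < \<epsilon>"
    then obtain \<delta> where \<delta>: "0 < \<delta>" "\<And>z. norm (z - x) \<le> \<delta> \<Longrightarrow>
        blinfun_apply \<xi> (z - x) \<le> \<tau> z - \<tau> x + \<epsilon> * norm (z - x)"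
      using fsub_onD[OF fs] by (metis UNIV_I)
    have "blinfun_apply \<xi> (w - (x + \<tau> x *\<^sub>R v)) \<le> \<epsilon> * norm (w - (x + \<tau> x *\<^sub>R v))"
      if w: "w \<in> \<Omega>" "norm (w - (x + \<tau> x *\<^sub>R v)) \<le> \<delta>" for w
    proof -
      have eq: "w - \<tau> x *\<^sub>R v - x = w - (x + \<tau> x *\<^sub>R v)" by simp
      have "\<tau> (w - \<tau> x *\<^sub>R v) \<le> \<tau> x" using \<tau>0 w(1) by (intro \<tau>_le) auto
      with \<delta>(2)[of "w - \<tau> x *\<^sub>R v"] w(2) show ?thesis unfolding eq by simp
    qed
    then show "\<exists>\<delta>>0. \<forall>w\<in>\<Omega>. norm (w - (x + \<tau> x *\<^sub>R v)) \<le> \<delta> \<longrightarrow>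
        blinfun_apply \<xi> (w - (x + \<tau> x *\<^sub>R v)) \<le> \<epsilon> * norm (w - (x + \<tau> x *\<^sub>R v))"
      using \<delta>(1) by blast
  qed
  show le1: "blinfun_apply \<xi> (- v) \<le> 1"
  proof (rule fsub_on_direction[OF fs zero_less_one])
    fix t :: real assume t: "0 < t"
    have eq: "x + t *\<^sub>R (- v) + (\<tau> x + t) *\<^sub>R v = x + \<tau> x *\<^sub>R v" by (simp add: algebra_simps)
    show "\<tau> (x + t *\<^sub>R (- v)) \<le> \<tau> x + 1 * t"
      using \<tau>_le[of "\<tau> x + t" "x + t *\<^sub>R (- v)", unfolded eq] hit t \<tau>0 by simp
  qed
  assume pos: "0 < \<tau> x"
  have "blinfun_apply \<xi> v \<le> - 1"
  proof (rule fsub_on_direction[OF fs pos])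
    fix t assume t: "0 < t" "t \<le> \<tau> x"
    have eq: "x + t *\<^sub>R v + (\<tau> x - t) *\<^sub>R v = x + \<tau> x *\<^sub>R v" by (simp add: algebra_simps)
    show "\<tau> (x + t *\<^sub>R v) \<le> \<tau> x + - 1 * t"
      using \<tau>_le[of "\<tau> x - t" "x + t *\<^sub>R v", unfolded eq] hit t by simp
  qed
  with le1 show "blinfun_apply \<xi> v = - 1" by (simp add: blinfun.minus_right)
qed

text \<open>All indices share one subsequence, so that a relation between the functionals, such as a
  small sum, survives in the limit.\<close>

lemma asplund_weak_star_subseq_family:
  fixes \<xi> :: "nat \<Rightarrow> nat \<Rightarrow> 'a::banach \<Rightarrow>\<^sub>L real"
  assumes asp: "asplund TYPE('a)" and bd: "\<And>k i. i < m \<Longrightarrow> norm (\<xi> k i) \<le> K"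
  shows "\<exists>r \<zeta>. strict_mono r \<and> (\<forall>i<m. weak_star_tendsto (\<lambda>k. \<xi> (r k) i) (\<zeta> i))"
  using bd
proof (induction m)
  case 0
  then show ?case by (intro exI[of _ id]) (auto simp: strict_mono_def)
next
  case (Suc m)
  then obtain r \<zeta> where r: "strict_mono r" "\<And>i. i < m \<Longrightarrow> weak_star_tendsto (\<lambda>k. \<xi> (r k) i) (\<zeta> i)"
    by (meson less_SucI)
  obtain s z where s: "strict_mono s" "weak_star_tendsto ((\<lambda>k. \<xi> (r k) m) \<circ> s) z"
    by (rule asplund_weak_star_subseq[OF asp, of "\<lambda>k. \<xi> (r k) m" K]) (use Suc.prems in auto)
  have "weak_star_tendsto (\<lambda>k. \<xi> ((r \<circ> s) k) i) ((\<zeta>(m := z)) i)" if "i < Suc m" for i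
  proof (cases "i = m")
    case True
    then show ?thesis using s(2) by (simp add: comp_def)
  next
    case False
    with that have "i < m" by simp
    from r(2)[OF this] have "weak_star_tendsto (\<lambda>k. \<xi> (r (s k)) i) (\<zeta> i)"
      unfolding weak_star_tendsto_def using LIMSEQ_subseq_LIMSEQ[OF _ s(1)] by (fastforce simp: comp_def)
    with False show ?thesis by simp
  qed
  moreover have "strict_mono (r \<circ> s)" using r(1) s(1) by (rule strict_mono_o)
  ultimately show ?case by blast
qed

theorem theorem5p3:
  fixes n :: nat
    and \<Omega> :: "nat \<Rightarrow> 'a::banach set"
    and v :: "nat \<Rightarrow> 'a"
    and xbar :: 'a
  assumes "asplund TYPE('a)"
    and "\<And>i. i \<le> n \<Longrightarrow> \<Omega> i \<noteq> {} \<and> closed (\<Omega> i)"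
    and "\<And>i. i \<in> {1..n} \<Longrightarrow> v i \<noteq> 0"
    and "optimal_solution (total_time n v \<Omega>) (\<Omega> 0) xbar"
    and "\<And>i. i \<in> {1..n} \<Longrightarrow> lipschitz_around (min_time (v i) (\<Omega> i)) xbar"
  shows "\<exists>\<xi> :: nat \<Rightarrow> 'a \<Rightarrow>\<^sub>L real.
    (\<forall>i\<in>{1..n}. \<xi> i \<in> limiting_normal_cone
        (xbar + real_of_ereal (min_time (v i) (\<Omega> i) xbar) *\<^sub>R v i) (\<Omega> i)) \<and>
    (\<forall>i\<in>idx_in n \<Omega> xbar. blinfun_apply (\<xi> i) (- v i) \<le> 1) \<and>
    (\<forall>j\<in>idx_out n \<Omega> xbar. blinfun_apply (\<xi> j) (v j) = - 1) \<and>
    - (\<Sum>i=1..n. \<xi> i) \<in> limiting_normal_cone xbar (\<Omega> 0)"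
proof -
  define \<tau> where "\<tau> i y = real_of_ereal (min_time (v i) (\<Omega> i) y)" for i y
  have cl: "closed (\<Omega> i)" if "i \<le> n" for i using assms(2)[OF that] by simp
  have x0: "xbar \<in> \<Omega> 0" using assms(4) by (simp add: optimal_solution_def)
  define Q where "Q i \<delta> L \<longleftrightarrow> 0 < \<delta> \<and> (\<forall>y\<in>ball xbar \<delta>. \<bar>min_time (v i) (\<Omega> i) y\<bar> \<noteq> \<infinity>) \<and>
      L-lipschitz_on (ball xbar \<delta>) (\<tau> i)" for i \<delta> L
  have "\<exists>\<delta> L. Q i \<delta> L" if "i \<in> {1..n}" for i
    using assms(5)[OF that] unfolding lipschitz_around_def Q_def \<tau>_def by blast
  then have "\<forall>i\<in>{1..n}. \<exists>p. Q i (fst p) (snd p)" by auto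
  from bchoice[OF this] obtain p where p: "\<forall>i\<in>{1..n}. Q i (fst (p i)) (snd (p i))" ..
  define \<delta> M where "\<delta> i = fst (p i)" and "M i = snd (p i)" for i
  have Q: "Q i (\<delta> i) (M i)" if "i \<in> {1..n}" for i
    using p that by (simp add: \<delta>_def M_def)
  have \<delta>: "0 < \<delta> i"
    and fin\<delta>: "y \<in> ball xbar (\<delta> i) \<Longrightarrow> \<bar>min_time (v i) (\<Omega> i) y\<bar> \<noteq> \<infinity>"
    and lip\<delta>: "(M i)-lipschitz_on (ball xbar (\<delta> i)) (\<tau> i)" if "i \<in> {1..n}" for i y
    using Q[OF that] unfolding Q_def by simp_all
  \<comment> \<open>Halving fits a closed ball into all the open ones; the inserted \<open>1\<close>
    covers \<open>n = 0\<close>.\<close>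
  define r where "r = Min (insert 1 (\<delta> ` {1..n})) / 2"
  have "0 < Min (insert 1 (\<delta> ` {1..n}))" using \<delta> by (subst Min_gr_iff) auto
  then have r: "0 < r" by (simp add: r_def)
  have r\<delta>: "r < \<delta> i" if "i \<in> {1..n}" for i
  proof -
    have "Min (insert 1 (\<delta> ` {1..n})) \<le> \<delta> i" using that by (intro Min_le) auto
    with \<delta>[OF that] r show ?thesis unfolding r_def by linarith
  qed
  define L where "L = (\<Sum>i=1..n. \<bar>M i\<bar>)"
  have L: "0 \<le> L" by (simp add: L_def sum_nonneg)
  have sub\<delta>: "cball xbar r \<subseteq> ball xbar (\<delta> i)" if "i \<in> {1..n}" for i
    using r\<delta>[OF that] by auto
  have fin: "\<bar>min_time (v i) (\<Omega> i) y\<bar> \<noteq> \<infinity>" if "i \<in> {1..n}" "y \<in> cball xbar r" for i y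
    by (rule fin\<delta>[OF that(1) subsetD[OF sub\<delta>[OF that(1)] that(2)]])
  \<comment> \<open>Index \<open>0\<close> carries the constraint: a Frechet subgradient of zero
    relative to \<open>\<Omega> 0\<close> is a Frechet normal.\<close>
  define f where "f i = (if i = 0 then (\<lambda>_. 0) else \<tau> i)" for i
  have lip: "L-lipschitz_on (cball xbar r) (f i)" if "i \<le> n" for i
  proof (cases "i = 0")
    case True
    then show ?thesis using L by (auto simp: f_def lipschitz_on_def)
  next
    case False
    with that have i: "i \<in> {1..n}" by simp
    have "M i \<le> L" unfolding L_def
      using member_le_sum[of i "{1..n}" "\<lambda>i. \<bar>M i\<bar>"] i by auto
    then show ?thesis
      using lipschitz_on_mono[OF lip\<delta>[OF i] sub\<delta>[OF i]] False by (simp add: f_def)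
  qed
  have total: "total_time n v \<Omega> y = ereal (\<Sum>i\<le>n. f i y)" if "y \<in> cball xbar r" for y
  proof -
    have "total_time n v \<Omega> y = (\<Sum>i=1..n. ereal (\<tau> i y))"
      unfolding total_time_def using fin[OF _ that] by (intro sum.cong) (auto simp: \<tau>_def ereal_real)
    also have "\<dots> = ereal (\<Sum>i=1..n. \<tau> i y)" by simp
    also have "(\<Sum>i=1..n. \<tau> i y) = (\<Sum>i\<le>n. f i y)" by (simp add: sum_atMost_split_0 f_def)
    finally show ?thesis .
  qed
  have min: "(\<Sum>i\<le>n. f i xbar) \<le> (\<Sum>i\<le>n. f i x)" if "x \<in> \<Omega> 0" "norm (x - xbar) \<le> r" for x
  proof -
    have "total_time n v \<Omega> xbar \<le> total_time n v \<Omega> x"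
      using assms(4) that(1) by (simp add: optimal_solution_def)
    then show ?thesis
      using total[of xbar] total[of x] that(2) r by (simp add: dist_norm norm_minus_commute)
  qed
  \<comment> \<open>Independent of \<open>k\<close>, as weak* compactness requires, although radius
    and tolerance shrink with \<open>k\<close>.\<close>
  define K where "K = real (n + 1) * L + 1"
  define P where "P k x \<xi> \<longleftrightarrow> (\<forall>i\<le>n. norm (x i - xbar) < min r (inverse (Suc k)) \<and> norm (\<xi> i) \<le> K \<and>
      fsub_on (if i = 0 then \<Omega> 0 else UNIV) (f i) (x i) (blinfun_apply (\<xi> i))) \<and> x 0 \<in> \<Omega> 0 \<and>
      norm (\<Sum>i\<le>n. \<xi> i) \<le> inverse (Suc k)" for k :: nat and x and \<xi> :: "nat \<Rightarrow> 'a \<Rightarrow>\<^sub>L real"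
  have "\<exists>x \<xi>. P k x \<xi>" for k
  proof (rule fuzzy_sum_rule[where A = "\<Omega> 0" and c = xbar and f = f and n = n and L = L
        and r = "min r (inverse (Suc k))" and \<epsilon> = "inverse (Suc k)"])
    show "L-lipschitz_on (cball xbar (min r (inverse (Suc k)))) (f i)" if "i \<le> n" for i
      by (rule lipschitz_on_subset[OF lip[OF that]]) auto
    show "(\<Sum>i\<le>n. f i xbar) \<le> (\<Sum>i\<le>n. f i x)" if "x \<in> \<Omega> 0" "norm (x - xbar) \<le> min r (inverse (Suc k))" for x
      using that by (intro min) auto
    show "\<exists>x \<xi>. P k x \<xi>" if "\<And>i. i \<le> n \<Longrightarrow> norm (x i - xbar) < min r (inverse (Suc k))" "x 0 \<in> \<Omega> 0"
      "\<And>i. i \<le> n \<Longrightarrow> norm (\<xi> i) \<le> real (n + 1) * L + 1"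
      "\<And>i. i \<le> n \<Longrightarrow> fsub_on (if i = 0 then \<Omega> 0 else UNIV) (f i) (x i) (blinfun_apply (\<xi> i))"
      "norm (\<Sum>i\<le>n. \<xi> i) \<le> inverse (Suc k)" for x \<xi>
      using that unfolding P_def K_def by blast
    show "inverse (real (Suc k)) \<le> 1" by (simp add: field_simps)
  qed (use assms(1) x0 cl[of 0] r L in auto)
  then obtain X \<Xi> where P: "\<And>k. P k (X k) (\<Xi> k)" by metis
  have X: "norm (X k i - xbar) < min r (inverse (Suc k))" and \<Xi>: "norm (\<Xi> k i) \<le> K"
    and fs: "fsub_on (if i = 0 then \<Omega> 0 else UNIV) (f i) (X k i) (blinfun_apply (\<Xi> k i))" if "i \<le> n" for k i
    using P[of k] that by (simp_all add: P_def)
  have X0: "X k 0 \<in> \<Omega> 0" and sum\<Xi>: "norm (\<Sum>i\<le>n. \<Xi> k i) \<le> inverse (Suc k)" for k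
    using P[of k] by (simp_all add: P_def)

  \<comment> \<open>Passage to the limit\<close>
  have "\<exists>s \<zeta>. strict_mono s \<and> (\<forall>i<Suc n. weak_star_tendsto (\<lambda>k. \<Xi> (s k) i) (\<zeta> i))"
    by (rule asplund_weak_star_subseq_family[OF assms(1), of _ _ K]) (use \<Xi> in auto)
  then obtain s \<zeta> where s: "strict_mono s"
    and "\<forall>i<Suc n. weak_star_tendsto (\<lambda>k. \<Xi> (s k) i) (\<zeta> i)" by blast
  then have \<zeta>: "weak_star_tendsto (\<lambda>k. \<Xi> (s k) i) (\<zeta> i)" if "i \<le> n" for i
    using that by (simp add: less_Suc_eq_le)
  have inv_s: "(\<lambda>k. inverse (real (Suc (s k)))) \<longlonglongrightarrow> 0"
    using LIMSEQ_subseq_LIMSEQ[OF LIMSEQ_inverse_real_of_nat s] by (simp add: comp_def)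
  have Xlim: "(\<lambda>k. X (s k) i) \<longlonglongrightarrow> xbar" if "i \<le> n" for i
  proof -
    have "norm (X (s k) i - xbar) \<le> inverse (real (Suc (s k)))" for k
      using X[OF that, of "s k"] by linarith
    then have "(\<lambda>k. X (s k) i - xbar) \<longlonglongrightarrow> 0"
      by (intro Lim_null_comparison[OF always_eventually inv_s]) blast
    then show ?thesis by (simp add: LIM_zero_iff)
  qed
  have Xr: "X k i \<in> cball xbar r" if "i \<le> n" for k i
    using X[OF that, of k] by (simp add: dist_norm norm_minus_commute)
  have \<tau>lim: "(\<lambda>k. \<tau> i (X (s k) i)) \<longlonglongrightarrow> \<tau> i xbar" if i: "i \<in> {1..n}" for i
  proof -
    have "continuous_on (cball xbar r) (\<tau> i)"
      using lipschitz_on_continuous_on[OF lip[of i]] i by (simp add: f_def split: if_splits)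
    then show ?thesis
    proof (rule continuous_on_tendsto_compose)
      show "(\<lambda>k. X (s k) i) \<longlonglongrightarrow> xbar" using i by (intro Xlim) simp
      show "\<forall>\<^sub>F k in sequentially. X (s k) i \<in> cball xbar r"
        by (intro always_eventually allI Xr) (use i in simp)
    qed (use r in simp)
  qed
  have fs\<tau>: "fsub_on UNIV (\<lambda>y. real_of_ereal (min_time (v i) (\<Omega> i) y)) (X k i) (blinfun_apply (\<Xi> k i))"
    if "i \<in> {1..n}" for i k
    using fs[of i k] that by (simp add: f_def \<tau>_def[abs_def])
  have sg: "\<Xi> k i \<in> frechet_normal_cone (X k i + \<tau> i (X k i) *\<^sub>R v i) (\<Omega> i)"
    "blinfun_apply (\<Xi> k i) (- v i) \<le> 1" "0 < \<tau> i (X k i) \<Longrightarrow> blinfun_apply (\<Xi> k i) (v i) = - 1"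
    if i: "i \<in> {1..n}" for i k
    unfolding \<tau>_def
    using min_time_subgradient[OF _ _ fs\<tau>[OF i, of k]] cl[of i] fin[OF i Xr[of i k]] i by auto
  have hit: "xbar + \<tau> i xbar *\<^sub>R v i \<in> \<Omega> i" if "i \<in> {1..n}" for i
    unfolding \<tau>_def using cl[of i] fin[OF that, of xbar] that r by (intro min_time_attained) auto
  have ap: "(\<lambda>k. blinfun_apply (\<Xi> (s k) i) h) \<longlonglongrightarrow> blinfun_apply (\<zeta> i) h" if "i \<le> n" for i h
    using \<zeta>[OF that] by (simp add: weak_star_tendsto_def)
  show ?thesis
  proof (intro exI[of _ \<zeta>] conjI ballI)
    fix i assume i: "i \<in> {1..n}"
    show "\<zeta> i \<in> limiting_normal_cone (xbar + real_of_ereal (min_time (v i) (\<Omega> i) xbar) *\<^sub>R v i) (\<Omega> i)"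
      unfolding limiting_normal_cone_def \<tau>_def[symmetric]
    proof (intro CollectI conjI hit[OF i] exI)
      \<comment> \<open>The normals live at the points hit from \<open>X (s k) i\<close>; these
        converge because the time is continuous near \<open>xbar\<close>.\<close>
      show "(\<lambda>k. X (s k) i + \<tau> i (X (s k) i) *\<^sub>R v i) \<longlonglongrightarrow> xbar + \<tau> i xbar *\<^sub>R v i"
        using Xlim[of i] \<tau>lim[OF i] i by (intro tendsto_intros) auto
      show "\<forall>k. X (s k) i + \<tau> i (X (s k) i) *\<^sub>R v i \<in> \<Omega> i \<and>
          \<Xi> (s k) i \<in> frechet_normal_cone (X (s k) i + \<tau> i (X (s k) i) *\<^sub>R v i) (\<Omega> i)"
        using sg(1)[OF i] by (auto simp: frechet_normal_cone_def)
      show "weak_star_tendsto (\<lambda>k. \<Xi> (s k) i) (\<zeta> i)" using \<zeta> i by simp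
    qed
  next
    fix i assume "i \<in> idx_in n \<Omega> xbar"
    then have i: "i \<in> {1..n}" by (simp add: idx_in_def)
    show "blinfun_apply (\<zeta> i) (- v i) \<le> 1"
      by (rule LIMSEQ_le_const2[OF ap]) (use sg(2)[OF i] i in auto)
  next
    fix j assume "j \<in> idx_out n \<Omega> xbar"
    then have j: "j \<in> {1..n}" "xbar \<notin> \<Omega> j" by (simp_all add: idx_out_def)
    have "0 \<le> \<tau> j xbar" unfolding \<tau>_def using min_time_nonneg by (rule real_of_ereal_pos)
    \<comment> \<open>At time zero the point hit would be \<open>xbar\<close> itself, which is
      outside \<open>\<Omega> j\<close>. Positivity spreads to nearby points by continuity, so the
      equality holds eventually along the sequence.\<close>
    moreover have "\<tau> j xbar \<noteq> 0" using hit[OF j(1)] j(2) by auto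
    ultimately have "0 < \<tau> j xbar" by simp
    then have "\<forall>\<^sub>F k in sequentially. 0 < \<tau> j (X (s k) j)" by (rule order_tendstoD(1)[OF \<tau>lim[OF j(1)]])
    then have "\<forall>\<^sub>F k in sequentially. blinfun_apply (\<Xi> (s k) j) (v j) = - 1"
      by (rule eventually_mono) (rule sg(3)[OF j(1)])
    then have "(\<lambda>k. blinfun_apply (\<Xi> (s k) j) (v j)) \<longlonglongrightarrow> - 1" by (rule tendsto_eventually)
    then show "blinfun_apply (\<zeta> j) (v j) = - 1"
      using ap[of j "v j"] j(1) by (intro LIMSEQ_unique) auto
  next
    \<comment> \<open>The approximate sums tend to zero in norm, so the functional of the constraint
      is exactly minus the sum of the others in the limit.\<close>
    have "(\<Sum>i\<le>n. \<zeta> i) = 0"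
    proof (rule blinfun_eqI)
      fix h
      have "(\<lambda>k. \<Sum>i\<le>n. blinfun_apply (\<Xi> (s k) i) h) \<longlonglongrightarrow> (\<Sum>i\<le>n. blinfun_apply (\<zeta> i) h)"
        by (intro tendsto_sum ap) auto
      moreover have "(\<lambda>k. \<Sum>i\<le>n. blinfun_apply (\<Xi> (s k) i) h) \<longlonglongrightarrow> 0"
      proof (rule Lim_null_comparison)
        show "\<forall>\<^sub>F k in sequentially. norm (\<Sum>i\<le>n. blinfun_apply (\<Xi> (s k) i) h) \<le> inverse (Suc (s k)) * norm h"
          using blinfun_le[OF sum\<Xi>, of _ h] by (simp add: blinfun.sum_left)
        show "(\<lambda>k. inverse (real (Suc (s k))) * norm h) \<longlonglongrightarrow> 0"
          using inv_s by (rule tendsto_mult_left_zero)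
      qed
      ultimately show "blinfun_apply (\<Sum>i\<le>n. \<zeta> i) h = blinfun_apply 0 h"
        using LIMSEQ_unique by (force simp: blinfun.sum_left)
    qed
    then have \<zeta>0: "- (\<Sum>i=1..n. \<zeta> i) = \<zeta> 0"
      by (simp add: sum_atMost_split_0 neg_eq_iff_add_eq_0 add.commute)
    show "- (\<Sum>i=1..n. \<zeta> i) \<in> limiting_normal_cone xbar (\<Omega> 0)"
      unfolding \<zeta>0 limiting_normal_cone_def
    proof (intro CollectI conjI x0 exI)
      show "(\<lambda>k. X (s k) 0) \<longlonglongrightarrow> xbar" by (rule Xlim) simp
      show "weak_star_tendsto (\<lambda>k. \<Xi> (s k) 0) (\<zeta> 0)" by (rule \<zeta>) simp
      show "\<forall>k. X (s k) 0 \<in> \<Omega> 0 \<and> \<Xi> (s k) 0 \<in> frechet_normal_cone (X (s k) 0) (\<Omega> 0)"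
        using fs[of 0] X0 by (simp add: frechet_normal_cone_def fsub_on_def f_def)
    qed
  qed
qed

end
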